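(* There exist absolute constants $c_0>0$ and $C>0$ such that the following holds. Let $f=\frac1N\sum_{i=1}^N f_i$ on $\mathbb R^d$, where each $f_i$ is $\beta$-smooth and the $f_i$ have $(G,B)$-bounded gradient dissimilarity ($G\ge 0$, $B\ge 1$). Let each client have a stochastic data oracle with variance bound $\sigma^2$ and a biased quantum gradient oracle with bias bound $U_q$ and variance bound $\sigma_q^2$. Assume $f^\star:=\inf_x f(x)>-\infty$ and set $F:=f(x^0)-f^\star$. Run quantum FedAvg from $x^0$ for $R\ge 1$ rounds with step sizes satisfying $$\eta_\ell\le\frac{c_0}{(1+B^2)\beta K\eta_g},\qquad \eta_g\ge 1,$$ let $\widetilde\eta:=\eta_g\eta_\ell K$, and let $\bar x^R$ be chosen uniformly at random from $\{x^0,\dots,x^{R-1}\}$. Then $$\mathbb E\|\nabla f(\bar x^R)\|^2\le C\left(\frac{F}{\widetilde\eta R}+\beta\widetilde\eta\left(\frac{G^2}{S}+\frac{\sigma^2+\sigma_q^2}{KS}\right)+\beta^2\eta_\ell^2K^2\left(G^2+\sigma^2+\sigma_q^2\right)+U_q^2\right).$$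
   Context: An absolute constant is a numerical constant not depending on any problem or algorithm parameter. There are $N\ge1$ clients with differentiable objectives $f_i:\mathbb R^d\to\mathbb R$, and $f:=\frac1N\sum_{i=1}^N f_i$. Integers $1\le S\le N$, $K\ge1$; step sizes $\eta_\ell,\eta_g>0$. Assumption terminology: - $\beta$-smooth: $\|\nabla f_i(x)-\nabla f_i(y)\|\le\beta\|x-y\|$ for all $x,y$. - $(G,B)$-bounded gradient dissimilarity: $\frac1N\sum_{i=1}^N\|\nabla f_i(x)\|^2\le G^2+B^2\|\nabla f(x)\|^2$ for all $x$. - Stochastic data oracle with variance bound $\sigma^2$: random $g_i(x;\xi)$ with $\mathbb E_\xi[g_i(x;\xi)\mid x]=\nabla f_i(x)$ and $\mathbb E_\xi[\|g_i(x;\xi)-\nabla f_i(x)\|^2\mid x]\le\sigma^2$. - Biased quantum gradient oracle with bias bound $U_q$ and variance bound $\sigma_q^2$: a random estimator $\widetilde g_i(x;\xi)$ (with additional quantum randomness, expectation $\mathbb E_q$) such that $\mathbb E_q[\widetilde g_i(x;\xi)\mid x,\xi]=g_i(x;\xi)+b_{q,i}(x)$, where $\|b_{q,i}(x)\|\le U_q$ for all $i,x$, and $\mathbb E_q[\|\widetilde g_i(x;\xi)-\mathbb E_q[\widetilde g_i(x;\xi)\mid x,\xi]\|^2\mid x,\xi]\le\sigma_q^2$. Quantum FedAvg: at round $r=1,2,\dots$ the server samples $\mathcal S_r\subseteq\{1,\dots,N\}$ with $|\mathcal S_r|=S$ uniformly without replacement. Each client $i\in\mathcal S_r$ sets $y_{i,0}^r=x^{r-1}$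 and performs $y_{i,k+1}^r=y_{i,k}^r-\eta_\ell\widetilde g_i(y_{i,k}^r;\xi_{i,k}^r)$ for $k=0,\dots,K-1$. The server sets $x^r=x^{r-1}+\eta_g\frac1S\sum_{i\in\mathcal S_r}(y_{i,K}^r-x^{r-1})$. Oracle calls use fresh randomness, independent across clients, local steps and rounds, and independent of the client sampling. *)

theory Defs
  imports "HOL-Probability.Probability"
begin

definition gradient :: "('a::euclidean_space \<Rightarrow> real) \<Rightarrow> 'a \<Rightarrow> 'a" where
  "gradient f x = (THE D. GDERIV f x :> D)"

definition global_objective :: "nat \<Rightarrow> (nat \<Rightarrow> 'a \<Rightarrow> real) \<Rightarrow> 'a \<Rightarrow> real" where
  "global_objective N f x = (1 / real N) * (\<Sum>i = 1..N. f i x)"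

definition beta_smooth :: "real \<Rightarrow> ('a::euclidean_space \<Rightarrow> real) \<Rightarrow> bool" where
  "beta_smooth \<beta> f \<longleftrightarrow>
     (\<forall>x. f differentiable (at x)) \<and>
     (\<forall>x y. norm (gradient f x - gradient f y) \<le> \<beta> * norm (x - y))"

definition bounded_gradient_dissimilarity ::
  "real \<Rightarrow> real \<Rightarrow> nat \<Rightarrow> (nat \<Rightarrow> 'a::euclidean_space \<Rightarrow> real) \<Rightarrow> bool" where
  "bounded_gradient_dissimilarity G B N f \<longleftrightarrow>
     (\<forall>x. (1 / real N) * (\<Sum>i = 1..N. (norm (gradient (f i) x))\<^sup>2)
            \<le> G\<^sup>2 + B\<^sup>2 * (norm (gradient (global_objective N f) x))\<^sup>2)"

text \<open>
  The oracles of a single client. A data sample has law \<open>D\<close>, and the additional quantum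
  randomness of one oracle call has law \<open>Q\<close>; both live on arbitrary probability spaces.
  For fixed \<open>x\<close>, the expectation over the data is the integral over \<open>D\<close>, and the
  expectation over the quantum randomness given \<open>x\<close> and \<open>\<xi>\<close> is the integral over \<open>Q\<close>.
  Second moments are stated with the nonnegative integral, so that a bound includes finiteness.
\<close>

definition stochastic_oracle ::
  "'x measure \<Rightarrow> ('a::euclidean_space \<Rightarrow> real) \<Rightarrow> ('a \<Rightarrow> 'x \<Rightarrow> 'a) \<Rightarrow> real \<Rightarrow> bool" where
  "stochastic_oracle D f g v \<longleftrightarrow>
     prob_space D \<and>
     (\<lambda>(x, \<xi>). g x \<xi>) \<in> borel_measurable (borel \<Otimes>\<^sub>M D) \<and>
     (\<forall>x. has_bochner_integral D (\<lambda>\<xi>. g x \<xi>) (gradient f x)) \<and>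
     (\<forall>x. (\<integral>\<^sup>+\<xi>. ennreal ((norm (g x \<xi> - gradient f x))\<^sup>2) \<partial>D) \<le> ennreal v)"

definition biased_quantum_oracle ::
  "'x measure \<Rightarrow> 'q measure \<Rightarrow> ('a::euclidean_space \<Rightarrow> 'x \<Rightarrow> 'a) \<Rightarrow>
   ('a \<Rightarrow> 'x \<Rightarrow> 'q \<Rightarrow> 'a) \<Rightarrow> real \<Rightarrow> real \<Rightarrow> bool" where
  "biased_quantum_oracle D Q g gq U v \<longleftrightarrow>
     prob_space Q \<and>
     (\<lambda>(x, \<xi>, \<zeta>). gq x \<xi> \<zeta>) \<in> borel_measurable (borel \<Otimes>\<^sub>M (D \<Otimes>\<^sub>M Q)) \<and>
     (\<exists>b. (\<forall>x. norm (b x) \<le> U) \<and>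
          (\<forall>x. AE \<xi> in D. has_bochner_integral Q (\<lambda>\<zeta>. gq x \<xi> \<zeta>) (g x \<xi> + b x))) \<and>
     (\<forall>x. AE \<xi> in D.
        (\<integral>\<^sup>+\<zeta>. ennreal ((norm (gq x \<xi> \<zeta> - (\<integral>\<zeta>'. gq x \<xi> \<zeta>' \<partial>Q)))\<^sup>2) \<partial>Q) \<le> ennreal v)"

text \<open>
  The iterates for given realisations of the randomness: \<open>local_iterate\<close> takes the
  samples of one client in one round, indexed by the local step, and starts from \<open>x\<close>.
\<close>

primrec local_iterate ::
  "real \<Rightarrow> ('a::euclidean_space \<Rightarrow> 'x \<Rightarrow> 'q \<Rightarrow> 'a) \<Rightarrow> (nat \<Rightarrow> 'x) \<Rightarrow> (nat \<Rightarrow> 'q) \<Rightarrow>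
   'a \<Rightarrow> nat \<Rightarrow> 'a" where
  "local_iterate \<eta> gq \<xi> \<zeta> x 0 = x"
| "local_iterate \<eta> gq \<xi> \<zeta> x (Suc k) =
     local_iterate \<eta> gq \<xi> \<zeta> x k - \<eta> *\<^sub>R gq (local_iterate \<eta> gq \<xi> \<zeta> x k) (\<xi> k) (\<zeta> k)"

primrec server_iterate ::
  "nat \<Rightarrow> nat \<Rightarrow> real \<Rightarrow> real \<Rightarrow> (nat \<Rightarrow> 'a::euclidean_space \<Rightarrow> 'x \<Rightarrow> 'q \<Rightarrow> 'a) \<Rightarrow>
   (nat \<Rightarrow> nat set) \<Rightarrow> (nat \<Rightarrow> nat \<Rightarrow> nat \<Rightarrow> 'x) \<Rightarrow> (nat \<Rightarrow> nat \<Rightarrow> nat \<Rightarrow> 'q) \<Rightarrow>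
   'a \<Rightarrow> nat \<Rightarrow> 'a" where
  "server_iterate S K \<eta>l \<eta>g gq A \<xi> \<zeta> x0 0 = x0"
| "server_iterate S K \<eta>l \<eta>g gq A \<xi> \<zeta> x0 (Suc r) =
     (let x = server_iterate S K \<eta>l \<eta>g gq A \<xi> \<zeta> x0 r in
      x + (\<eta>g * (1 / real S)) *\<^sub>R
        (\<Sum>i\<in>A (Suc r). local_iterate \<eta>l (gq i) (\<xi> (Suc r) i) (\<zeta> (Suc r) i) x K - x))"

definition has_law :: "'w measure \<Rightarrow> 'b measure \<Rightarrow> ('w \<Rightarrow> 'b) \<Rightarrow> bool" where
  "has_law M L X \<longleftrightarrow> X \<in> measurable M L \<and> distr M L X = L"

text \<open>
  The random draws of a run: the sampled client set of a round, the data sample and the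
  quantum randomness of a call (round, client, local step), and the round index that selects
  the output. They take values in different types, so their mutual independence is
  expressed by the independence of the \<open>\<sigma>\<close>-algebras they generate. Samples exist also for the
  clients that are not selected in a round; they do not influence the iterates.
\<close>

datatype draw = Output | Sampling nat | Data nat nat nat | Quantum nat nat nat

definition draws :: "nat \<Rightarrow> nat \<Rightarrow> nat \<Rightarrow> draw set" where
  "draws N K R = {Output} \<union> {Sampling r | r. r \<in> {1..R}} \<union>
     {Data r i k | r i k. r \<in> {1..R} \<and> i \<in> {1..N} \<and> k < K} \<union>
     {Quantum r i k | r i k. r \<in> {1..R} \<and> i \<in> {1..N} \<and> k < K}"

definition client_subsets :: "nat \<Rightarrow> nat \<Rightarrow> nat set set" where
  "client_subsets N S = {A. A \<subseteq> {1..N} \<and> card A = S}"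

definition fedavg_randomness ::
  "nat \<Rightarrow> nat \<Rightarrow> nat \<Rightarrow> nat \<Rightarrow> (nat \<Rightarrow> 'x measure) \<Rightarrow> (nat \<Rightarrow> 'q measure) \<Rightarrow> 'w measure \<Rightarrow>
   (nat \<Rightarrow> 'w \<Rightarrow> nat set) \<Rightarrow> (nat \<Rightarrow> nat \<Rightarrow> nat \<Rightarrow> 'w \<Rightarrow> 'x) \<Rightarrow>
   (nat \<Rightarrow> nat \<Rightarrow> nat \<Rightarrow> 'w \<Rightarrow> 'q) \<Rightarrow> ('w \<Rightarrow> nat) \<Rightarrow> bool" where
  "fedavg_randomness N S K R D Q M A \<xi> \<zeta> \<tau> \<longleftrightarrow>
     prob_space M \<and>
     has_law M (uniform_count_measure {..<R}) \<tau> \<and>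
     (\<forall>r\<in>{1..R}. has_law M (uniform_count_measure (client_subsets N S)) (A r)) \<and>
     (\<forall>r\<in>{1..R}. \<forall>i\<in>{1..N}. \<forall>k<K.
        has_law M (D i) (\<xi> r i k) \<and> has_law M (Q i) (\<zeta> r i k)) \<and>
     prob_space.indep_sets M
       (\<lambda>d. case d of
          Output \<Rightarrow> sets (vimage_algebra (space M) \<tau> (uniform_count_measure {..<R}))
        | Sampling r \<Rightarrow>
            sets (vimage_algebra (space M) (A r) (uniform_count_measure (client_subsets N S)))
        | Data r i k \<Rightarrow> sets (vimage_algebra (space M) (\<xi> r i k) (D i))
        | Quantum r i k \<Rightarrow> sets (vimage_algebra (space M) (\<zeta> r i k) (Q i)))
       (draws N K R)"

text \<open>
  The convergence theorem speaks about the Euclidean spaces of all dimensions, where the dimension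
  is that of a type, and type variables are quantified outside of the whole proposition. A bare
  \<open>\<exists>c0 C\<close> would therefore allow constants that depend on the dimension. The
  existential carries the bounds \<open>1 / 1000 \<le> c0\<close> and \<open>C \<le> 1000\<close> for this
  reason only: since the claim stays true when \<open>c0\<close> is decreased and \<open>C\<close>
  increased, they make the one pair \<open>1 / 1000\<close>, \<open>1000\<close> serve all types.
\<close>

end

theory Submission
  imports Defs
begin

text \<open>
  A round moves the server by \<open>- (\<eta>g * \<eta>l / S)\<close> times the sum of the gradient estimates of the sampled
  clients. Split an estimate at the local iterate \<open>y\<close>, for the server iterate \<open>x\<close>, into the conditionally
  centred noise, the error \<open>h\<^sub>i(y) - \<nabla>f\<^sub>i(x)\<close> of the conditional mean \<open>h\<^sub>i\<close>, and \<open>\<nabla>f\<^sub>i(x)\<close>. The noises of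
  different calls are orthogonal, which produces the factor \<open>1 / (K S)\<close>; the error is at most the bias
  plus \<open>\<beta>\<close> times the client drift \<open>\<parallel>y - x\<parallel>\<close>, which is of the order \<open>\<eta>l * K\<close>; and sampling without
  replacement gives the third part the variance \<open>(G\<^sup>2 + B\<^sup>2 \<parallel>\<nabla>f\<parallel>\<^sup>2) / S\<close>. Inserted into the descent
  inequality of the smooth function \<open>f\<close>, these bounds leave a fixed fraction of \<open>\<eta> \<parallel>\<nabla>f(x)\<parallel>\<^sup>2\<close> because the
  step size absorbs the terms with \<open>\<parallel>\<nabla>f\<parallel>\<^sup>2\<close>, and the inequality telescopes over the rounds.
\<close>

section \<open>Smooth objectives\<close>

text \<open>The iterates are explicit functions of the draws, so product measures replace
  conditional expectations: a draw that is \<open>fresh\<close> relative to a sigma-algebra can be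
  integrated first, with everything measurable there frozen. These sigma-algebras are generated by
  chosen sets of draws, which turns every independence claim into a question of set inclusion.
  Because the sampled set is random, all clients are imagined to run locally, and a selection
  indicator, independent of those runs, cuts the sum down afterwards. The bias cannot be averaged
  away; it is put into the error, which may be correlated and enters only through the inequalities
  of Young and Cauchy-Schwarz. Absolute constants are free and are spent: the descent inequality has
  \<beta> in place of \<open>\<beta> / 2\<close>, combining data and quantum variance costs a factor
  2, and drift is bounded without orthogonality. With the step-size constant 1/1000, the terms in
  the squared gradient norm that must be absorbed add up to at most 28/1000 of it, while 1/4 of it
  is available.\<close>

lemma GDERIV_imp_gradient:
  assumes "GDERIV f x :> D"
  shows "gradient f x = D"
  unfolding gradient_def
proof (rule the_equality)
  fix D' assume "GDERIV f x :> D'"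
  then have "(\<lambda>h. h \<bullet> D') = (\<lambda>h. h \<bullet> D)"
    using assms unfolding gderiv_def by (rule has_derivative_unique)
  \<comment> \<open>\<open>gradient\<close> is a definite description, so everything rests on
    uniqueness: the two linear forms are tested on the difference of the vectors that represent
    them.\<close>
  then have "(D' - D) \<bullet> D' = (D' - D) \<bullet> D" by metis
  then have "(D' - D) \<bullet> (D' - D) = 0" by (simp add: inner_diff_right)
  then show "D' = D" by simp
qed (fact assms)

text \<open>Riesz representation in coordinates: the vector is assembled from the values of the
  derivative on the basis.\<close>

lemma differentiable_imp_GDERIV:
  fixes f :: "'a::euclidean_space \<Rightarrow> real"
  assumes "f differentiable (at x)"
  shows "GDERIV f x :> gradient f x"
proof -
  obtain f' where f': "(f has_derivative f') (at x)"
    using assms by (auto simp: differentiable_def)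
  then interpret f': bounded_linear f' by (rule has_derivative_bounded_linear)
  have "f' = (\<lambda>h. h \<bullet> (\<Sum>b\<in>Basis. f' b *\<^sub>R b))"
  proof
    fix h
    have "f' h = f' (\<Sum>b\<in>Basis. (h \<bullet> b) *\<^sub>R b)" by (simp add: euclidean_representation)
    also have "\<dots> = h \<bullet> (\<Sum>b\<in>Basis. f' b *\<^sub>R b)"
      by (simp add: f'.sum f'.scaleR inner_sum_right mult.commute)
    finally show "f' h = h \<bullet> (\<Sum>b\<in>Basis. f' b *\<^sub>R b)" .
  qed
  with f' have "GDERIV f x :> (\<Sum>b\<in>Basis. f' b *\<^sub>R b)"
    unfolding gderiv_def by simp
  then show ?thesis using GDERIV_imp_gradient by metis
qed

text \<open>A Euclidean space has a unit vector, and the Lipschitz inequality between it and the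
  origin forces the sign, which \<open>beta_smooth\<close> does not state.\<close>

lemma beta_smooth_nonneg:
  fixes f :: "'a::euclidean_space \<Rightarrow> real"
  assumes "beta_smooth \<beta> f"
  shows "0 \<le> \<beta>"
proof -
  define b :: 'a where "b = (SOME b. b \<in> Basis)"
  then have b: "b \<in> Basis" by (simp add: SOME_Basis)
  have "0 \<le> norm (gradient f b - gradient f 0)" by simp
  also have "\<dots> \<le> \<beta> * norm (b - 0)" using assms unfolding beta_smooth_def by blast
  finally show ?thesis using b by simp
qed

lemma beta_smooth_lipschitz:
  "beta_smooth \<beta> f \<Longrightarrow> norm (gradient f x - gradient f y) \<le> \<beta> * norm (x - y)"
  by (simp add: beta_smooth_def)

lemma beta_smooth_gradient_measurable:
  assumes "beta_smooth \<beta> f"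
  shows "gradient f \<in> borel_measurable borel"
proof (rule borel_measurable_continuous_onI)
  have "\<beta>-lipschitz_on UNIV (gradient f)"
    using assms beta_smooth_nonneg[OF assms] by (auto simp: lipschitz_on_def dist_norm beta_smooth_def)
  then show "continuous_on UNIV (gradient f)" by (rule lipschitz_on_continuous_on)
qed

lemma beta_smooth_linear_growth:
  assumes "beta_smooth \<beta> f"
  shows "norm (gradient f x) \<le> norm (gradient f 0) + \<beta> * norm x"
  using beta_smooth_lipschitz[OF assms, of x 0] norm_triangle_sub[of "gradient f x" "gradient f 0"] by simp

lemma GDERIV_global_objective:
  fixes f :: "nat \<Rightarrow> 'a::euclidean_space \<Rightarrow> real"
  assumes "\<And>i. i \<in> {1..N} \<Longrightarrow> f i differentiable (at x)"
  shows "GDERIV (global_objective N f) x :> (1 / real N) *\<^sub>R (\<Sum>i=1..N. gradient (f i) x)"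
proof -
  have "((\<lambda>y. \<Sum>i=1..N. f i y) has_derivative (\<lambda>h. \<Sum>i=1..N. h \<bullet> gradient (f i) x)) (at x)"
    using differentiable_imp_GDERIV[OF assms] by (intro has_derivative_sum) (auto simp: gderiv_def)
  then have "((\<lambda>y. (1 / real N) * (\<Sum>i=1..N. f i y)) has_derivative
      (\<lambda>h. (1 / real N) * (\<Sum>i=1..N. h \<bullet> gradient (f i) x))) (at x)"
    by (rule has_derivative_mult_right)
  then show ?thesis
    by (simp add: gderiv_def global_objective_def[abs_def] inner_sum_right)
qed

lemma gradient_global_objective:
  fixes f :: "nat \<Rightarrow> 'a::euclidean_space \<Rightarrow> real"
  assumes "\<And>i. i \<in> {1..N} \<Longrightarrow> beta_smooth \<beta> (f i)"
  shows "gradient (global_objective N f) x = (1 / real N) *\<^sub>R (\<Sum>i=1..N. gradient (f i) x)"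
  by (intro GDERIV_imp_gradient GDERIV_global_objective) (use assms in \<open>auto simp: beta_smooth_def\<close>)

lemma beta_smooth_global_objective:
  fixes f :: "nat \<Rightarrow> 'a::euclidean_space \<Rightarrow> real"
  assumes "\<And>i. i \<in> {1..N} \<Longrightarrow> beta_smooth \<beta> (f i)" "1 \<le> N"
  shows "beta_smooth \<beta> (global_objective N f)"
  unfolding beta_smooth_def
proof (intro conjI allI)
  fix x show "global_objective N f differentiable (at x)"
    using GDERIV_global_objective[of N f x] assms
    by (auto simp: beta_smooth_def gderiv_def differentiable_def)
next
  fix x y
  have grad: "gradient (global_objective N f) z = (1 / real N) *\<^sub>R (\<Sum>i=1..N. gradient (f i) z)" for z
    using assms(1) by (rule gradient_global_objective)
  have "norm (\<Sum>i=1..N. gradient (f i) x - gradient (f i) y) \<le> (\<Sum>i=1..N. \<beta> * norm (x - y))"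
    using assms by (intro sum_norm_le) (auto simp: beta_smooth_def)
  then have "norm ((1 / real N) *\<^sub>R (\<Sum>i=1..N. gradient (f i) x - gradient (f i) y))
      \<le> \<beta> * norm (x - y)"
    using assms(2) by (simp add: field_simps)
  then show "norm (gradient (global_objective N f) x - gradient (global_objective N f) y) \<le> \<beta> * norm (x - y)"
    by (simp only: grad sum_subtractf scaleR_diff_right)
qed

text \<open>Mean value theorem on the segment from \<open>x\<close> to \<open>x + d\<close>: the
  gradient at the intermediate point is within \<open>\<beta> * norm d\<close> of the gradient at
  \<open>x\<close>. The two-sided form also supplies the quadratic growth behind
  \<open>obj_integrable\<close>.\<close>

lemma beta_smooth_descent:
  fixes f :: "'a::euclidean_space \<Rightarrow> real"
  assumes "beta_smooth \<beta> f"
  shows "\<bar>f (x + d) - f x - gradient f x \<bullet> d\<bar> \<le> \<beta> * (norm d)\<^sup>2"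
proof -
  have D: "(f has_derivative (\<lambda>h. h \<bullet> gradient f z)) (at z)" for z
    using differentiable_imp_GDERIV[of f z] assms by (simp add: beta_smooth_def gderiv_def)
  have "\<exists>t\<in>{0..1}. f (x + 1 *\<^sub>R d) - f (x + 0 *\<^sub>R d)
      = (\<lambda>t h. (h *\<^sub>R d) \<bullet> gradient f (x + t *\<^sub>R d)) t (1 - 0)"
  proof (rule mvt_very_simple)
    fix t :: real
    have "((\<lambda>t. x + t *\<^sub>R d) has_derivative (\<lambda>h. h *\<^sub>R d)) (at t within {0..1})"
      by (auto intro!: derivative_eq_intros)
    from has_derivative_in_compose[OF this has_derivative_at_withinI[OF D]]
    show "((\<lambda>t. f (x + t *\<^sub>R d)) has_derivative (\<lambda>h. (h *\<^sub>R d) \<bullet> gradient f (x + t *\<^sub>R d)))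
        (at t within {0..1})" .
  qed simp
  then obtain t where t: "0 \<le> t" "t \<le> 1" and eq: "f (x + d) - f x = d \<bullet> gradient f (x + t *\<^sub>R d)"
    by auto
  have "\<bar>f (x + d) - f x - gradient f x \<bullet> d\<bar> = \<bar>d \<bullet> (gradient f (x + t *\<^sub>R d) - gradient f x)\<bar>"
    by (simp add: eq inner_diff_right inner_commute)
  also have "\<dots> \<le> norm d * norm (gradient f (x + t *\<^sub>R d) - gradient f x)"
    by (rule Cauchy_Schwarz_ineq2)
  also have "\<dots> \<le> norm d * (\<beta> * norm (t *\<^sub>R d))"
    using beta_smooth_lipschitz[OF assms, of "x + t *\<^sub>R d" x] by (intro mult_left_mono) auto
  also have "\<dots> = t * (\<beta> * (norm d)\<^sup>2)" using t by (simp add: power2_eq_square)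
  also have "\<dots> \<le> \<beta> * (norm d)\<^sup>2"
    using t beta_smooth_nonneg[OF assms] by (intro mult_left_le_one_le) auto
  finally show ?thesis .
qed

section \<open>Square-integrable random vectors\<close>

lemma norm_sum_squared_eq:
  fixes v :: "'i \<Rightarrow> 'a::real_inner"
  shows "(norm (\<Sum>i\<in>I. v i))\<^sup>2 = (\<Sum>i\<in>I. \<Sum>j\<in>I. v i \<bullet> v j)"
  unfolding power2_norm_eq_inner by (subst inner_sum_left) (simp only: inner_sum_right)

lemma norm_sum_squared_le:
  fixes v :: "'i \<Rightarrow> 'a::real_normed_vector"
  shows "(norm (\<Sum>i\<in>I. v i))\<^sup>2 \<le> real (card I) * (\<Sum>i\<in>I. (norm (v i))\<^sup>2)"
proof (cases "finite I")
  case True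
  have "(norm (\<Sum>i\<in>I. v i))\<^sup>2 \<le> (\<Sum>i\<in>I. norm (v i))\<^sup>2"
    by (intro power_mono norm_sum) simp
  also have "\<dots> \<le> (\<Sum>i\<in>I. (norm (v i))\<^sup>2) * real (card I)"
    using Cauchy_Schwarz_ineq_sum[of "\<lambda>i. norm (v i)" "\<lambda>_. 1" I] True by simp
  finally show ?thesis by (simp add: mult.commute)
qed simp

lemma norm_add_squared_le:
  fixes a b :: "'a::real_normed_vector"
  shows "(norm (a + b))\<^sup>2 \<le> 2 * (norm a)\<^sup>2 + 2 * (norm b)\<^sup>2"
  using norm_sum_squared_le[of "\<lambda>c. if c then a else b" UNIV] by (simp add: UNIV_bool algebra_simps)

lemma norm_add3_squared_le:
  fixes a b c :: "'a::real_normed_vector"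
  shows "(norm (a + b + c))\<^sup>2 \<le> 3 * (norm a)\<^sup>2 + 3 * (norm b)\<^sup>2 + 3 * (norm c)\<^sup>2"
  using norm_sum_squared_le[of "\<lambda>i. if i = 0 then a else if i = 1 then b else c" "{..<3::nat}"]
  by (simp add: numeral_3_eq_3 algebra_simps)

lemma norm_add4_squared_le:
  fixes a b c d :: "'a::real_normed_vector"
  shows "(norm (a + b + c + d))\<^sup>2
    \<le> 4 * (norm a)\<^sup>2 + 4 * (norm b)\<^sup>2 + 4 * (norm c)\<^sup>2 + 4 * (norm d)\<^sup>2"
  using norm_add_squared_le[of "a + b" "c + d"] norm_add_squared_le[of a b] norm_add_squared_le[of c d]
  by (simp add: algebra_simps)

lemma integral_double_sum:
  fixes h :: "'i \<Rightarrow> 'j \<Rightarrow> 'w \<Rightarrow> real"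
  assumes "\<And>i j. i \<in> I \<Longrightarrow> j \<in> J \<Longrightarrow> integrable M (h i j)"
  shows "(\<integral>\<omega>. (\<Sum>i\<in>I. \<Sum>j\<in>J. h i j \<omega>) \<partial>M) = (\<Sum>i\<in>I. \<Sum>j\<in>J. \<integral>\<omega>. h i j \<omega> \<partial>M)"
  using assms by (simp add: Bochner_Integration.integral_sum Bochner_Integration.integrable_sum)

text \<open>All random vectors of a run stay in this class: it is closed under the linear operations
  of the algorithm, and inner products of its members are integrable.\<close>

definition L2 :: "'w measure \<Rightarrow> ('w \<Rightarrow> 'a::euclidean_space) \<Rightarrow> bool" where
  "L2 M X \<longleftrightarrow> X \<in> borel_measurable M \<and> integrable M (\<lambda>\<omega>. (norm (X \<omega>))\<^sup>2)"

lemma L2_measurable: "L2 M X \<Longrightarrow> X \<in> borel_measurable M"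
  and L2_integrable: "L2 M X \<Longrightarrow> integrable M (\<lambda>\<omega>. (norm (X \<omega>))\<^sup>2)"
  by (auto simp: L2_def)

lemma L2_inner:
  assumes "L2 M X" "L2 M Y"
  shows "integrable M (\<lambda>\<omega>. X \<omega> \<bullet> Y \<omega>)"
proof (rule Bochner_Integration.integrable_bound)
  show "integrable M (\<lambda>\<omega>. (norm (X \<omega>))\<^sup>2 + (norm (Y \<omega>))\<^sup>2)"
    using assms by (auto simp: L2_def)
  show "(\<lambda>\<omega>. X \<omega> \<bullet> Y \<omega>) \<in> borel_measurable M"
    using assms by (auto simp: L2_def)
  have "\<bar>x \<bullet> y\<bar> \<le> (norm x)\<^sup>2 + (norm y)\<^sup>2" for x y :: 'b
  proof -
    have "\<bar>x \<bullet> y\<bar> \<le> norm x * norm y" by (rule Cauchy_Schwarz_ineq2)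
    also have "\<dots> \<le> (norm x)\<^sup>2 + (norm y)\<^sup>2"
      using sum_squares_bound[of "norm x" "norm y"] mult_nonneg_nonneg[of "norm x" "norm y"] norm_ge_zero[of x] norm_ge_zero[of y]
      by linarith
    finally show ?thesis .
  qed
  then show "AE \<omega> in M. norm (X \<omega> \<bullet> Y \<omega>) \<le> norm ((norm (X \<omega>))\<^sup>2 + (norm (Y \<omega>))\<^sup>2)"
    by simp
qed

lemma L2_bound:
  assumes "L2 M Y" "X \<in> borel_measurable M" "\<And>\<omega>. \<omega> \<in> space M \<Longrightarrow> norm (X \<omega>) \<le> norm (Y \<omega>)"
  shows "L2 M X"
  unfolding L2_def
proof
  show "integrable M (\<lambda>\<omega>. (norm (X \<omega>))\<^sup>2)"
  proof (rule Bochner_Integration.integrable_bound[OF L2_integrable[OF assms(1)]])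
    show "AE \<omega> in M. norm ((norm (X \<omega>))\<^sup>2) \<le> norm ((norm (Y \<omega>))\<^sup>2)"
      using assms(3) by (intro AE_I2) (auto intro: power_mono)
  qed (use assms(2) in measurable)
qed fact

lemma L2_add:
  assumes "L2 M X" "L2 M Y"
  shows "L2 M (\<lambda>\<omega>. X \<omega> + Y \<omega>)"
  unfolding L2_def
proof
  have [measurable]: "X \<in> borel_measurable M" "Y \<in> borel_measurable M"
    using assms by (auto simp: L2_def)
  show "(\<lambda>\<omega>. X \<omega> + Y \<omega>) \<in> borel_measurable M" by measurable
  show "integrable M (\<lambda>\<omega>. (norm (X \<omega> + Y \<omega>))\<^sup>2)"
  proof (rule Bochner_Integration.integrable_bound)
    show "integrable M (\<lambda>\<omega>. 2 * (norm (X \<omega>))\<^sup>2 + 2 * (norm (Y \<omega>))\<^sup>2)"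
      using assms by (auto simp: L2_def)
    show "AE \<omega> in M. norm ((norm (X \<omega> + Y \<omega>))\<^sup>2) \<le> norm (2 * (norm (X \<omega>))\<^sup>2 + 2 * (norm (Y \<omega>))\<^sup>2)"
      using norm_add_squared_le by (auto intro!: AE_I2)
  qed measurable
qed

lemma L2_scaleR:
  assumes "L2 M X"
  shows "L2 M (\<lambda>\<omega>. c *\<^sub>R X \<omega>)"
  using assms by (auto simp: L2_def power_mult_distrib)

lemma L2_diff:
  assumes "L2 M X" "L2 M Y"
  shows "L2 M (\<lambda>\<omega>. X \<omega> - Y \<omega>)"
  using L2_add[OF assms(1) L2_scaleR[OF assms(2), of "-1"]] by simp

lemma L2_zero: "L2 M (\<lambda>_. 0)"
  by (simp add: L2_def)

lemma L2_sum:
  assumes "\<And>i. i \<in> I \<Longrightarrow> L2 M (X i)"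
  shows "L2 M (\<lambda>\<omega>. \<Sum>i\<in>I. X i \<omega>)"
  using assms by (induction I rule: infinite_finite_induct) (auto intro: L2_zero L2_add)

lemma (in finite_measure) L2_const: "L2 M (\<lambda>_. c)"
  by (simp add: L2_def)

text \<open>Carries square integrability through gradients, which are Lipschitz, and through the
  conditional means of the oracles, which differ from gradients by a bounded bias.\<close>

lemma (in finite_measure) L2_linear_growth:
  fixes X :: "'a \<Rightarrow> 'b::euclidean_space" and \<phi> :: "'b \<Rightarrow> 'c::euclidean_space"
  assumes X: "L2 M X" and \<phi>: "\<phi> \<in> borel_measurable borel"
    and growth: "\<And>x. norm (\<phi> x) \<le> a + b * norm x"
  shows "L2 M (\<lambda>\<omega>. \<phi> (X \<omega>))"
proof -
  have "L2 M (\<lambda>\<omega>. norm (X \<omega>))" using X by (auto simp: L2_def)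
  then have "L2 M (\<lambda>\<omega>. a + b *\<^sub>R norm (X \<omega>))"
    by (intro L2_add L2_const L2_scaleR)
  then show ?thesis
  proof (rule L2_bound)
    show "(\<lambda>\<omega>. \<phi> (X \<omega>)) \<in> borel_measurable M"
      using measurable_compose[OF L2_measurable[OF X] \<phi>] .
    show "norm (\<phi> (X \<omega>)) \<le> norm (a + b *\<^sub>R norm (X \<omega>))" for \<omega>
      using growth[of "X \<omega>"] by simp
  qed
qed

lemma L2_of_bool:
  assumes "L2 M X" "{\<omega> \<in> space M. P \<omega>} \<in> sets M"
  shows "L2 M (\<lambda>\<omega>. of_bool (P \<omega>) *\<^sub>R X \<omega>)"
proof (rule L2_bound[OF assms(1)])
  have [measurable]: "X \<in> borel_measurable M" "Measurable.pred M P"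
    using assms by (auto simp: L2_def pred_def)
  show "(\<lambda>\<omega>. of_bool (P \<omega>) *\<^sub>R X \<omega>) \<in> borel_measurable M" by measurable
qed auto

text \<open>A finite nonnegative integral carries integrability with it; this turns the oracle
  bounds into statements about Bochner integrals.\<close>

lemma L2I_nn_integral:
  assumes "X \<in> borel_measurable M" "(\<integral>\<^sup>+\<omega>. ennreal ((norm (X \<omega>))\<^sup>2) \<partial>M) \<le> ennreal v" "0 \<le> v"
  shows "L2 M X" "(\<integral>\<omega>. (norm (X \<omega>))\<^sup>2 \<partial>M) \<le> v"
proof -
  have int: "integrable M (\<lambda>\<omega>. (norm (X \<omega>))\<^sup>2)"
    using assms by (intro integrableI_bounded) (auto simp: less_top[symmetric] top_unique)
  then show "L2 M X" using assms by (simp add: L2_def)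
  have "ennreal (\<integral>\<omega>. (norm (X \<omega>))\<^sup>2 \<partial>M) \<le> ennreal v"
    using nn_integral_eq_integral[OF int] assms(2) by simp
  then show "(\<integral>\<omega>. (norm (X \<omega>))\<^sup>2 \<partial>M) \<le> v" using assms(3) by simp
qed

lemma (in finite_measure) L2_imp_integrable:
  assumes "L2 M X"
  shows "integrable M X"
proof (rule Bochner_Integration.integrable_bound)
  show "integrable M (\<lambda>\<omega>. 1 + (norm (X \<omega>))\<^sup>2)" using assms by (simp add: L2_def)
  show "X \<in> borel_measurable M" using assms by (simp add: L2_def)
  have "norm x \<le> 1 + (norm x)\<^sup>2" for x :: 'b
    using sum_squares_bound[of 1 "norm x"] norm_ge_zero[of x] by (simp del: norm_ge_zero)
  then show "AE \<omega> in M. norm (X \<omega>) \<le> norm (1 + (norm (X \<omega>))\<^sup>2)"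
    by (intro AE_I2) (simp add: abs_of_nonneg)
qed

section \<open>Fresh randomness\<close>

text \<open>\<open>H\<close> is the information available when \<open>Y\<close> is drawn.\<close>

definition fresh :: "'w measure \<Rightarrow> 'w measure \<Rightarrow> 'b measure \<Rightarrow> ('w \<Rightarrow> 'b) \<Rightarrow> bool" where
  "fresh M H L Y \<longleftrightarrow>
     prob_space M \<and> subalgebra M H \<and> has_law M L Y \<and>
     prob_space.indep_set M (sets H) {Y -` B \<inter> space M | B. B \<in> sets L}"

context
  fixes M H :: "'w measure" and L :: "'b measure" and Y :: "'w \<Rightarrow> 'b"
  assumes fresh: "fresh M H L Y"
begin

interpretation prob_space M using fresh by (simp add: fresh_def)

lemma fresh_measurable: "Y \<in> measurable M L"
  and fresh_distr: "distr M L Y = L"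
  using fresh by (auto simp: fresh_def has_law_def)

lemma fresh_prob_space: "prob_space L"
  using prob_space_distr[OF fresh_measurable] fresh_distr by simp

lemma fresh_measurable_H: "X \<in> measurable H N \<Longrightarrow> X \<in> measurable M N"
  using fresh by (auto simp: fresh_def intro: measurable_from_subalg)

lemma fresh_id: "(\<lambda>\<omega>. \<omega>) \<in> measurable M H"
proof (rule measurable_from_subalg)
  show "subalgebra M H" using fresh by (simp add: fresh_def)
qed measurable

lemma fresh_pair_measurable: "(\<lambda>\<omega>. (\<omega>, Y \<omega>)) \<in> measurable M (H \<Otimes>\<^sub>M L)"
  using fresh_id fresh_measurable by measurable

text \<open>Independence is checked on rectangles. The first coordinate is the whole sample point,
  seen only through \<open>H\<close>, so any number of \<open>H\<close>-measurable quantities can be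
  frozen at once without naming them.\<close>

lemma fresh_joint: "distr M H (\<lambda>\<omega>. \<omega>) \<Otimes>\<^sub>M L = distr M (H \<Otimes>\<^sub>M L) (\<lambda>\<omega>. (\<omega>, Y \<omega>))"
proof -
  interpret L: prob_space L by (rule fresh_prob_space)
  note fresh_pair_measurable [measurable] fresh_id [measurable]
  interpret H: prob_space "distr M H (\<lambda>\<omega>. \<omega>)" by (rule prob_space_distr) measurable
  show ?thesis
  proof (rule pair_measure_eqI)
    fix A B assume "A \<in> sets (distr M H (\<lambda>\<omega>. \<omega>))" "B \<in> sets L"
    then have A [measurable]: "A \<in> sets H" and B [measurable]: "B \<in> sets L" by auto
    have "A \<subseteq> space M"
      using sets.sets_into_space[OF A] fresh by (simp add: fresh_def subalgebra_def)
    then have pre: "(\<lambda>\<omega>. (\<omega>, Y \<omega>)) -` (A \<times> B) \<inter> space M = A \<inter> (Y -` B \<inter> space M)" by auto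
    have "prob (A \<inter> (Y -` B \<inter> space M)) = prob A * prob (Y -` B \<inter> space M)"
      using fresh A B unfolding fresh_def by (intro indep_setD) auto
    also have "prob (Y -` B \<inter> space M) = measure L B"
      using measure_distr[OF fresh_measurable B] fresh_distr by simp
    finally have "emeasure M (A \<inter> (Y -` B \<inter> space M)) = emeasure M A * emeasure L B"
      by (simp add: emeasure_eq_measure L.emeasure_eq_measure ennreal_mult)
    then show "emeasure (distr M H (\<lambda>\<omega>. \<omega>)) A * emeasure L B
        = emeasure (distr M (H \<Otimes>\<^sub>M L) (\<lambda>\<omega>. (\<omega>, Y \<omega>))) (A \<times> B)"
      using \<open>A \<subseteq> space M\<close> by (simp add: emeasure_distr pre Int_absorb2)
  qed (auto intro: H.sigma_finite_measure_axioms L.sigma_finite_measure_axioms)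
qed

text \<open>Tonelli on the product law, the substitute for conditioning on \<open>H\<close>: the
  inner integral sees \<open>\<omega>\<close> as a constant.\<close>

lemma fresh_nn_integral:
  assumes [measurable]: "\<phi> \<in> borel_measurable (H \<Otimes>\<^sub>M L)"
  shows "(\<integral>\<^sup>+\<omega>. \<phi> (\<omega>, Y \<omega>) \<partial>M) = (\<integral>\<^sup>+\<omega>. \<integral>\<^sup>+t. \<phi> (\<omega>, t) \<partial>L \<partial>M)"
proof -
  interpret L: prob_space L by (rule fresh_prob_space)
  note fresh_pair_measurable [measurable] fresh_id [measurable]
  have "(\<integral>\<^sup>+\<omega>. \<phi> (\<omega>, Y \<omega>) \<partial>M) = (\<integral>\<^sup>+z. \<phi> z \<partial>(distr M H (\<lambda>\<omega>. \<omega>) \<Otimes>\<^sub>M L))"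
    unfolding fresh_joint by (subst nn_integral_distr) auto
  also have "\<dots> = (\<integral>\<^sup>+\<omega>. \<integral>\<^sup>+t. \<phi> (\<omega>, t) \<partial>L \<partial>distr M H (\<lambda>\<omega>. \<omega>))"
    by (subst L.nn_integral_fst) auto
  also have "\<dots> = (\<integral>\<^sup>+\<omega>. \<integral>\<^sup>+t. \<phi> (\<omega>, t) \<partial>L \<partial>M)"
    by (subst nn_integral_distr) auto
  finally show ?thesis .
qed

lemma fresh_integral:
  fixes \<phi> :: "'w \<times> 'b \<Rightarrow> real"
  assumes [measurable]: "\<phi> \<in> borel_measurable (H \<Otimes>\<^sub>M L)"
    and int: "integrable M (\<lambda>\<omega>. \<phi> (\<omega>, Y \<omega>))"
  shows "(\<integral>\<omega>. \<phi> (\<omega>, Y \<omega>) \<partial>M) = (\<integral>\<omega>. \<integral>t. \<phi> (\<omega>, t) \<partial>L \<partial>M)"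
proof -
  interpret L: prob_space L by (rule fresh_prob_space)
  note fresh_pair_measurable [measurable] fresh_id [measurable]
  interpret H: prob_space "distr M H (\<lambda>\<omega>. \<omega>)" by (rule prob_space_distr) measurable
  interpret pair_prob_space "distr M H (\<lambda>\<omega>. \<omega>)" L ..
  have int': "integrable (distr M H (\<lambda>\<omega>. \<omega>) \<Otimes>\<^sub>M L) \<phi>"
    unfolding fresh_joint using int by (subst integrable_distr_eq) auto
  have "(\<integral>\<omega>. \<phi> (\<omega>, Y \<omega>) \<partial>M) = (\<integral>z. \<phi> z \<partial>(distr M H (\<lambda>\<omega>. \<omega>) \<Otimes>\<^sub>M L))"
    unfolding fresh_joint by (subst integral_distr) auto
  also have "\<dots> = (\<integral>\<omega>. \<integral>t. \<phi> (\<omega>, t) \<partial>L \<partial>distr M H (\<lambda>\<omega>. \<omega>))"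
    using integral_fst'[OF int'] by simp
  also have "\<dots> = (\<integral>\<omega>. \<integral>t. \<phi> (\<omega>, t) \<partial>L \<partial>M)"
    by (subst integral_distr) auto
  finally show ?thesis .
qed

text \<open>The bound is uniform in the query point, so it survives the substitution of a random
  point that is determined by \<open>H\<close>.\<close>

lemma fresh_second_moment:
  fixes \<Psi> :: "'a::euclidean_space \<Rightarrow> 'b \<Rightarrow> 'a"
  assumes \<Psi>: "(\<lambda>(x, t). \<Psi> x t) \<in> borel_measurable (borel \<Otimes>\<^sub>M L)"
    and v: "\<And>x. (\<integral>\<^sup>+t. ennreal ((norm (\<Psi> x t))\<^sup>2) \<partial>L) \<le> ennreal v" "0 \<le> v"
    and X: "X \<in> borel_measurable H"
  shows "L2 M (\<lambda>\<omega>. \<Psi> (X \<omega>) (Y \<omega>))" "(\<integral>\<omega>. (norm (\<Psi> (X \<omega>) (Y \<omega>)))\<^sup>2 \<partial>M) \<le> v"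
proof -
  note \<Psi> [measurable] X [measurable] fresh_measurable [measurable]
  have [measurable]: "X \<in> borel_measurable M" by (rule fresh_measurable_H[OF X])
  have meas: "(\<lambda>\<omega>. \<Psi> (X \<omega>) (Y \<omega>)) \<in> borel_measurable M"
    using measurable_compose[OF _ \<Psi>, of "\<lambda>\<omega>. (X \<omega>, Y \<omega>)" M] by simp
  have \<Psi>H: "(\<lambda>z. \<Psi> (X (fst z)) (snd z)) \<in> borel_measurable (H \<Otimes>\<^sub>M L)"
    using measurable_compose[OF _ \<Psi>, of "\<lambda>z. (X (fst z), snd z)" "H \<Otimes>\<^sub>M L"] by simp
  have "(\<integral>\<^sup>+\<omega>. ennreal ((norm (\<Psi> (X \<omega>) (Y \<omega>)))\<^sup>2) \<partial>M)
      = (\<integral>\<^sup>+\<omega>. \<integral>\<^sup>+t. ennreal ((norm (\<Psi> (X \<omega>) t))\<^sup>2) \<partial>L \<partial>M)"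
    using fresh_nn_integral[of "\<lambda>z. ennreal ((norm (\<Psi> (X (fst z)) (snd z)))\<^sup>2)"] \<Psi>H by simp
  also have "\<dots> \<le> (\<integral>\<^sup>+\<omega>. ennreal v \<partial>M)"
    by (intro nn_integral_mono v)
  also have "\<dots> = ennreal v" by (simp add: emeasure_space_1)
  finally have "(\<integral>\<^sup>+\<omega>. ennreal ((norm (\<Psi> (X \<omega>) (Y \<omega>)))\<^sup>2) \<partial>M) \<le> ennreal v" .
  from L2I_nn_integral[OF meas this v(2)]
  show "L2 M (\<lambda>\<omega>. \<Psi> (X \<omega>) (Y \<omega>))" "(\<integral>\<omega>. (norm (\<Psi> (X \<omega>) (Y \<omega>)))\<^sup>2 \<partial>M) \<le> v" .
qed

text \<open>With \<open>\<omega>\<close> frozen, both \<open>Z\<close> and the query point are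
  constants, and the inner integral is the inner product of \<open>Z\<close> with a zero
  mean.\<close>

lemma fresh_orthogonal:
  fixes \<Psi> :: "'a::euclidean_space \<Rightarrow> 'b \<Rightarrow> 'a"
  assumes \<Psi>: "(\<lambda>(x, t). \<Psi> x t) \<in> borel_measurable (borel \<Otimes>\<^sub>M L)"
    and mean: "\<And>x. integrable L (\<Psi> x)" "\<And>x. (\<integral>t. \<Psi> x t \<partial>L) = 0"
    and X: "X \<in> borel_measurable H" and Z: "Z \<in> borel_measurable H"
    and L2: "L2 M Z" "L2 M (\<lambda>\<omega>. \<Psi> (X \<omega>) (Y \<omega>))"
  shows "(\<integral>\<omega>. Z \<omega> \<bullet> \<Psi> (X \<omega>) (Y \<omega>) \<partial>M) = 0"
proof -
  note Z [measurable] X [measurable]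
  have \<Psi>H [measurable]: "(\<lambda>z. \<Psi> (X (fst z)) (snd z)) \<in> borel_measurable (H \<Otimes>\<^sub>M L)"
    using measurable_compose[OF _ \<Psi>, of "\<lambda>z. (X (fst z), snd z)" "H \<Otimes>\<^sub>M L"] by simp
  have "(\<integral>\<omega>. Z \<omega> \<bullet> \<Psi> (X \<omega>) (Y \<omega>) \<partial>M) = (\<integral>\<omega>. \<integral>t. Z \<omega> \<bullet> \<Psi> (X \<omega>) t \<partial>L \<partial>M)"
    using fresh_integral[of "\<lambda>z. Z (fst z) \<bullet> \<Psi> (X (fst z)) (snd z)"] L2_inner[OF L2] by simp
  also have "\<dots> = 0"
    by (simp add: mean)
  finally show ?thesis .
qed

text \<open>Serves draws that act as bounded weights: the selection indicators of clients and the
  indicator of the output round.\<close>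

lemma fresh_product:
  fixes \<phi> :: "'b \<Rightarrow> real" and W :: "'w \<Rightarrow> real"
  assumes \<phi>: "\<phi> \<in> borel_measurable L" "\<And>t. \<bar>\<phi> t\<bar> \<le> c"
    and W: "W \<in> borel_measurable H" "integrable M W"
  shows "integrable M (\<lambda>\<omega>. \<phi> (Y \<omega>) * W \<omega>)"
    "(\<integral>\<omega>. \<phi> (Y \<omega>) * W \<omega> \<partial>M) = (\<integral>t. \<phi> t \<partial>L) * (\<integral>\<omega>. W \<omega> \<partial>M)"
proof -
  note \<phi>(1) [measurable] W(1) [measurable] fresh_measurable [measurable]
  have c: "0 \<le> c" using \<phi>(2)[of undefined] by linarith
  show int: "integrable M (\<lambda>\<omega>. \<phi> (Y \<omega>) * W \<omega>)"
  proof (rule Bochner_Integration.integrable_bound)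
    show "integrable M (\<lambda>\<omega>. c * W \<omega>)" using W by simp
    show "AE \<omega> in M. norm (\<phi> (Y \<omega>) * W \<omega>) \<le> norm (c * W \<omega>)"
      using \<phi>(2) c by (intro AE_I2) (auto simp: abs_mult intro: mult_right_mono)
    show "(\<lambda>\<omega>. \<phi> (Y \<omega>) * W \<omega>) \<in> borel_measurable M"
      using fresh_measurable_H[OF W(1)] by measurable
  qed
  have "(\<lambda>z. \<phi> (snd z) * W (fst z)) \<in> borel_measurable (H \<Otimes>\<^sub>M L)" by measurable
  from fresh_integral[OF this] int
  show "(\<integral>\<omega>. \<phi> (Y \<omega>) * W \<omega> \<partial>M) = (\<integral>t. \<phi> t \<partial>L) * (\<integral>\<omega>. W \<omega> \<partial>M)" by simp
qed

end

section \<open>Sampling clients without replacement\<close>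

lemma finite_client_subsets: "finite (client_subsets N S)"
  unfolding client_subsets_def by (rule finite_subset[of _ "Pow {1..N}"]) auto

lemma card_client_subsets: "card (client_subsets N S) = N choose S"
  unfolding client_subsets_def using n_subsets[of "{1..N}" S] by simp

text \<open>Removing \<open>T\<close> is a bijection onto the subsets of the remaining clients of
  size \<open>S - card T\<close>. The case distinction matters: for \<open>card T > S\<close> the
  truncated difference is 0 and the binomial coefficient would be 1.\<close>

lemma card_client_subsets_containing:
  assumes T: "T \<subseteq> {1..N}"
  shows "card {A \<in> client_subsets N S. T \<subseteq> A}
    = (if card T \<le> S then (N - card T) choose (S - card T) else 0)"
proof (cases "card T \<le> S")
  case True
  have fT: "finite T" using T finite_subset by blast
  have "bij_betw (\<lambda>A. A \<union> T) {A. A \<subseteq> {1..N} - T \<and> card A = S - card T} {A \<in> client_subsets N S. T \<subseteq> A}"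
  proof (rule bij_betwI[where g = "\<lambda>A. A - T"])
    show "(\<lambda>A. A \<union> T) \<in> {A. A \<subseteq> {1..N} - T \<and> card A = S - card T} \<rightarrow> {A \<in> client_subsets N S. T \<subseteq> A}"
    proof safe
      fix A assume A: "A \<subseteq> {1..N} - T" "card A = S - card T"
      then have "finite A" using finite_subset by blast
      then have "card (A \<union> T) = S"
        using A fT True by (subst card_Un_disjoint) auto
      then show "A \<union> T \<in> client_subsets N S" using A T by (auto simp: client_subsets_def)
    qed
    show "(\<lambda>A. A - T) \<in> {A \<in> client_subsets N S. T \<subseteq> A} \<rightarrow> {A. A \<subseteq> {1..N} - T \<and> card A = S - card T}"
      using fT by (auto simp: client_subsets_def card_Diff_subset)
  qed auto
  then have "card {A \<in> client_subsets N S. T \<subseteq> A} = card {A. A \<subseteq> {1..N} - T \<and> card A = S - card T}"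
    by (simp add: bij_betw_same_card)
  also have "\<dots> = (N - card T) choose (S - card T)"
    using n_subsets[of "{1..N} - T" "S - card T"] T fT by (simp add: card_Diff_subset)
  finally show ?thesis using True by simp
next
  case False
  have "card T \<le> card A" if "A \<in> client_subsets N S" "T \<subseteq> A" for A
    using that by (intro card_mono) (auto simp: client_subsets_def intro: finite_subset)
  then have "{A \<in> client_subsets N S. T \<subseteq> A} = {}"
    using False by (fastforce simp: client_subsets_def)
  then show ?thesis using False by (metis card.empty)
qed

lemma sampling_mean:
  assumes "1 \<le> S" "S \<le> N" "i \<in> {1..N}"
  shows "(\<integral>A. of_bool (i \<in> A) \<partial>uniform_count_measure (client_subsets N S)) = real S / real N"
proof -
  have "(\<Sum>A\<in>client_subsets N S. of_bool (i \<in> A)) = real (card {A \<in> client_subsets N S. {i} \<subseteq> A})"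
    using sum.inter_filter[OF finite_client_subsets, of "\<lambda>_. 1::real" N S "\<lambda>A. i \<in> A"]
    by (simp add: of_bool_def)
  also have "\<dots> = real ((N - 1) choose (S - 1))"
    using assms by (subst card_client_subsets_containing) auto
  finally have *: "(\<Sum>A\<in>client_subsets N S. of_bool (i \<in> A)) = real ((N - 1) choose (S - 1))" .
  \<comment> \<open>Absorption identity; it turns the quotient of the two binomial coefficients into
    \<open>S / N\<close>.\<close>
  have "S * (N choose S) = N * ((N - 1) choose (S - 1))"
    using assms by (intro times_binomial_minus1_eq) auto
  then have "real S * real (N choose S) = real N * real ((N - 1) choose (S - 1))"
    by (metis of_nat_mult)
  then show ?thesis
    using assms by (simp add: integral_uniform_count_measure finite_client_subsets * card_client_subsets field_simps)
qed

text \<open>Two distinct clients are sampled together with a probability that does not depend on them;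
  for a centred family the off-diagonal terms therefore contribute a nonpositive amount.\<close>

lemma sampling_variance:
  fixes u :: "nat \<Rightarrow> 'a::euclidean_space"
  assumes S: "1 \<le> S" "S \<le> N" and centred: "(\<Sum>i=1..N. u i) = 0"
  shows "(\<Sum>i=1..N. \<Sum>j=1..N. (\<integral>A. of_bool (i \<in> A) * of_bool (j \<in> A) \<partial>uniform_count_measure (client_subsets N S))
            * (u i \<bullet> u j)) \<le> real S / real N * (\<Sum>i=1..N. (norm (u i))\<^sup>2)"
proof -
  define p :: "nat \<Rightarrow> nat \<Rightarrow> real" where "p i j = (\<integral>A. of_bool (i \<in> A) * of_bool (j \<in> A) \<partial>uniform_count_measure (client_subsets N S))"
    for i j
  \<comment> \<open>The probability that two given clients are sampled together, which is zero for
    \<open>S = 1\<close>.\<close>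
  define p2 where "p2 = real (if 2 \<le> S then (N - 2) choose (S - 2) else 0) / real (N choose S)"
  have diag: "p i i = real S / real N" if "i \<in> {1..N}" for i
    using sampling_mean[OF S that] by (simp add: p_def flip: of_bool_conj)
  have off: "p i j = p2" if "i \<in> {1..N}" "j \<in> {1..N}" "i \<noteq> j" for i j
  proof -
    have "(\<Sum>A\<in>client_subsets N S. of_bool (i \<in> A) * of_bool (j \<in> A))
        = real (card {A \<in> client_subsets N S. {i, j} \<subseteq> A})"
      using sum.inter_filter[OF finite_client_subsets, of "\<lambda>_. 1::real" N S "\<lambda>A. i \<in> A \<and> j \<in> A"]
      by (simp add: of_bool_conj[symmetric] del: of_bool_conj) (simp add: of_bool_def)
    also have "\<dots> = real (if 2 \<le> S then (N - 2) choose (S - 2) else 0)"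
      using that by (subst card_client_subsets_containing) (auto simp: numeral_2_eq_2)
    finally show ?thesis
      by (simp add: p_def p2_def integral_uniform_count_measure finite_client_subsets card_client_subsets)
  qed
  have "0 \<le> p2" by (simp add: p2_def)
  \<comment> \<open>A constant matrix plus a diagonal correction: the constant part contributes
    \<open>p2\<close> times the squared norm of the full sum, which vanishes by centring.\<close>
  have "p i j * (u i \<bullet> u j) = p2 * (u i \<bullet> u j) + (if i = j then (real S / real N - p2) * (u i \<bullet> u i) else 0)"
    if "i \<in> {1..N}" "j \<in> {1..N}" for i j
    using that diag off by (auto simp: algebra_simps)
  then have "(\<Sum>i=1..N. \<Sum>j=1..N. p i j * (u i \<bullet> u j))
      = (\<Sum>i=1..N. \<Sum>j=1..N. p2 * (u i \<bullet> u j) + (if i = j then (real S / real N - p2) * (u i \<bullet> u i) else 0))"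
    by (intro sum.cong refl) auto
  also have "\<dots> = p2 * ((\<Sum>i=1..N. u i) \<bullet> (\<Sum>j=1..N. u j)) + (\<Sum>i=1..N. (real S / real N - p2) * (u i \<bullet> u i))"
    by (simp add: sum.distrib inner_sum_left inner_sum_right sum_distrib_left sum.delta cong: sum.cong)
       (intro arg_cong2[where f = "(+)"] sum.cong refl, auto simp: inner_commute)
  also have "\<dots> = (real S / real N - p2) * (\<Sum>i=1..N. (norm (u i))\<^sup>2)"
    using centred by (simp add: sum_distrib_left power2_norm_eq_inner)
  \<comment> \<open>The gain of sampling without replacement over independent selection is given
    away here; only \<open>p2 \<ge> 0\<close> is kept of it.\<close>
  also have "\<dots> \<le> real S / real N * (\<Sum>i=1..N. (norm (u i))\<^sup>2)"
    using \<open>0 \<le> p2\<close> by (intro mult_right_mono sum_nonneg) auto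
  finally show ?thesis by (simp add: p_def)
qed

section \<open>The oracles\<close>

text \<open>Pairing the data sample with the quantum sample makes a call depend on one fresh draw
  with a product law.\<close>

definition oracle_call :: "('a \<Rightarrow> 'x \<Rightarrow> 'q \<Rightarrow> 'a) \<Rightarrow> 'a \<Rightarrow> 'x \<times> 'q \<Rightarrow> 'a" where
  "oracle_call gq x t = gq x (fst t) (snd t)"

text \<open>The proof of \<open>oracle_call_moments\<close> identifies this as gradient plus bias.
  Defining it as an integral gives measurability in \<open>x\<close>, which cannot be read off from
  the bias: that is given only as some bounded function.\<close>

definition oracle_mean :: "('x \<times> 'q) measure \<Rightarrow> ('a::euclidean_space \<Rightarrow> 'x \<Rightarrow> 'q \<Rightarrow> 'a) \<Rightarrow> 'a \<Rightarrow> 'a" where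
  "oracle_mean L gq x = (\<integral>t. oracle_call gq x t \<partial>L)"

context
  fixes D :: "'x measure" and Q :: "'q measure" and f :: "'a::euclidean_space \<Rightarrow> real" and g gq v w U
  assumes data: "stochastic_oracle D f g v" and quantum: "biased_quantum_oracle D Q g gq U w"
    and nonneg: "0 \<le> v" "0 \<le> w"
begin

lemma oracle_call_measurable:
  "(\<lambda>(x, t). oracle_call gq x t) \<in> borel_measurable (borel \<Otimes>\<^sub>M (D \<Otimes>\<^sub>M Q))"
  using quantum by (simp add: biased_quantum_oracle_def oracle_call_def case_prod_unfold)

lemma oracle_prob_space: "prob_space (D \<Otimes>\<^sub>M Q)"
proof -
  interpret D: prob_space D using data by (simp add: stochastic_oracle_def)
  interpret Q: prob_space Q using quantum by (simp add: biased_quantum_oracle_def)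
  interpret pair_prob_space D Q ..
  show ?thesis by (rule prob_space_axioms)
qed

lemma oracle_mean_measurable: "oracle_mean (D \<Otimes>\<^sub>M Q) gq \<in> borel_measurable borel"
proof -
  interpret prob_space "D \<Otimes>\<^sub>M Q" by (rule oracle_prob_space)
  show ?thesis
    unfolding oracle_mean_def[abs_def]
    by (rule borel_measurable_lebesgue_integral[OF oracle_call_measurable])
qed

text \<open>Around \<open>m\<close>, the deviation of a call is the quantum deviation for fixed data
  plus the data deviation; each is squared at the cost of a factor 2. The second moment has to come
  before the mean, because it provides the joint integrability that Fubini requires.\<close>

lemma oracle_call_moments:
  shows "integrable (D \<Otimes>\<^sub>M Q) (oracle_call gq x)"
    and "norm (oracle_mean (D \<Otimes>\<^sub>M Q) gq x - gradient f x) \<le> U"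
    and "(\<integral>\<^sup>+t. ennreal ((norm (oracle_call gq x t - oracle_mean (D \<Otimes>\<^sub>M Q) gq x))\<^sup>2) \<partial>(D \<Otimes>\<^sub>M Q))
      \<le> ennreal (2 * v + 2 * w)"
proof -
  interpret D: prob_space D using data by (simp add: stochastic_oracle_def)
  interpret Q: prob_space Q using quantum by (simp add: biased_quantum_oracle_def)
  interpret pair_prob_space D Q ..
  obtain b where b: "\<And>x. norm (b x) \<le> U"
    and AE_mean: "\<And>x. AE \<xi> in D. has_bochner_integral Q (gq x \<xi>) (g x \<xi> + b x)"
    using quantum unfolding biased_quantum_oracle_def by blast
  have AE_var: "AE \<xi> in D. (\<integral>\<^sup>+\<zeta>. ennreal ((norm (gq x \<xi> \<zeta> - (\<integral>\<zeta>'. gq x \<xi> \<zeta>' \<partial>Q)))\<^sup>2) \<partial>Q) \<le> ennreal w"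
    using quantum unfolding biased_quantum_oracle_def by blast
  define m where "m = gradient f x + b x"
  have call [measurable]: "oracle_call gq x \<in> borel_measurable (D \<Otimes>\<^sub>M Q)"
    using measurable_compose[OF _ oracle_call_measurable, of "\<lambda>t. (x, t)" "D \<Otimes>\<^sub>M Q"] by simp
  have gq_meas: "(\<lambda>\<zeta>. gq x \<xi> \<zeta>) \<in> borel_measurable Q" if "\<xi> \<in> space D" for \<xi>
    using measurable_compose[OF measurable_Pair1'[OF that] call] by (simp add: oracle_call_def)
  have g: "has_bochner_integral D (g x) (gradient f x)"
    and g_var: "(\<integral>\<^sup>+\<xi>. ennreal ((norm (g x \<xi> - gradient f x))\<^sup>2) \<partial>D) \<le> ennreal v"
    using data by (auto simp: stochastic_oracle_def)
  have [measurable]: "g x \<in> borel_measurable D"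
    using g by (auto simp: has_bochner_integral_iff)
  have "(\<integral>\<^sup>+t. ennreal ((norm (oracle_call gq x t - m))\<^sup>2) \<partial>(D \<Otimes>\<^sub>M Q))
      = (\<integral>\<^sup>+\<xi>. \<integral>\<^sup>+\<zeta>. ennreal ((norm (gq x \<xi> \<zeta> - m))\<^sup>2) \<partial>Q \<partial>D)"
    using call by (subst Q.nn_integral_fst[symmetric]) (simp_all add: oracle_call_def[abs_def])
  also have "\<dots> \<le> (\<integral>\<^sup>+\<xi>. ennreal (2 * w) + ennreal 2 * ennreal ((norm (g x \<xi> - gradient f x))\<^sup>2) \<partial>D)"
  proof (rule nn_integral_mono_AE)
    show "AE \<xi> in D. (\<integral>\<^sup>+\<zeta>. ennreal ((norm (gq x \<xi> \<zeta> - m))\<^sup>2) \<partial>Q)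
        \<le> ennreal (2 * w) + ennreal 2 * ennreal ((norm (g x \<xi> - gradient f x))\<^sup>2)"
      using AE_mean[of x] AE_var
    proof eventually_elim
      case (elim \<xi>)
      define e where "e = g x \<xi> - gradient f x"
      have int: "(\<integral>\<zeta>. gq x \<xi> \<zeta> \<partial>Q) = g x \<xi> + b x" and [measurable]: "gq x \<xi> \<in> borel_measurable Q"
        using elim by (auto simp: has_bochner_integral_iff)
      have "(\<integral>\<^sup>+\<zeta>. ennreal ((norm (gq x \<xi> \<zeta> - m))\<^sup>2) \<partial>Q)
          \<le> (\<integral>\<^sup>+\<zeta>. ennreal 2 * ennreal ((norm (gq x \<xi> \<zeta> - (g x \<xi> + b x)))\<^sup>2) + ennreal 2 * ennreal ((norm e)\<^sup>2) \<partial>Q)"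
      proof (rule nn_integral_mono)
        fix \<zeta>
        have "(norm (gq x \<xi> \<zeta> - m))\<^sup>2 \<le> 2 * (norm (gq x \<xi> \<zeta> - (g x \<xi> + b x)))\<^sup>2 + 2 * (norm e)\<^sup>2"
          using norm_add_squared_le[of "gq x \<xi> \<zeta> - (g x \<xi> + b x)" e] by (simp add: m_def e_def algebra_simps)
        then show "ennreal ((norm (gq x \<xi> \<zeta> - m))\<^sup>2)
            \<le> ennreal 2 * ennreal ((norm (gq x \<xi> \<zeta> - (g x \<xi> + b x)))\<^sup>2) + ennreal 2 * ennreal ((norm e)\<^sup>2)"
          by (simp del: ennreal_numeral flip: ennreal_mult ennreal_plus)
      qed
      also have "\<dots> = ennreal 2 * (\<integral>\<^sup>+\<zeta>. ennreal ((norm (gq x \<xi> \<zeta> - (g x \<xi> + b x)))\<^sup>2) \<partial>Q)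
          + ennreal 2 * ennreal ((norm e)\<^sup>2)"
        by (subst nn_integral_add) (auto simp: nn_integral_cmult Q.emeasure_space_1)
      also have "\<dots> \<le> ennreal 2 * ennreal w + ennreal 2 * ennreal ((norm e)\<^sup>2)"
        using elim(2) int by (intro add_right_mono mult_left_mono) auto
      finally show ?case using nonneg by (simp add: e_def ennreal_mult)
    qed
  qed
  also have "\<dots> = ennreal (2 * w) + ennreal 2 * (\<integral>\<^sup>+\<xi>. ennreal ((norm (g x \<xi> - gradient f x))\<^sup>2) \<partial>D)"
    by (subst nn_integral_add) (auto simp: nn_integral_cmult D.emeasure_space_1)
  also have "\<dots> \<le> ennreal (2 * w) + ennreal 2 * ennreal v"
    using g_var by (intro add_left_mono mult_left_mono) auto
  also have "\<dots> = ennreal (2 * v + 2 * w)"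
    using nonneg by (simp add: add.commute del: ennreal_numeral flip: ennreal_mult ennreal_plus)
  finally have var: "(\<integral>\<^sup>+t. ennreal ((norm (oracle_call gq x t - m))\<^sup>2) \<partial>(D \<Otimes>\<^sub>M Q)) \<le> ennreal (2 * v + 2 * w)" .
  \<comment> \<open>The oracle hypotheses give integrability only in one variable at a time; over
    the product it follows from the second moment just bounded.\<close>
  have "L2 (D \<Otimes>\<^sub>M Q) (\<lambda>t. oracle_call gq x t - m)"
    using nonneg by (intro L2I_nn_integral(1)[OF _ var]) auto
  from L2_add[OF this L2_const[of m]] have "L2 (D \<Otimes>\<^sub>M Q) (oracle_call gq x)" by simp
  then show int: "integrable (D \<Otimes>\<^sub>M Q) (oracle_call gq x)" by (rule L2_imp_integrable)
  have "oracle_mean (D \<Otimes>\<^sub>M Q) gq x = (\<integral>\<xi>. \<integral>\<zeta>. gq x \<xi> \<zeta> \<partial>Q \<partial>D)"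
    using integral_fst'[OF int] by (simp add: oracle_mean_def oracle_call_def[abs_def])
  also have "\<dots> = (\<integral>\<xi>. g x \<xi> + b x \<partial>D)"
  proof (rule integral_cong_AE)
    show "(\<lambda>\<xi>. \<integral>\<zeta>. gq x \<xi> \<zeta> \<partial>Q) \<in> borel_measurable D"
      using call by (intro Q.borel_measurable_lebesgue_integral) (simp add: oracle_call_def[abs_def] case_prod_unfold)
    show "AE \<xi> in D. (\<integral>\<zeta>. gq x \<xi> \<zeta> \<partial>Q) = g x \<xi> + b x"
      using AE_mean[of x] by eventually_elim (simp add: has_bochner_integral_iff)
  qed measurable
  also have "\<dots> = m"
    using g by (simp add: has_bochner_integral_iff m_def D.prob_space)
  finally have mean: "oracle_mean (D \<Otimes>\<^sub>M Q) gq x = m" .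
  show "norm (oracle_mean (D \<Otimes>\<^sub>M Q) gq x - gradient f x) \<le> U"
    using b[of x] by (simp add: mean m_def)
  show "(\<integral>\<^sup>+t. ennreal ((norm (oracle_call gq x t - oracle_mean (D \<Otimes>\<^sub>M Q) gq x))\<^sup>2) \<partial>(D \<Otimes>\<^sub>M Q))
      \<le> ennreal (2 * v + 2 * w)"
    using var by (simp add: mean)
qed

end

section \<open>Independence of the draws\<close>

definition generated :: "'w measure \<Rightarrow> ('d \<Rightarrow> 'w set set) \<Rightarrow> 'd set \<Rightarrow> 'w measure" where
  "generated M F J = sigma (space M) (\<Union>d\<in>J. F d)"

lemma space_generated: "space (generated M F J) = space M"
  by (simp add: generated_def space_measure_of_conv)

lemma sets_generated:
  assumes "\<And>d. d \<in> J \<Longrightarrow> F d \<subseteq> Pow (space M)"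
  shows "sets (generated M F J) = sigma_sets (space M) (\<Union>d\<in>J. F d)"
  unfolding generated_def using assms by (intro sets_measure_of) blast

lemma subalgebra_generated:
  assumes "\<And>d. d \<in> J \<Longrightarrow> F d \<subseteq> sets M"
  shows "subalgebra M (generated M F J)"
proof -
  have "F d \<subseteq> Pow (space M)" if "d \<in> J" for d
    using assms[OF that] sets.sets_into_space by blast
  moreover have "sigma_sets (space M) (\<Union>d\<in>J. F d) \<subseteq> sets M"
    using assms by (intro sets.sigma_sets_subset) auto
  ultimately show ?thesis
    by (simp add: subalgebra_def space_generated sets_generated)
qed

lemma measurable_generated:
  assumes "d \<in> J" "F d = sets (vimage_algebra (space M) X N)" "X \<in> space M \<rightarrow> space N"
    "\<And>d. d \<in> J \<Longrightarrow> F d \<subseteq> Pow (space M)"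
  shows "X \<in> measurable (generated M F J) N"
proof (rule measurable_from_subalg)
  show "X \<in> measurable (vimage_algebra (space M) X N) N"
    using assms(3) by (rule measurable_vimage_algebra1)
  show "subalgebra (generated M F J) (vimage_algebra (space M) X N)"
    using assms by (auto simp: subalgebra_def space_generated sets_generated)
qed

text \<open>Disjoint groups of independent Int-stable families generate independent sigma-algebras.
  This is the passage from the mutual independence of all draws to freshness of one of them.\<close>

lemma (in prob_space) fresh_generated:
  assumes indep: "indep_sets F I" and stable: "\<And>d. d \<in> I \<Longrightarrow> Int_stable (F d)"
    and J: "J \<union> J' \<subseteq> I" "J \<inter> J' = {}"
    and Y: "Y \<in> measurable (generated M F J') L" and law: "has_law M L Y"
  shows "fresh M (generated M F J) L Y"
proof -
  have events: "F d \<subseteq> events" if "d \<in> I" for d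
    using indep that by (auto simp: indep_sets_def)
  then have Pow: "F d \<subseteq> Pow (space M)" if "d \<in> I" for d
    using that sets.sets_into_space by blast
  \<comment> \<open>The two groups are indexed by \<open>bool\<close>, the form in which
    \<open>indep_set\<close> is defined.\<close>
  have "indep_sets (\<lambda>b. sigma_sets (space M) (\<Union>d\<in>(if b then J else J'). F d)) UNIV"
  proof (rule indep_sets_collect_sigma)
    show "indep_sets F (\<Union>b. if b then J else J')"
      using indep J by (auto intro: indep_sets_mono_index simp: UNIV_bool)
    show "disjoint_family_on (\<lambda>b. if b then J else J') UNIV"
      using J by (auto simp: disjoint_family_on_def)
    show "Int_stable (F d)" if "d \<in> (if b then J else J')" for b d
      using that J by (intro stable) (auto split: if_splits)
  qed
  then have "indep_sets (\<lambda>b. case b of True \<Rightarrow> sets (generated M F J)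
      | False \<Rightarrow> {Y -` B \<inter> space M | B. B \<in> sets L}) UNIV"
  proof (rule indep_sets_mono_sets)
    fix b :: bool
    have "Y -` B \<inter> space M \<in> sigma_sets (space M) (\<Union>d\<in>J'. F d)" if "B \<in> sets L" for B
      using measurable_sets[OF Y that] J Pow by (subst (asm) sets_generated) (auto simp: space_generated)
    moreover have "sets (generated M F J) = sigma_sets (space M) (\<Union>d\<in>J. F d)"
      using J Pow by (intro sets_generated) auto
    ultimately show "(case b of True \<Rightarrow> sets (generated M F J)
        | False \<Rightarrow> {Y -` B \<inter> space M | B. B \<in> sets L})
      \<subseteq> sigma_sets (space M) (\<Union>d\<in>(if b then J else J'). F d)"
      by (auto split: bool.split)
  qed
  then have "indep_set (sets (generated M F J)) {Y -` B \<inter> space M | B. B \<in> sets L}"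
    by (simp add: indep_set_def)
  moreover have "subalgebra M (generated M F J)"
    using J events by (intro subalgebra_generated) auto
  ultimately show ?thesis using law prob_space_axioms by (simp add: fresh_def)
qed

text \<open>The first factor of \<open>fresh_joint\<close> is pushed forward along \<open>X\<close>.
  Applied to the data and the quantum sample of one call, it shows that their joint law is the
  product.\<close>

lemma fresh_pair_law:
  assumes "fresh M H L Y" "X \<in> measurable H K" "has_law M K X"
  shows "has_law M (K \<Otimes>\<^sub>M L) (\<lambda>\<omega>. (X \<omega>, Y \<omega>))"
proof -
  note assms(2) [measurable] fresh_measurable[OF assms(1), measurable]
    and pair = fresh_pair_measurable[OF assms(1)] and id [measurable] = fresh_id[OF assms(1)]
  have X: "X \<in> measurable M K" and XK: "distr M K X = K" using assms(3) by (auto simp: has_law_def)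
  interpret M: prob_space M using assms(1) by (simp add: fresh_def)
  interpret L: prob_space L by (rule fresh_prob_space[OF assms(1)])
  interpret H: prob_space "distr M H (\<lambda>\<omega>. \<omega>)" by (rule M.prob_space_distr) (rule id)
  have "distr (distr M H (\<lambda>\<omega>. \<omega>)) K X = K"
    using distr_distr[OF assms(2) id] XK by (simp add: comp_def)
  then have "K \<Otimes>\<^sub>M L = distr (distr M H (\<lambda>\<omega>. \<omega>)) K X \<Otimes>\<^sub>M distr L L (\<lambda>t. t)"
    by (simp add: distr_id)
  also have "\<dots> = distr (distr M H (\<lambda>\<omega>. \<omega>) \<Otimes>\<^sub>M L) (K \<Otimes>\<^sub>M L) (\<lambda>(\<omega>, t). (X \<omega>, t))"
    by (rule pair_measure_distr) (auto simp: distr_id intro: L.sigma_finite_measure_axioms)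
  also have "\<dots> = distr M (K \<Otimes>\<^sub>M L) (\<lambda>\<omega>. (X \<omega>, Y \<omega>))"
    unfolding fresh_joint[OF assms(1)] using pair by (subst distr_distr) (auto simp: comp_def)
  finally show ?thesis
    unfolding has_law_def using X fresh_measurable[OF assms(1)] by auto
qed

section \<open>The iterates as random variables\<close>

text \<open>The step-size condition and the lower bound on the objective stay outside: most moment
  bounds hold without them, and the lemmas that absorb terms or bound the last iterate state what
  they use.\<close>

locale fedavg =
  fixes N S K R :: nat and f :: "nat \<Rightarrow> 'a::euclidean_space \<Rightarrow> real" and \<beta> G B :: real
    and D :: "nat \<Rightarrow> 'x measure" and Q :: "nat \<Rightarrow> 'q measure"
    and g :: "nat \<Rightarrow> 'a \<Rightarrow> 'x \<Rightarrow> 'a" and gq :: "nat \<Rightarrow> 'a \<Rightarrow> 'x \<Rightarrow> 'q \<Rightarrow> 'a"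
    and \<sigma> Uq \<sigma>q \<eta>l \<eta>g :: real and x0 :: 'a
    and M :: "'w measure" and A :: "nat \<Rightarrow> 'w \<Rightarrow> nat set"
    and \<xi> :: "nat \<Rightarrow> nat \<Rightarrow> nat \<Rightarrow> 'w \<Rightarrow> 'x" and \<zeta> :: "nat \<Rightarrow> nat \<Rightarrow> nat \<Rightarrow> 'w \<Rightarrow> 'q" and \<tau> :: "'w \<Rightarrow> nat"
  assumes S: "1 \<le> S" "S \<le> N" and K: "1 \<le> K" and R: "1 \<le> R"
    and smooth: "\<And>i. i \<in> {1..N} \<Longrightarrow> beta_smooth \<beta> (f i)"
    and dissimilarity: "bounded_gradient_dissimilarity G B N f"
    and data_oracle: "\<And>i. i \<in> {1..N} \<Longrightarrow> stochastic_oracle (D i) (f i) (g i) (\<sigma>\<^sup>2)"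
    and quantum_oracle: "\<And>i. i \<in> {1..N} \<Longrightarrow> biased_quantum_oracle (D i) (Q i) (g i) (gq i) Uq (\<sigma>q\<^sup>2)"
    and \<eta>l: "0 < \<eta>l" and \<eta>g: "1 \<le> \<eta>g"
    and randomness: "fedavg_randomness N S K R D Q M A \<xi> \<zeta> \<tau>"
begin

sublocale prob_space M
  using randomness by (simp add: fedavg_randomness_def)

text \<open>The variance bound of a whole call from \<open>oracle_call_moments\<close>.\<close>

definition V :: real where "V = 2 * \<sigma>\<^sup>2 + 2 * \<sigma>q\<^sup>2"
definition L :: "nat \<Rightarrow> ('x \<times> 'q) measure" where "L i = D i \<Otimes>\<^sub>M Q i"
definition mean :: "nat \<Rightarrow> 'a \<Rightarrow> 'a" where "mean i = oracle_mean (L i) (gq i)"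
definition P :: "nat set measure" where "P = uniform_count_measure (client_subsets N S)"
definition obj :: "'a \<Rightarrow> real" where "obj = global_objective N f"

definition x :: "nat \<Rightarrow> 'w \<Rightarrow> 'a" where
  "x r \<omega> = server_iterate S K \<eta>l \<eta>g gq (\<lambda>r. A r \<omega>) (\<lambda>r i k. \<xi> r i k \<omega>) (\<lambda>r i k. \<zeta> r i k \<omega>) x0 r"

text \<open>\<open>x r\<close> is the server state after \<open>r\<close> rounds. The local
  quantities with index \<open>r\<close> belong to the round that starts there, so their draws carry
  the index \<open>Suc r\<close>.\<close>

definition y :: "nat \<Rightarrow> nat \<Rightarrow> nat \<Rightarrow> 'w \<Rightarrow> 'a" where
  "y r i k \<omega> = local_iterate \<eta>l (gq i) (\<lambda>k. \<xi> (Suc r) i k \<omega>) (\<lambda>k. \<zeta> (Suc r) i k \<omega>) (x r \<omega>) k"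

definition z :: "nat \<Rightarrow> nat \<Rightarrow> nat \<Rightarrow> 'w \<Rightarrow> 'x \<times> 'q" where
  "z r i k \<omega> = (\<xi> (Suc r) i k \<omega>, \<zeta> (Suc r) i k \<omega>)"

definition q :: "nat \<Rightarrow> nat \<Rightarrow> nat \<Rightarrow> 'w \<Rightarrow> 'a" where
  "q r i k \<omega> = oracle_call (gq i) (y r i k \<omega>) (z r i k \<omega>)"

definition noise :: "nat \<Rightarrow> nat \<Rightarrow> nat \<Rightarrow> 'w \<Rightarrow> 'a" where
  "noise r i k \<omega> = q r i k \<omega> - mean i (y r i k \<omega>)"

text \<open>A numerical weight in place of a random index set: sums over sampled clients become sums
  over the fixed set \<open>{1..N}\<close>, which commute with expectation.\<close>

definition sel :: "nat \<Rightarrow> nat \<Rightarrow> 'w \<Rightarrow> real" where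
  "sel r i \<omega> = of_bool (i \<in> A (Suc r) \<omega>)"

lemma V_nonneg: "0 \<le> V" by (simp add: V_def)

lemma smooth_obj: "beta_smooth \<beta> obj"
  unfolding obj_def using smooth S by (intro beta_smooth_global_objective) auto

lemma \<beta>_nonneg: "0 \<le> \<beta>"
  by (rule beta_smooth_nonneg[OF smooth_obj])

lemma gradient_obj: "gradient obj u = (1 / real N) *\<^sub>R (\<Sum>i=1..N. gradient (f i) u)"
  unfolding obj_def using smooth by (rule gradient_global_objective)

lemma y_0: "y r i 0 \<omega> = x r \<omega>"
  and y_Suc: "y r i (Suc k) \<omega> = y r i k \<omega> - \<eta>l *\<^sub>R q r i k \<omega>"
  by (simp_all add: y_def q_def oracle_call_def z_def)

lemma y_diff: "y r i k \<omega> - x r \<omega> = - \<eta>l *\<^sub>R (\<Sum>j<k. q r i j \<omega>)"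
  by (induction k) (auto simp: y_0 y_Suc algebra_simps scaleR_sum_right)

context
  fixes i assumes i: "i \<in> {1..N}"
begin

lemma call_measurable: "(\<lambda>(u, t). oracle_call (gq i) u t) \<in> borel_measurable (borel \<Otimes>\<^sub>M L i)"
  unfolding L_def by (rule oracle_call_measurable[OF data_oracle[OF i] quantum_oracle[OF i]]) auto

lemma mean_measurable: "mean i \<in> borel_measurable borel"
  unfolding L_def mean_def by (rule oracle_mean_measurable[OF data_oracle[OF i] quantum_oracle[OF i]]) auto

lemma L_prob_space: "prob_space (L i)"
  unfolding L_def by (rule oracle_prob_space[OF data_oracle[OF i] quantum_oracle[OF i]]) auto

lemma call_integrable: "integrable (L i) (oracle_call (gq i) u)"
  and mean_bias: "norm (mean i u - gradient (f i) u) \<le> Uq"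
  and call_variance: "(\<integral>\<^sup>+t. ennreal ((norm (oracle_call (gq i) u t - mean i u))\<^sup>2) \<partial>L i) \<le> ennreal V"
  unfolding L_def mean_def V_def
  using oracle_call_moments[OF data_oracle[OF i] quantum_oracle[OF i]] by auto

lemma centred_measurable:
  "(\<lambda>(u, t). oracle_call (gq i) u t - mean i u) \<in> borel_measurable (borel \<Otimes>\<^sub>M L i)"
  using call_measurable mean_measurable by (simp add: case_prod_unfold)

lemma centred_mean:
  "integrable (L i) (\<lambda>t. oracle_call (gq i) u t - mean i u)"
  "(\<integral>t. oracle_call (gq i) u t - mean i u \<partial>L i) = 0"
proof -
  interpret L: prob_space "L i" by (rule L_prob_space)
  show "integrable (L i) (\<lambda>t. oracle_call (gq i) u t - mean i u)"
    using call_integrable by auto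
  show "(\<integral>t. oracle_call (gq i) u t - mean i u \<partial>L i) = 0"
    using call_integrable by (simp add: L.prob_space mean_def oracle_mean_def)
qed

end

section \<open>Information carried by sets of draws\<close>

text \<open>The family inside \<open>fedavg_randomness\<close>, repeated so that its independence is
  available by unfolding.\<close>

definition draw_algebra :: "draw \<Rightarrow> 'w set set" where
  "draw_algebra = (\<lambda>d. case d of
          Output \<Rightarrow> sets (vimage_algebra (space M) \<tau> (uniform_count_measure {..<R}))
        | Sampling r \<Rightarrow> sets (vimage_algebra (space M) (A r) P)
        | Data r i k \<Rightarrow> sets (vimage_algebra (space M) (\<xi> r i k) (D i))
        | Quantum r i k \<Rightarrow> sets (vimage_algebra (space M) (\<zeta> r i k) (Q i)))"

definition gen :: "draw set \<Rightarrow> 'w measure" where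
  "gen = generated M draw_algebra"

lemma draw_algebra_Pow: "draw_algebra d \<subseteq> Pow (space M)"
proof -
  have *: "sets (vimage_algebra (space M) X \<Lambda>) \<subseteq> Pow (space M)" for X :: "'w \<Rightarrow> 'c" and \<Lambda>
    using sets.space_closed[of "vimage_algebra (space M) X \<Lambda>"] by simp
  show ?thesis by (cases d) (simp_all only: draw_algebra_def draw.case *)
qed

lemma space_gen: "space (gen J) = space M"
  by (simp add: gen_def space_generated)

lemma gen_measurable:
  "Output \<in> J \<Longrightarrow> \<tau> \<in> measurable (gen J) (uniform_count_measure {..<R})"
  "Sampling r \<in> J \<Longrightarrow> r \<in> {1..R} \<Longrightarrow> A r \<in> measurable (gen J) P"
  "Data r i k \<in> J \<Longrightarrow> r \<in> {1..R} \<Longrightarrow> i \<in> {1..N} \<Longrightarrow> k < K \<Longrightarrow> \<xi> r i k \<in> measurable (gen J) (D i)"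
  "Quantum r i k \<in> J \<Longrightarrow> r \<in> {1..R} \<Longrightarrow> i \<in> {1..N} \<Longrightarrow> k < K \<Longrightarrow> \<zeta> r i k \<in> measurable (gen J) (Q i)"
proof -
  have gen: "X \<in> measurable (gen J) \<Lambda>"
    if "d \<in> J" "draw_algebra d = sets (vimage_algebra (space M) X \<Lambda>)" "has_law M \<Lambda> X"
    for d and X :: "'w \<Rightarrow> 'c" and \<Lambda>
    unfolding gen_def using that(1,2)
  proof (rule measurable_generated)
    show "X \<in> space M \<rightarrow> space \<Lambda>"
      using that(3) by (auto simp: has_law_def measurable_def)
  qed (rule draw_algebra_Pow)
  note laws = randomness[unfolded fedavg_randomness_def, folded P_def]
  show "\<tau> \<in> measurable (gen J) (uniform_count_measure {..<R})" if "Output \<in> J"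
    using that laws by (intro gen[of Output]) (simp_all add: draw_algebra_def)
  show "A r \<in> measurable (gen J) P" if "Sampling r \<in> J" "r \<in> {1..R}"
    using that laws by (intro gen[of "Sampling r"]) (simp_all add: draw_algebra_def)
  show "\<xi> r i k \<in> measurable (gen J) (D i)"
    if "Data r i k \<in> J" "r \<in> {1..R}" "i \<in> {1..N}" "k < K"
    using that laws by (intro gen[of "Data r i k"]) (simp_all add: draw_algebra_def)
  show "\<zeta> r i k \<in> measurable (gen J) (Q i)"
    if "Quantum r i k \<in> J" "r \<in> {1..R}" "i \<in> {1..N}" "k < K"
    using that laws by (intro gen[of "Quantum r i k"]) (simp_all add: draw_algebra_def)
qed

lemma fresh_gen:
  assumes "J \<union> J' \<subseteq> draws N K R" "J \<inter> J' = {}" "Y \<in> measurable (gen J') \<Lambda>" "has_law M \<Lambda> Y"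
  shows "fresh M (gen J) \<Lambda> Y"
  unfolding gen_def
proof (rule fresh_generated[OF _ _ assms(1,2)])
  show "Y \<in> measurable (generated M draw_algebra J') \<Lambda>"
    using assms(3) by (simp add: gen_def)
  show "indep_sets draw_algebra (draws N K R)"
    using randomness unfolding fedavg_randomness_def draw_algebra_def P_def by blast
  show "Int_stable (draw_algebra d)" for d
    by (cases d) (simp_all add: draw_algebra_def sets.Int_stable)
qed (fact assms(4))

text \<open>Much larger than the past of the call: it includes other clients, later steps and all
  samplings. Freshness relative to it admits selection indicators and the noises of other calls as
  test functions.\<close>

definition other_calls :: "nat \<Rightarrow> nat \<Rightarrow> nat \<Rightarrow> draw set" where
  "other_calls r i k = draws N K R - {Data (Suc r) i k, Quantum (Suc r) i k}"

text \<open>\<open>draws\<close> always contains \<open>Output\<close>; taking it out keeps the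
  iterates independent of the output round.\<close>

definition past :: "nat \<Rightarrow> draw set" where
  "past r = draws N K r - {Output}"

lemma past_Suc: "past r \<subseteq> past (Suc r)"
  by (auto simp: past_def draws_def)

lemma past_other:
  assumes "r < R"
  shows "past r \<subseteq> other_calls r i k" "past r \<subseteq> draws N K R - {Sampling (Suc r)}"
  using assms by (auto simp: past_def other_calls_def draws_def)

lemma past_output: "r \<le> R \<Longrightarrow> past r \<subseteq> draws N K R - {Output}"
  by (auto simp: past_def draws_def)

lemma fresh_call:
  assumes "r < R" "i \<in> {1..N}" "k < K"
  shows "fresh M (gen (other_calls r i k)) (L i) (z r i k)"
proof (rule fresh_gen)
  let ?d1 = "Data (Suc r) i k" and ?d2 = "Quantum (Suc r) i k"
  have r: "Suc r \<in> {1..R}" using assms by auto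
  have d: "?d1 \<in> draws N K R" "?d2 \<in> draws N K R"
    using assms by (auto simp: draws_def)
  show "other_calls r i k \<union> {?d1, ?d2} \<subseteq> draws N K R" "other_calls r i k \<inter> {?d1, ?d2} = {}"
    using d by (auto simp: other_calls_def)
  show "z r i k \<in> measurable (gen {?d1, ?d2}) (L i)"
    using gen_measurable(3,4)[OF _ r assms(2,3), of "{?d1, ?d2}"]
    unfolding z_def[abs_def] L_def by measurable
  have law: "has_law M (D i) (\<xi> (Suc r) i k)" "has_law M (Q i) (\<zeta> (Suc r) i k)"
    using randomness r assms by (auto simp: fedavg_randomness_def)
  \<comment> \<open>For the law of the pair, the quantum sample is taken as fresh relative to the
    data sample alone.\<close>
  have "fresh M (gen {?d1}) (Q i) (\<zeta> (Suc r) i k)"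
    using d law(2) gen_measurable(4)[OF _ r assms(2,3), of "{?d2}"]
    by (intro fresh_gen[where J' = "{?d2}"]) auto
  from fresh_pair_law[OF this gen_measurable(3)[OF _ r assms(2,3)] law(1)]
  show "has_law M (L i) (z r i k)" by (simp add: z_def[abs_def] L_def)
qed

lemma fresh_sampling:
  assumes "r < R"
  shows "fresh M (gen (draws N K R - {Sampling (Suc r)})) P (A (Suc r))"
proof (rule fresh_gen)
  have r: "Suc r \<in> {1..R}" using assms by auto
  show "draws N K R - {Sampling (Suc r)} \<union> {Sampling (Suc r)} \<subseteq> draws N K R"
    using assms by (auto simp: draws_def)
  show "A (Suc r) \<in> measurable (gen {Sampling (Suc r)}) P"
    using gen_measurable(2)[OF _ r] by simp
  show "has_law M P (A (Suc r))"
    using randomness r by (auto simp: fedavg_randomness_def P_def)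
qed auto

text \<open>True at every sample point, not just almost surely, because a measurable map takes its
  values in the space of its target.\<close>

lemma sampled_clients:
  assumes "r < R" "\<omega> \<in> space M"
  shows "A (Suc r) \<omega> \<subseteq> {1..N}" "card (A (Suc r) \<omega>) = S"
  using measurable_space[OF fresh_measurable[OF fresh_sampling[OF assms(1)]] assms(2)]
  by (auto simp: P_def space_uniform_count_measure client_subsets_def)

lemma fresh_output: "fresh M (gen (draws N K R - {Output})) (uniform_count_measure {..<R}) \<tau>"
proof (rule fresh_gen)
  show "draws N K R - {Output} \<union> {Output} \<subseteq> draws N K R" by (auto simp: draws_def)
  show "\<tau> \<in> measurable (gen {Output}) (uniform_count_measure {..<R})"
    by (rule gen_measurable) simp
  show "has_law M (uniform_count_measure {..<R}) \<tau>"
    using randomness by (auto simp: fedavg_randomness_def)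
qed auto

lemma sel_measurable:
  assumes "r < R" "Sampling (Suc r) \<in> J"
  shows "sel r i \<in> borel_measurable (gen J)"
proof -
  have "(\<lambda>a. of_bool (i \<in> a) :: real) \<in> borel_measurable P"
    by (simp add: P_def measurable_def sets_uniform_count_measure space_uniform_count_measure)
  from measurable_compose[OF gen_measurable(2)[OF assms(2)] this] assms(1)
  show ?thesis by (simp add: sel_def[abs_def])
qed

lemma x_Suc:
  assumes "r < R" "\<omega> \<in> space M"
  shows "x (Suc r) \<omega> = x r \<omega> + (\<eta>g / real S) *\<^sub>R (\<Sum>i=1..N. sel r i \<omega> *\<^sub>R (y r i K \<omega> - x r \<omega>))"
proof -
  have "(\<Sum>i=1..N. sel r i \<omega> *\<^sub>R (y r i K \<omega> - x r \<omega>)) = (\<Sum>i\<in>A (Suc r) \<omega>. y r i K \<omega> - x r \<omega>)"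
    using sampled_clients(1)[OF assms] by (intro sum.mono_neutral_cong_right) (auto simp: sel_def)
  then show ?thesis
    by (simp add: x_def y_def Let_def)
qed

text \<open>Local step \<open>k\<close> has consumed exactly the samples with index below
  \<open>k\<close>. This sharp count is what makes a local iterate measurable without the call about
  to be made there.\<close>

lemma y_measurable:
  assumes "r < R" "i \<in> {1..N}" "k \<le> K" and x: "x r \<in> borel_measurable (gen J)"
    and J: "\<And>j. j < k \<Longrightarrow> Data (Suc r) i j \<in> J" "\<And>j. j < k \<Longrightarrow> Quantum (Suc r) i j \<in> J"
  shows "y r i k \<in> borel_measurable (gen J)"
    and "\<And>j. j < k \<Longrightarrow> q r i j \<in> borel_measurable (gen J)"
    and "\<And>j. j < k \<Longrightarrow> noise r i j \<in> borel_measurable (gen J)"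
proof -
  have q: "q r i j \<in> borel_measurable (gen J)"
    if "j < k" "y r i j \<in> borel_measurable (gen J)" for j
  proof -
    have "\<xi> (Suc r) i j \<in> measurable (gen J) (D i)" "\<zeta> (Suc r) i j \<in> measurable (gen J) (Q i)"
      using that J assms by (auto intro!: gen_measurable)
    then have "(\<lambda>\<omega>. (y r i j \<omega>, z r i j \<omega>)) \<in> measurable (gen J) (borel \<Otimes>\<^sub>M L i)"
      using that(2) unfolding z_def[abs_def] L_def by measurable
    from measurable_compose[OF this call_measurable[OF assms(2)]]
    show ?thesis by (simp add: q_def[abs_def])
  qed
  have *: "y r i j \<in> borel_measurable (gen J)" if "j \<le> k" for j
    using that
  proof (induction j)
    case 0
    then show ?case using x by (simp add: y_0[abs_def])
  next
    case (Suc j)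
    then show ?case using q[of j] by (simp add: y_Suc[abs_def])
  qed
  then show "y r i k \<in> borel_measurable (gen J)" by simp
  show "q r i j \<in> borel_measurable (gen J)" if "j < k" for j
    using q that * by simp
  then show "noise r i j \<in> borel_measurable (gen J)" if "j < k" for j
    using that measurable_compose[OF *[of j] mean_measurable[OF assms(2)]]
    by (simp add: noise_def[abs_def])
qed

lemma x_measurable:
  assumes "r \<le> R" "past r \<subseteq> J"
  shows "x r \<in> borel_measurable (gen J)"
  using assms
proof (induction r)
  case 0
  then show ?case by (simp add: x_def)
next
  case (Suc r)
  have x [measurable]: "x r \<in> borel_measurable (gen J)"
    using Suc past_Suc by auto
  have d: "Sampling (Suc r) \<in> J" "i \<in> {1..N} \<Longrightarrow> k < K \<Longrightarrow> Data (Suc r) i k \<in> J"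
    "i \<in> {1..N} \<Longrightarrow> k < K \<Longrightarrow> Quantum (Suc r) i k \<in> J" for i k
    using Suc.prems by (auto simp: past_def draws_def)
  have "y r i K \<in> borel_measurable (gen J)" if "i \<in> {1..N}" for i
    using Suc.prems that d x by (intro y_measurable) auto
  moreover have "sel r i \<in> borel_measurable (gen J)" for i
    using Suc.prems d by (intro sel_measurable) auto
  ultimately have "(\<lambda>\<omega>. x r \<omega> + (\<eta>g / real S) *\<^sub>R (\<Sum>i=1..N. sel r i \<omega> *\<^sub>R (y r i K \<omega> - x r \<omega>)))
      \<in> borel_measurable (gen J)"
    by (intro borel_measurable_add x borel_measurable_scaleR borel_measurable_sum borel_measurable_diff
        borel_measurable_const) auto
  then show ?case
    using x_Suc Suc.prems by (subst measurable_cong[OF x_Suc]) (auto simp: space_gen)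
qed

end

section \<open>Moments of one round\<close>

text \<open>The deterministic core of a round: \<open>P\<close> stands for the expected squared
  gradient norm, \<open>e\<close> for the mean squared error, \<open>\<Delta>\<close> for the change
  of the expected objective, \<open>b\<close> for \<open>\<beta> * \<eta>l * K\<close>. Besides
  \<open>- P / 2\<close>, the multiples of \<open>P\<close> have coefficients at most 6/1000, 6/1000
  and 16/1000, so \<open>- P / 4\<close> survives.\<close>

lemma round_arithmetic:
  fixes \<eta> \<beta> b S K B P e V U G \<Delta> :: real
  assumes \<Delta>: "\<Delta> \<le> - (\<eta> / 2) * (P - e)
      + \<beta> * ((\<eta> / (S * K))\<^sup>2 * (3 * (S * K * V) + 3 * (S\<^sup>2 * K\<^sup>2 * e) + 3 * (K\<^sup>2 * (2 * S\<^sup>2 * P + 2 * S * (G\<^sup>2 + B\<^sup>2 * P)))))"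
    and e: "e \<le> 2 * U\<^sup>2 + 16 * b\<^sup>2 * (V + U\<^sup>2 + G\<^sup>2 + B\<^sup>2 * P)"
    and nonneg: "0 \<le> \<eta>" "0 \<le> \<beta>" "0 \<le> P" "0 \<le> V" "1 \<le> S" "1 \<le> K" "0 \<le> b" "0 \<le> e"
    and small: "(1 + B\<^sup>2) * (\<beta> * \<eta>) \<le> 1 / 1000" and b: "b \<le> \<beta> * \<eta>"
  shows "\<eta> / 4 * P \<le> - \<Delta> + \<eta> * (3 * U\<^sup>2 + 16 * b\<^sup>2 * (V + G\<^sup>2) + 3 * (\<beta> * \<eta>) * (V / (S * K) + 2 * G\<^sup>2 / S))"
proof -
  define a where "a = \<beta> * \<eta>"
  have a: "0 \<le> a" using nonneg by (simp add: a_def)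
  have aB: "a + a * B\<^sup>2 \<le> 1 / 1000" using small by (simp add: a_def algebra_simps)
  have a': "a \<le> 1 / 1000" and aB': "a * B\<^sup>2 \<le> 1 / 1000"
    using aB a mult_nonneg_nonneg[OF a zero_le_power2[of B]] by linarith+
  \<comment> \<open>The square is weakened to a linear term, so that the one bound on
    \<open>a * B\<^sup>2\<close> also absorbs the drift part.\<close>
  have bb: "b\<^sup>2 \<le> a * a"
    using b nonneg a by (simp add: power2_eq_square a_def mult_mono)
  also have "a * a \<le> a * 1" using a a' by (intro mult_left_mono) auto
  finally have ba: "b\<^sup>2 \<le> a" by simp
  have bB: "b\<^sup>2 * B\<^sup>2 \<le> 1 / 1000"
    using mult_right_mono[OF ba, of "B\<^sup>2"] aB' by simp
  have "\<beta> * ((\<eta> / (S * K))\<^sup>2 * (3 * (S * K * V) + 3 * (S\<^sup>2 * K\<^sup>2 * e) + 3 * (K\<^sup>2 * (2 * S\<^sup>2 * P + 2 * S * (G\<^sup>2 + B\<^sup>2 * P)))))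
      = \<eta> * (3 * a * (V / (S * K)) + 3 * a * e + 6 * a * P + 6 * a * (G\<^sup>2 / S) + 6 * (a * B\<^sup>2) * (P / S))"
    using nonneg by (simp add: a_def field_simps power2_eq_square)
  then have "\<Delta> \<le> \<eta> * (- (1 / 2) * P + (1 / 2 + 3 * a) * e + 3 * a * (V / (S * K)) + 6 * a * P + 6 * a * (G\<^sup>2 / S) + 6 * (a * B\<^sup>2) * (P / S))"
    using \<Delta> by (simp add: algebra_simps diff_divide_distrib)
  also have "\<dots> \<le> \<eta> * (- (1 / 4) * P + (3 * U\<^sup>2 + 16 * b\<^sup>2 * (V + G\<^sup>2) + 3 * a * (V / (S * K) + 2 * G\<^sup>2 / S)))"
  proof (rule mult_left_mono[OF _ nonneg(1)])
    have 1: "(1 / 2 + 3 * a) * e \<le> e" using a' nonneg by (intro mult_left_le_one_le) (auto simp: a)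
    have 2: "a * P \<le> 1 / 1000 * P" using a' nonneg by (intro mult_right_mono)
    \<comment> \<open>In absorbed terms the gain \<open>1 / S\<close> can be discarded.\<close>
    have "P / S \<le> P" using nonneg by (simp add: divide_le_eq mult_le_cancel_left1)
    then have "(a * B\<^sup>2) * (P / S) \<le> 1 / 1000 * P"
      using aB' a nonneg by (intro mult_mono) auto
    moreover have 4: "b\<^sup>2 * B\<^sup>2 * P \<le> 1 / 1000 * P" using bB nonneg by (intro mult_right_mono)
    moreover have "b\<^sup>2 * U\<^sup>2 \<le> 1 / 1000 * U\<^sup>2" using ba a' by (intro mult_right_mono) auto
    moreover have "e \<le> 2 * U\<^sup>2 + 16 * (b\<^sup>2 * (V + G\<^sup>2)) + 16 * (b\<^sup>2 * U\<^sup>2) + 16 * (b\<^sup>2 * B\<^sup>2 * P)"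
      using e by (simp add: algebra_simps)
    moreover have "6 * a * (G\<^sup>2 / S) + 3 * a * (V / (S * K)) = 3 * a * (V / (S * K) + 2 * G\<^sup>2 / S)"
      by (simp add: algebra_simps)
    moreover have "0 \<le> U\<^sup>2" by simp
    ultimately show "- (1 / 2) * P + (1 / 2 + 3 * a) * e + 3 * a * (V / (S * K)) + 6 * a * P + 6 * a * (G\<^sup>2 / S) + 6 * (a * B\<^sup>2) * (P / S)
        \<le> - (1 / 4) * P + (3 * U\<^sup>2 + 16 * b\<^sup>2 * (V + G\<^sup>2) + 3 * a * (V / (S * K) + 2 * G\<^sup>2 / S))"
      using 1 2 nonneg(3) by (simp only: mult.assoc)
  qed
  finally show ?thesis by (simp add: a_def algebra_simps)
qed

context fedavg
begin

lemma gradient_L2: "beta_smooth \<beta> h \<Longrightarrow> L2 M X \<Longrightarrow> L2 M (\<lambda>\<omega>. gradient h (X \<omega>))"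
  by (rule L2_linear_growth[OF _ beta_smooth_gradient_measurable beta_smooth_linear_growth])

lemma mean_L2:
  assumes i: "i \<in> {1..N}" and X: "L2 M X"
  shows "L2 M (\<lambda>\<omega>. mean i (X \<omega>))"
proof (rule L2_linear_growth[OF X mean_measurable[OF i]])
  fix u
  have "norm (mean i u) \<le> norm (mean i u - gradient (f i) u) + norm (gradient (f i) u)"
    by (rule norm_triangle_sub[of "mean i u" "gradient (f i) u", unfolded add.commute[of "norm (gradient (f i) u)"]])
  then show "norm (mean i u) \<le> (Uq + norm (gradient (f i) 0)) + \<beta> * norm u"
    using mean_bias[OF i, of u] beta_smooth_linear_growth[OF smooth[OF i], of u] by simp
qed

lemma obj_integrable:
  assumes "L2 M X"
  shows "integrable M (\<lambda>\<omega>. obj (X \<omega>))"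
proof (rule Bochner_Integration.integrable_bound)
  have X [measurable]: "X \<in> borel_measurable M" using assms by (rule L2_measurable)
  show "integrable M (\<lambda>\<omega>. (\<bar>obj 0\<bar> + norm (gradient obj 0) * norm (X \<omega>)) + \<beta> * (norm (X \<omega>))\<^sup>2)"
    using L2_imp_integrable[OF assms] L2_integrable[OF assms] by auto
  have "continuous_on UNIV obj"
    using smooth_obj unfolding beta_smooth_def
    by (auto intro!: differentiable_imp_continuous_on simp: differentiable_on_def)
  then show "(\<lambda>\<omega>. obj (X \<omega>)) \<in> borel_measurable M"
    using measurable_compose[OF X borel_measurable_continuous_onI] by blast
  have "\<bar>obj u\<bar> \<le> \<bar>obj 0\<bar> + norm (gradient obj 0) * norm u + \<beta> * (norm u)\<^sup>2" for u
    using beta_smooth_descent[OF smooth_obj, of 0 u] Cauchy_Schwarz_ineq2[of "gradient obj 0" u] by simp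
  then show "AE \<omega> in M. norm (obj (X \<omega>))
      \<le> norm ((\<bar>obj 0\<bar> + norm (gradient obj 0) * norm (X \<omega>)) + \<beta> * (norm (X \<omega>))\<^sup>2)"
    by (intro AE_I2) (metis abs_ge_self order_trans real_norm_def)
qed

lemma measurable_comp_H:
  assumes "X \<in> borel_measurable (gen J)"
  shows "i \<in> {1..N} \<Longrightarrow> (\<lambda>\<omega>. mean i (X \<omega>)) \<in> borel_measurable (gen J)"
    and "i \<in> {1..N} \<Longrightarrow> (\<lambda>\<omega>. gradient (f i) (X \<omega>)) \<in> borel_measurable (gen J)"
    and "(\<lambda>\<omega>. gradient obj (X \<omega>)) \<in> borel_measurable (gen J)"
  using measurable_compose[OF assms mean_measurable]
    measurable_compose[OF assms beta_smooth_gradient_measurable[OF smooth]]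
    measurable_compose[OF assms beta_smooth_gradient_measurable[OF smooth_obj]] by auto

definition calls :: "(nat \<times> nat) set" where "calls = {1..N} \<times> {..<K}"

lemma sum_calls: "(\<Sum>p\<in>calls. h (fst p) (snd p)) = (\<Sum>i=1..N. \<Sum>k<K. h i k)"
  by (simp only: calls_def sum.cartesian_product case_prod_unfold)

definition err :: "nat \<Rightarrow> nat \<Rightarrow> nat \<Rightarrow> 'w \<Rightarrow> 'a" where
  "err r i k \<omega> = mean i (y r i k \<omega>) - gradient (f i) (x r \<omega>)"

definition grad_sq :: "nat \<Rightarrow> real" where
  "grad_sq r = (\<integral>\<omega>. (norm (gradient obj (x r \<omega>)))\<^sup>2 \<partial>M)"

definition local_grad_sq :: "nat \<Rightarrow> nat \<Rightarrow> real" where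
  "local_grad_sq r i = (\<integral>\<omega>. (norm (gradient (f i) (x r \<omega>)))\<^sup>2 \<partial>M)"

text \<open>An average over all clients: the selection indicators are integrated out before it
  appears.\<close>

definition err_sq :: "nat \<Rightarrow> real" where
  "err_sq r = (1 / (real N * real K)) * (\<Sum>p\<in>calls. \<integral>\<omega>. (norm (err r (fst p) (snd p) \<omega>))\<^sup>2 \<partial>M)"

context
  fixes r :: nat assumes r: "r < R" and L2_x: "L2 M (x r)"
begin

lemma y_measurable_other:
  assumes "i \<in> {1..N}" "k < K"
  shows "y r i k \<in> borel_measurable (gen (other_calls r i k))"
proof (rule y_measurable(1)[OF r assms(1)])
  show "x r \<in> borel_measurable (gen (other_calls r i k))"
    using r past_other by (intro x_measurable) auto
qed (use assms r in \<open>auto simp: other_calls_def draws_def\<close>)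

lemma noise_L2:
  assumes i: "i \<in> {1..N}" and k: "k < K"
  shows "L2 M (noise r i k)" "(\<integral>\<omega>. (norm (noise r i k \<omega>))\<^sup>2 \<partial>M) \<le> V"
  using fresh_second_moment[OF fresh_call[OF r i k] centred_measurable[OF i] call_variance[OF i] V_nonneg
      y_measurable_other[OF i k]]
  by (simp_all add: noise_def[abs_def] q_def)

text \<open>A call is noise plus conditional mean at the local iterate. The first has a uniform
  second moment and the second grows linearly, so square integrability passes from one local step to
  the next.\<close>

lemma y_L2: "i \<in> {1..N} \<Longrightarrow> k \<le> K \<Longrightarrow> L2 M (y r i k)"
  and q_L2: "i \<in> {1..N} \<Longrightarrow> k < K \<Longrightarrow> L2 M (q r i k)"
proof -
  have q: "L2 M (q r i k)" if "i \<in> {1..N}" "k < K" "L2 M (y r i k)" for k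
    using L2_add[OF noise_L2(1)[OF that(1,2)] mean_L2[OF that(1,3)]] by (simp add: noise_def[abs_def])
  show y: "L2 M (y r i k)" if "i \<in> {1..N}" "k \<le> K" for k
    using that(2)
  proof (induction k)
    case 0
    then show ?case using L2_x by (simp add: y_0[abs_def])
  next
    case (Suc k)
    then show ?case
      using q[of k] that(1) by (auto simp: y_Suc[abs_def] intro!: L2_diff L2_scaleR)
  qed
  show "L2 M (q r i k)" if "i \<in> {1..N}" "k < K"
    using q y that by simp
qed

lemma sel_events: "{\<omega> \<in> space M. i \<in> A (Suc r) \<omega>} \<in> events"
proof -
  have "sel r i \<in> borel_measurable M"
    using fresh_measurable_H[OF fresh_output sel_measurable[OF r]] r by (auto simp: draws_def)
  then have "{\<omega> \<in> space M. sel r i \<omega> = 1} \<in> events" by measurable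
  then show ?thesis by (simp add: sel_def)
qed

lemma sel_L2: "L2 M X \<Longrightarrow> L2 M (\<lambda>\<omega>. sel r i \<omega> *\<^sub>R X \<omega>)"
  unfolding sel_def using sel_events by (rule L2_of_bool[rotated])

lemma x_Suc_diff:
  assumes "\<omega> \<in> space M"
  shows "x (Suc r) \<omega> - x r \<omega> = - (\<eta>g * \<eta>l / real S) *\<^sub>R (\<Sum>i=1..N. sel r i \<omega> *\<^sub>R (\<Sum>k<K. q r i k \<omega>))"
  using x_Suc[OF r assms] by (simp add: y_diff scaleR_sum_right sum_negf mult_ac)

lemma L2_x_Suc: "L2 M (x (Suc r))"
proof -
  have "L2 M (\<lambda>\<omega>. x r \<omega> + (\<eta>g / real S) *\<^sub>R (\<Sum>i=1..N. sel r i \<omega> *\<^sub>R (y r i K \<omega> - x r \<omega>)))"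
    using L2_x y_L2 by (intro L2_add L2_scaleR L2_sum sel_L2 L2_diff) auto
  then show ?thesis
    unfolding L2_def using x_Suc[OF r]
    by (simp cong: measurable_cong Bochner_Integration.integrable_cong)
qed

text \<open>Clients are selected independently of the local runs, which are thought of as taking place at
  all clients.\<close>

lemma sel_integral:
  assumes "i \<in> {1..N}" "W \<in> borel_measurable (gen (draws N K R - {Sampling (Suc r)}))" "integrable M W"
  shows "integrable M (\<lambda>\<omega>. sel r i \<omega> * W \<omega>)"
    "(\<integral>\<omega>. sel r i \<omega> * W \<omega> \<partial>M) = real S / real N * (\<integral>\<omega>. W \<omega> \<partial>M)"
proof -
  have "(\<lambda>a. of_bool (i \<in> a) :: real) \<in> borel_measurable P"
    by (simp add: P_def measurable_def sets_uniform_count_measure space_uniform_count_measure)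
  note * = fresh_product[OF fresh_sampling[OF r] this, of 1, OF _ assms(2,3)]
  show "integrable M (\<lambda>\<omega>. sel r i \<omega> * W \<omega>)" using *(1) by (simp add: sel_def)
  show "(\<integral>\<omega>. sel r i \<omega> * W \<omega> \<partial>M) = real S / real N * (\<integral>\<omega>. W \<omega> \<partial>M)"
    using *(2) sampling_mean[OF S assms(1)] by (simp add: sel_def P_def)
qed

lemma sel2_integral:
  assumes "W \<in> borel_measurable (gen (draws N K R - {Sampling (Suc r)}))" "integrable M W"
  shows "integrable M (\<lambda>\<omega>. sel r i \<omega> * sel r j \<omega> * W \<omega>)"
    "(\<integral>\<omega>. sel r i \<omega> * sel r j \<omega> * W \<omega> \<partial>M)
      = (\<integral>a. of_bool (i \<in> a) * of_bool (j \<in> a) \<partial>P) * (\<integral>\<omega>. W \<omega> \<partial>M)"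
proof -
  have "(\<lambda>a. of_bool (i \<in> a) * of_bool (j \<in> a) :: real) \<in> borel_measurable P"
    by (simp add: P_def measurable_def sets_uniform_count_measure space_uniform_count_measure)
  note * = fresh_product[OF fresh_sampling[OF r] this, of 1, OF _ assms]
  show "integrable M (\<lambda>\<omega>. sel r i \<omega> * sel r j \<omega> * W \<omega>)" using *(1) by (simp add: sel_def)
  show "(\<integral>\<omega>. sel r i \<omega> * sel r j \<omega> * W \<omega> \<partial>M)
      = (\<integral>a. of_bool (i \<in> a) * of_bool (j \<in> a) \<partial>P) * (\<integral>\<omega>. W \<omega> \<partial>M)"
    using *(2) by (simp add: sel_def)
qed

lemma local_measurable:
  defines "H \<equiv> gen (draws N K R - {Sampling (Suc r)})"
  shows "x r \<in> borel_measurable H"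
    and "i \<in> {1..N} \<Longrightarrow> k < K \<Longrightarrow> y r i k \<in> borel_measurable H"
    and "i \<in> {1..N} \<Longrightarrow> k < K \<Longrightarrow> noise r i k \<in> borel_measurable H"
proof -
  show x: "x r \<in> borel_measurable H"
    unfolding H_def using r past_other by (intro x_measurable) auto
  have J: "Data (Suc r) i j \<in> draws N K R - {Sampling (Suc r)}" "Quantum (Suc r) i j \<in> draws N K R - {Sampling (Suc r)}"
    if "i \<in> {1..N}" "j < K" for i j
    using that r by (auto simp: draws_def)
  show "y r i k \<in> borel_measurable H" if "i \<in> {1..N}" "k < K"
    unfolding H_def using that J x by (intro y_measurable(1)[OF r]) (auto simp: H_def)
  show "noise r i k \<in> borel_measurable H" if "i \<in> {1..N}" "k < K"
    unfolding H_def using that J x by (intro y_measurable(3)[OF r, where k = K]) (auto simp: H_def)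
qed

section \<open>Second moments of the parts of an update\<close>

lemma noise_orthogonal:
  assumes i: "i \<in> {1..N}" and k: "k < K" and Z: "L2 M Z" "Z \<in> borel_measurable (gen (other_calls r i k))"
  shows "(\<integral>\<omega>. Z \<omega> \<bullet> noise r i k \<omega> \<partial>M) = 0"
  using fresh_orthogonal[OF fresh_call[OF r i k] centred_measurable[OF i] centred_mean[OF i]
      y_measurable_other[OF i k] Z(2,1)] noise_L2(1)[OF i k]
  by (simp add: noise_def[abs_def] q_def)

lemma sel_measurable_other: "sel r j \<in> borel_measurable (gen (other_calls r i k))"
  using r by (intro sel_measurable) (auto simp: other_calls_def draws_def)

text \<open>Of two distinct oracle calls, the one with the smaller local step is determined by draws
  other than those of the other call.\<close>

lemma noise_cross:
  assumes i: "i \<in> {1..N}" "k < K" and j: "j \<in> {1..N}" "l < K" and ne: "(i, k) \<noteq> (j, l)"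
  shows "(\<integral>\<omega>. (sel r i \<omega> *\<^sub>R noise r i k \<omega>) \<bullet> (sel r j \<omega> *\<^sub>R noise r j l \<omega>) \<partial>M) = 0"
proof -
  have *: "(\<integral>\<omega>. (sel r i \<omega> *\<^sub>R noise r i k \<omega>) \<bullet> (sel r j \<omega> *\<^sub>R noise r j l \<omega>) \<partial>M) = 0"
    if i: "i \<in> {1..N}" "k < K" and j: "j \<in> {1..N}" "l < K" and ne: "(i, k) \<noteq> (j, l)" and kl: "k \<le> l"
    for i k j l
  proof -
    have x: "x r \<in> borel_measurable (gen (other_calls r j l))"
      using r past_other by (intro x_measurable) auto
    \<comment> \<open>The noise at step \<open>k\<close> needs the samples up to and including
      \<open>k\<close>, hence \<open>Suc k\<close>. For \<open>k \<le> l\<close> and distinct pairs,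
      none of these is the sample of call \<open>(j, l)\<close>.\<close>
    have "noise r i k \<in> borel_measurable (gen (other_calls r j l))"
      using i j ne kl r x
      by (intro y_measurable(3)[OF r, where k = "Suc k"]) (auto simp: other_calls_def draws_def)
    \<comment> \<open>Both selection factors are moved to the side of the earlier noise; they do not
      depend on any call.\<close>
    then have "(\<lambda>\<omega>. sel r j \<omega> *\<^sub>R sel r i \<omega> *\<^sub>R noise r i k \<omega>) \<in> borel_measurable (gen (other_calls r j l))"
      using sel_measurable_other by (intro borel_measurable_scaleR)
    moreover have "L2 M (\<lambda>\<omega>. sel r j \<omega> *\<^sub>R sel r i \<omega> *\<^sub>R noise r i k \<omega>)"
      using noise_L2(1)[OF i] by (intro sel_L2)
    ultimately have "(\<integral>\<omega>. (sel r j \<omega> *\<^sub>R sel r i \<omega> *\<^sub>R noise r i k \<omega>) \<bullet> noise r j l \<omega> \<partial>M) = 0"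
      using noise_orthogonal[OF j] by blast
    then show ?thesis by (simp add: mult_ac)
  qed
  show ?thesis
  proof (cases "k \<le> l")
    case True
    then show ?thesis using * i j ne by blast
  next
    case False
    then show ?thesis using *[of j l i k] i j ne by (auto simp: inner_commute mult_ac)
  qed
qed

text \<open>Orthogonality leaves the \<open>N * K\<close> diagonal terms, each weighted by the
  selection probability \<open>S / N\<close>; the total is linear in \<open>S * K\<close> instead of
  quadratic.\<close>

lemma noise_sum:
  "(\<integral>\<omega>. (norm (\<Sum>p\<in>calls. sel r (fst p) \<omega> *\<^sub>R noise r (fst p) (snd p) \<omega>))\<^sup>2 \<partial>M) \<le> real S * real K * V"
proof -
  define n where "n p \<omega> = sel r (fst p) \<omega> *\<^sub>R noise r (fst p) (snd p) \<omega>" for p \<omega>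
  have fin: "finite calls" by (simp add: calls_def)
  have L2: "L2 M (n p)" if "p \<in> calls" for p
    using that noise_L2(1) unfolding n_def by (intro sel_L2) (auto simp: calls_def)
  have diag: "(\<integral>\<omega>. n p \<omega> \<bullet> n p \<omega> \<partial>M) \<le> real S / real N * V" if "p \<in> calls" for p
  proof -
    have p: "fst p \<in> {1..N}" "snd p < K" using that by (auto simp: calls_def)
    \<comment> \<open>A selection indicator equals its square.\<close>
    have "(\<integral>\<omega>. n p \<omega> \<bullet> n p \<omega> \<partial>M) = (\<integral>\<omega>. sel r (fst p) \<omega> * (norm (noise r (fst p) (snd p) \<omega>))\<^sup>2 \<partial>M)"
      by (intro Bochner_Integration.integral_cong) (auto simp: n_def power2_norm_eq_inner sel_def)
    also have "\<dots> = real S / real N * (\<integral>\<omega>. (norm (noise r (fst p) (snd p) \<omega>))\<^sup>2 \<partial>M)"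
      using noise_L2(1)[OF p] local_measurable(3)[OF p] p by (intro sel_integral) (auto simp: L2_def)
    also have "\<dots> \<le> real S / real N * V"
      using noise_L2(2)[OF p] by (intro mult_left_mono) auto
    finally show ?thesis .
  qed
  have off: "(\<integral>\<omega>. n p \<omega> \<bullet> n p' \<omega> \<partial>M) = 0" if "p \<in> calls" "p' \<in> calls" "p \<noteq> p'" for p p'
    using that noise_cross[of "fst p" "snd p" "fst p'" "snd p'"] unfolding n_def calls_def by auto
  have "(\<integral>\<omega>. (norm (\<Sum>p\<in>calls. n p \<omega>))\<^sup>2 \<partial>M) = (\<integral>\<omega>. (\<Sum>p\<in>calls. \<Sum>p'\<in>calls. n p \<omega> \<bullet> n p' \<omega>) \<partial>M)"
    by (simp only: norm_sum_squared_eq)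
  also have "\<dots> = (\<Sum>p\<in>calls. \<Sum>p'\<in>calls. \<integral>\<omega>. n p \<omega> \<bullet> n p' \<omega> \<partial>M)"
    by (intro integral_double_sum L2_inner L2)
  also have "\<dots> = (\<Sum>p\<in>calls. \<integral>\<omega>. n p \<omega> \<bullet> n p \<omega> \<partial>M)"
  proof (intro sum.cong refl)
    fix p assume p: "p \<in> calls"
    have "(\<Sum>p'\<in>calls. \<integral>\<omega>. n p \<omega> \<bullet> n p' \<omega> \<partial>M) = (\<Sum>p'\<in>{p}. \<integral>\<omega>. n p \<omega> \<bullet> n p' \<omega> \<partial>M)"
    proof (rule sum.mono_neutral_right)
      show "\<forall>p'\<in>calls - {p}. (\<integral>\<omega>. n p \<omega> \<bullet> n p' \<omega> \<partial>M) = 0"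
        using off[OF p] by (metis DiffD1 DiffD2 singletonI)
    qed (use p fin in auto)
    then show "(\<Sum>p'\<in>calls. \<integral>\<omega>. n p \<omega> \<bullet> n p' \<omega> \<partial>M) = (\<integral>\<omega>. n p \<omega> \<bullet> n p \<omega> \<partial>M)" by simp
  qed
  also have "\<dots> \<le> (\<Sum>p\<in>calls. real S / real N * V)"
    using diag by (rule sum_mono)
  also have "\<dots> = real S * real K * V"
    using S by (simp add: calls_def)
  finally show ?thesis by (simp add: n_def)
qed

lemma err_L2: "i \<in> {1..N} \<Longrightarrow> k < K \<Longrightarrow> L2 M (err r i k)"
  unfolding err_def using L2_x smooth y_L2 by (intro L2_diff mean_L2 gradient_L2) auto

lemma err_measurable:
  "i \<in> {1..N} \<Longrightarrow> k < K \<Longrightarrow> err r i k \<in> borel_measurable (gen (draws N K R - {Sampling (Suc r)}))"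
  unfolding err_def[abs_def]
  by (intro borel_measurable_diff measurable_comp_H local_measurable)

text \<open>The errors may be correlated, so Cauchy-Schwarz is used. It is applied at each sample
  point, before integration, where only \<open>S * K\<close> summands are nonzero; counting all
  \<open>N * K\<close> calls would lose a factor \<open>N / S\<close>.\<close>

lemma err_sum:
  "(\<integral>\<omega>. (norm (\<Sum>p\<in>calls. sel r (fst p) \<omega> *\<^sub>R err r (fst p) (snd p) \<omega>))\<^sup>2 \<partial>M)
    \<le> (real S)\<^sup>2 * (real K)\<^sup>2 * err_sq r"
proof -
  define e where "e p \<omega> = (norm (err r (fst p) (snd p) \<omega>))\<^sup>2" for p \<omega>
  have p: "fst p \<in> {1..N}" "snd p < K" if "p \<in> calls" for p using that by (auto simp: calls_def)
  have e: "integrable M (e p)" "e p \<in> borel_measurable (gen (draws N K R - {Sampling (Suc r)}))"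
    if "p \<in> calls" for p
    using err_L2[OF p[OF that]] err_measurable[OF p[OF that]] unfolding e_def[abs_def]
    by (auto simp: L2_def)
  have sel_e: "integrable M (\<lambda>\<omega>. sel r (fst p) \<omega> * e p \<omega>)"
    "(\<integral>\<omega>. sel r (fst p) \<omega> * e p \<omega> \<partial>M) = real S / real N * (\<integral>\<omega>. e p \<omega> \<partial>M)" if "p \<in> calls" for p
    using sel_integral[OF p(1)[OF that] e(2,1)[OF that]] by auto
  have int: "integrable M (\<lambda>\<omega>. \<Sum>p\<in>calls. sel r (fst p) \<omega> * e p \<omega>)"
    using sel_e by auto
  have "(\<integral>\<omega>. (norm (\<Sum>p\<in>calls. sel r (fst p) \<omega> *\<^sub>R err r (fst p) (snd p) \<omega>))\<^sup>2 \<partial>M)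
      \<le> (\<integral>\<omega>. real (S * K) * (\<Sum>p\<in>calls. sel r (fst p) \<omega> * e p \<omega>) \<partial>M)"
  proof (rule integral_mono)
    show "integrable M (\<lambda>\<omega>. (norm (\<Sum>p\<in>calls. sel r (fst p) \<omega> *\<^sub>R err r (fst p) (snd p) \<omega>))\<^sup>2)"
      using err_L2 p by (intro L2_integrable L2_sum sel_L2) auto
    show "integrable M (\<lambda>\<omega>. real (S * K) * (\<Sum>p\<in>calls. sel r (fst p) \<omega> * e p \<omega>))"
      using int by simp
    fix \<omega> assume \<omega>: "\<omega> \<in> space M"
    note a = sampled_clients[OF r \<omega>]
    let ?C = "A (Suc r) \<omega> \<times> {..<K}"
    have C: "?C \<subseteq> calls" using a by (auto simp: calls_def)
    have fin: "finite calls" by (simp add: calls_def)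
    have "(\<Sum>p\<in>calls. sel r (fst p) \<omega> *\<^sub>R err r (fst p) (snd p) \<omega>) = (\<Sum>p\<in>?C. err r (fst p) (snd p) \<omega>)"
      using C fin by (intro sum.mono_neutral_cong_right) (auto simp: sel_def calls_def)
    moreover have "(\<Sum>p\<in>calls. sel r (fst p) \<omega> * e p \<omega>) = (\<Sum>p\<in>?C. e p \<omega>)"
      using C fin by (intro sum.mono_neutral_cong_right) (auto simp: sel_def calls_def)
    moreover have "(norm (\<Sum>p\<in>?C. err r (fst p) (snd p) \<omega>))\<^sup>2 \<le> real (S * K) * (\<Sum>p\<in>?C. e p \<omega>)"
      using norm_sum_squared_le[of "\<lambda>p. err r (fst p) (snd p) \<omega>" ?C] a by (simp add: e_def card_cartesian_product)
    ultimately show "(norm (\<Sum>p\<in>calls. sel r (fst p) \<omega> *\<^sub>R err r (fst p) (snd p) \<omega>))\<^sup>2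
        \<le> real (S * K) * (\<Sum>p\<in>calls. sel r (fst p) \<omega> * e p \<omega>)" by simp
  qed
  also have "\<dots> = real (S * K) * (\<Sum>p\<in>calls. real S / real N * (\<integral>\<omega>. e p \<omega> \<partial>M))"
    using sel_e by (simp add: Bochner_Integration.integral_sum)
  also have "\<dots> = real (S * K) * (real S / real N * (\<Sum>p\<in>calls. \<integral>\<omega>. e p \<omega> \<partial>M))"
    by (simp only: sum_distrib_left)
  also have "\<dots> = (real S)\<^sup>2 * (real K)\<^sup>2 * err_sq r"
    using S K by (simp add: err_sq_def e_def power2_eq_square)
  finally show ?thesis .
qed

lemma dissimilarity_sq: "(\<Sum>i=1..N. local_grad_sq r i) \<le> real N * (G\<^sup>2 + B\<^sup>2 * grad_sq r)"
proof -
  have L2: "L2 M (\<lambda>\<omega>. gradient (f i) (x r \<omega>))" if "i \<in> {1..N}" for i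
    using smooth[OF that] L2_x by (rule gradient_L2)
  have L2': "L2 M (\<lambda>\<omega>. gradient obj (x r \<omega>))"
    using smooth_obj L2_x by (rule gradient_L2)
  have "(\<Sum>i=1..N. local_grad_sq r i) = (\<integral>\<omega>. (\<Sum>i=1..N. (norm (gradient (f i) (x r \<omega>)))\<^sup>2) \<partial>M)"
    unfolding local_grad_sq_def using L2 by (subst Bochner_Integration.integral_sum) (auto simp: L2_def)
  also have "\<dots> \<le> (\<integral>\<omega>. real N * (G\<^sup>2 + B\<^sup>2 * (norm (gradient obj (x r \<omega>)))\<^sup>2) \<partial>M)"
  proof (rule integral_mono)
    show "integrable M (\<lambda>\<omega>. \<Sum>i=1..N. (norm (gradient (f i) (x r \<omega>)))\<^sup>2)"
      using L2 by (auto simp: L2_def)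
    show "integrable M (\<lambda>\<omega>. real N * (G\<^sup>2 + B\<^sup>2 * (norm (gradient obj (x r \<omega>)))\<^sup>2))"
      using L2' by (auto simp: L2_def)
    fix \<omega>
    have "1 / real N * (\<Sum>i=1..N. (norm (gradient (f i) (x r \<omega>)))\<^sup>2)
        \<le> G\<^sup>2 + B\<^sup>2 * (norm (gradient obj (x r \<omega>)))\<^sup>2"
      using dissimilarity unfolding bounded_gradient_dissimilarity_def obj_def by blast
    then show "(\<Sum>i=1..N. (norm (gradient (f i) (x r \<omega>)))\<^sup>2)
        \<le> real N * (G\<^sup>2 + B\<^sup>2 * (norm (gradient obj (x r \<omega>)))\<^sup>2)"
      using S by (simp add: field_simps)
  qed
  also have "\<dots> = real N * (G\<^sup>2 + B\<^sup>2 * grad_sq r)"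
    using L2' by (simp add: grad_sq_def prob_space L2_def)
  finally show ?thesis .
qed

text \<open>\<open>sampling_variance\<close> needs a centred family, so the mean gradient is split
  off. Exactly \<open>S\<close> clients are selected, hence the mean contributes \<open>S\<close>
  times the full gradient, and only the deviations feel the sampling.\<close>

lemma grad_sum:
  "(\<integral>\<omega>. (norm (\<Sum>i=1..N. sel r i \<omega> *\<^sub>R gradient (f i) (x r \<omega>)))\<^sup>2 \<partial>M)
    \<le> 2 * (real S)\<^sup>2 * grad_sq r + 2 * (real S / real N) * (\<Sum>i=1..N. local_grad_sq r i)"
proof -
  define v where "v i \<omega> = gradient (f i) (x r \<omega>)" for i \<omega>
  define m where "m \<omega> = gradient obj (x r \<omega>)" for \<omega>
  define u where "u i \<omega> = v i \<omega> - m \<omega>" for i \<omega>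
  define p :: "nat \<Rightarrow> nat \<Rightarrow> real" where "p i j = (\<integral>a. of_bool (i \<in> a) * of_bool (j \<in> a) \<partial>P)" for i j
  have v: "L2 M (v i)" if "i \<in> {1..N}" for i
    unfolding v_def using smooth[OF that] L2_x by (rule gradient_L2)
  have m: "L2 M m"
    unfolding m_def using smooth_obj L2_x by (rule gradient_L2)
  have u: "L2 M (u i)" if "i \<in> {1..N}" for i
    unfolding u_def using v[OF that] m by (rule L2_diff)
  have sum_v: "(\<Sum>i=1..N. v i \<omega>) = real N *\<^sub>R m \<omega>" for \<omega>
    using S by (simp add: v_def m_def gradient_obj)
  have centred: "(\<Sum>i=1..N. u i \<omega>) = 0" for \<omega>
    using sum_v[of \<omega>] unfolding u_def sum_subtractf by (simp add: scaleR_conv_of_real sum_constant_scaleR)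
  have u_meas: "u i \<in> borel_measurable (gen (draws N K R - {Sampling (Suc r)}))" if "i \<in> {1..N}" for i
    unfolding u_def[abs_def] v_def m_def
    using that by (intro borel_measurable_diff measurable_comp_H local_measurable)
  have uu: "integrable M (\<lambda>\<omega>. sel r i \<omega> * sel r j \<omega> * (u i \<omega> \<bullet> u j \<omega>))"
    "(\<integral>\<omega>. sel r i \<omega> * sel r j \<omega> * (u i \<omega> \<bullet> u j \<omega>) \<partial>M) = p i j * (\<integral>\<omega>. u i \<omega> \<bullet> u j \<omega> \<partial>M)"
    "integrable M (\<lambda>\<omega>. u i \<omega> \<bullet> u j \<omega>)"
    if "i \<in> {1..N}" "j \<in> {1..N}" for i j
    using sel2_integral[of "\<lambda>\<omega>. u i \<omega> \<bullet> u j \<omega>" i j] that u_meas L2_inner[OF u u] unfolding p_def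
    by (auto intro: borel_measurable_inner)
  have "(\<integral>\<omega>. (norm (\<Sum>i=1..N. sel r i \<omega> *\<^sub>R u i \<omega>))\<^sup>2 \<partial>M)
      = (\<integral>\<omega>. (\<Sum>i=1..N. \<Sum>j=1..N. sel r i \<omega> * sel r j \<omega> * (u i \<omega> \<bullet> u j \<omega>)) \<partial>M)"
    by (simp only: norm_sum_squared_eq inner_scaleR_left inner_scaleR_right mult_ac)
  also have "\<dots> = (\<Sum>i=1..N. \<Sum>j=1..N. \<integral>\<omega>. sel r i \<omega> * sel r j \<omega> * (u i \<omega> \<bullet> u j \<omega>) \<partial>M)"
    by (intro integral_double_sum uu(1))
  also have "\<dots> = (\<Sum>i=1..N. \<Sum>j=1..N. \<integral>\<omega>. p i j * (u i \<omega> \<bullet> u j \<omega>) \<partial>M)"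
    using uu(2) by (intro sum.cong refl) auto
  \<comment> \<open>Now that the selections are replaced by numbers, the sum goes back under the
    integral: \<open>sampling_variance\<close> is about fixed vectors and is applied at each sample
    point.\<close>
  also have "\<dots> = (\<integral>\<omega>. (\<Sum>i=1..N. \<Sum>j=1..N. p i j * (u i \<omega> \<bullet> u j \<omega>)) \<partial>M)"
    by (intro integral_double_sum[symmetric] integrable_mult_right uu(3))
  also have "\<dots> \<le> (\<integral>\<omega>. real S / real N * (\<Sum>i=1..N. (norm (v i \<omega>))\<^sup>2) \<partial>M)"
  proof (rule integral_mono)
    show "integrable M (\<lambda>\<omega>. \<Sum>i=1..N. \<Sum>j=1..N. p i j * (u i \<omega> \<bullet> u j \<omega>))"
      by (intro Bochner_Integration.integrable_sum integrable_mult_right uu(3))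
    show "integrable M (\<lambda>\<omega>. real S / real N * (\<Sum>i=1..N. (norm (v i \<omega>))\<^sup>2))"
      using v by (intro Bochner_Integration.integrable_sum integrable_mult_right) (auto simp: L2_def)
    fix \<omega>
    \<comment> \<open>Variance identity: centring lowers the sum of squares by \<open>N\<close>
      times the squared mean.\<close>
    have "(\<Sum>i=1..N. (norm (u i \<omega>))\<^sup>2)
        = (\<Sum>i=1..N. (norm (v i \<omega>))\<^sup>2 - 2 * (v i \<omega> \<bullet> m \<omega>) + (norm (m \<omega>))\<^sup>2)"
      by (simp add: u_def power2_norm_eq_inner inner_diff_left inner_diff_right inner_commute algebra_simps)
    also have "\<dots> = (\<Sum>i=1..N. (norm (v i \<omega>))\<^sup>2) - 2 * ((\<Sum>i=1..N. v i \<omega>) \<bullet> m \<omega>) + real N * (norm (m \<omega>))\<^sup>2"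
      by (simp add: sum.distrib sum_subtractf inner_sum_left sum_distrib_left)
    also have "\<dots> = (\<Sum>i=1..N. (norm (v i \<omega>))\<^sup>2) - real N * (norm (m \<omega>))\<^sup>2"
      by (simp only: sum_v) (simp add: power2_norm_eq_inner)
    also have "\<dots> \<le> (\<Sum>i=1..N. (norm (v i \<omega>))\<^sup>2)" by simp
    finally have "real S / real N * (\<Sum>i=1..N. (norm (u i \<omega>))\<^sup>2) \<le> real S / real N * (\<Sum>i=1..N. (norm (v i \<omega>))\<^sup>2)"
      by (intro mult_left_mono) auto
    moreover have "(\<Sum>i=1..N. \<Sum>j=1..N. p i j * (u i \<omega> \<bullet> u j \<omega>)) \<le> real S / real N * (\<Sum>i=1..N. (norm (u i \<omega>))\<^sup>2)"
      using sampling_variance[OF S centred] by (simp add: p_def P_def)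
    ultimately show "(\<Sum>i=1..N. \<Sum>j=1..N. p i j * (u i \<omega> \<bullet> u j \<omega>)) \<le> real S / real N * (\<Sum>i=1..N. (norm (v i \<omega>))\<^sup>2)"
      by (rule order_trans[rotated])
  qed
  also have "\<dots> = real S / real N * (\<Sum>i=1..N. local_grad_sq r i)"
    using v by (simp add: local_grad_sq_def v_def L2_def Bochner_Integration.integral_sum)
  finally have centred_bound: "(\<integral>\<omega>. (norm (\<Sum>i=1..N. sel r i \<omega> *\<^sub>R u i \<omega>))\<^sup>2 \<partial>M)
      \<le> real S / real N * (\<Sum>i=1..N. local_grad_sq r i)" .
  have int_m: "integrable M (\<lambda>\<omega>. 2 * (real S)\<^sup>2 * (norm (m \<omega>))\<^sup>2)"
    using m by (simp add: L2_def)
  have int_u: "integrable M (\<lambda>\<omega>. 2 * (norm (\<Sum>i=1..N. sel r i \<omega> *\<^sub>R u i \<omega>))\<^sup>2)"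
    using u by (intro integrable_mult_right L2_integrable L2_sum sel_L2) auto
  have "(\<integral>\<omega>. (norm (\<Sum>i=1..N. sel r i \<omega> *\<^sub>R v i \<omega>))\<^sup>2 \<partial>M)
      \<le> (\<integral>\<omega>. 2 * (real S)\<^sup>2 * (norm (m \<omega>))\<^sup>2 + 2 * (norm (\<Sum>i=1..N. sel r i \<omega> *\<^sub>R u i \<omega>))\<^sup>2 \<partial>M)"
  proof (rule integral_mono)
    show "integrable M (\<lambda>\<omega>. (norm (\<Sum>i=1..N. sel r i \<omega> *\<^sub>R v i \<omega>))\<^sup>2)"
      using v by (intro L2_integrable L2_sum sel_L2) auto
    show "integrable M (\<lambda>\<omega>. 2 * (real S)\<^sup>2 * (norm (m \<omega>))\<^sup>2 + 2 * (norm (\<Sum>i=1..N. sel r i \<omega> *\<^sub>R u i \<omega>))\<^sup>2)"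
      using int_m int_u by (rule Bochner_Integration.integrable_add)
    fix \<omega> assume \<omega>: "\<omega> \<in> space M"
    note a = sampled_clients[OF r \<omega>]
    have "(\<Sum>i=1..N. sel r i \<omega>) = (\<Sum>i\<in>A (Suc r) \<omega>. 1)"
      using a by (intro sum.mono_neutral_cong_right) (auto simp: sel_def)
    then have "(\<Sum>i=1..N. sel r i \<omega>) = real S" using a by simp
    then have "(\<Sum>i=1..N. sel r i \<omega> *\<^sub>R v i \<omega>) = real S *\<^sub>R m \<omega> + (\<Sum>i=1..N. sel r i \<omega> *\<^sub>R u i \<omega>)"
      by (simp add: u_def scaleR_diff_right sum_subtractf flip: scaleR_sum_left)
    then show "(norm (\<Sum>i=1..N. sel r i \<omega> *\<^sub>R v i \<omega>))\<^sup>2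
        \<le> 2 * (real S)\<^sup>2 * (norm (m \<omega>))\<^sup>2 + 2 * (norm (\<Sum>i=1..N. sel r i \<omega> *\<^sub>R u i \<omega>))\<^sup>2"
      using norm_add_squared_le[of "real S *\<^sub>R m \<omega>" "\<Sum>i=1..N. sel r i \<omega> *\<^sub>R u i \<omega>"]
      by (simp add: power_mult_distrib)
  qed
  also have "\<dots> = 2 * (real S)\<^sup>2 * grad_sq r + 2 * (\<integral>\<omega>. (norm (\<Sum>i=1..N. sel r i \<omega> *\<^sub>R u i \<omega>))\<^sup>2 \<partial>M)"
    using int_m int_u by (subst Bochner_Integration.integral_add) (auto simp: grad_sq_def m_def)
  finally show ?thesis using centred_bound by (simp add: v_def)
qed

section \<open>Client drift and the resulting error\<close>

lemma q_squared_le: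
  assumes "i \<in> {1..N}"
  shows "(norm (q r i k \<omega>))\<^sup>2 \<le> 4 * (norm (noise r i k \<omega>))\<^sup>2 + 4 * Uq\<^sup>2
    + 4 * (\<beta>\<^sup>2 * (norm (y r i k \<omega> - x r \<omega>))\<^sup>2) + 4 * (norm (gradient (f i) (x r \<omega>)))\<^sup>2"
proof -
  let ?y = "y r i k \<omega>" and ?x = "x r \<omega>"
  have "(norm (mean i ?y - gradient (f i) ?y))\<^sup>2 \<le> Uq\<^sup>2"
    using mean_bias[OF assms] by (intro power_mono) auto
  moreover have "(norm (gradient (f i) ?y - gradient (f i) ?x))\<^sup>2 \<le> (\<beta> * norm (?y - ?x))\<^sup>2"
    using beta_smooth_lipschitz[OF smooth[OF assms]] by (intro power_mono) auto
  moreover have "q r i k \<omega> = noise r i k \<omega> + (mean i ?y - gradient (f i) ?y)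
      + (gradient (f i) ?y - gradient (f i) ?x) + gradient (f i) ?x"
    by (simp add: noise_def)
  ultimately show ?thesis
    using norm_add4_squared_le[of "noise r i k \<omega>" "mean i ?y - gradient (f i) ?y"
        "gradient (f i) ?y - gradient (f i) ?x" "gradient (f i) ?x"]
    by (simp add: power_mult_distrib)
qed

lemma err_squared_le:
  assumes "i \<in> {1..N}"
  shows "(norm (err r i k \<omega>))\<^sup>2 \<le> 2 * Uq\<^sup>2 + 2 * (\<beta>\<^sup>2 * (norm (y r i k \<omega> - x r \<omega>))\<^sup>2)"
proof -
  let ?y = "y r i k \<omega>" and ?x = "x r \<omega>"
  have "(norm (mean i ?y - gradient (f i) ?y))\<^sup>2 \<le> Uq\<^sup>2"
    using mean_bias[OF assms] by (intro power_mono) auto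
  moreover have "(norm (gradient (f i) ?y - gradient (f i) ?x))\<^sup>2 \<le> (\<beta> * norm (?y - ?x))\<^sup>2"
    using beta_smooth_lipschitz[OF smooth[OF assms]] by (intro power_mono) auto
  ultimately show ?thesis
    using norm_add_squared_le[of "mean i ?y - gradient (f i) ?y" "gradient (f i) ?y - gradient (f i) ?x"]
    by (simp add: power_mult_distrib err_def)
qed

text \<open>Strong induction over local steps: the bound at earlier steps controls the feedback of
  drift into the gradients. Noise is added up by Cauchy-Schwarz, so it scales with
  \<open>K\<^sup>2\<close>; this is why the variances stand next to \<open>G\<^sup>2\<close> in the
  drift term of the theorem with no division by \<open>K\<close>.\<close>

lemma drift:
  assumes i: "i \<in> {1..N}" and small: "8 * (\<beta> * \<eta>l * real K)\<^sup>2 \<le> 1" and "k \<le> K"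
  shows "(\<integral>\<omega>. (norm (y r i k \<omega> - x r \<omega>))\<^sup>2 \<partial>M) \<le> 8 * (\<eta>l * real K)\<^sup>2 * (V + Uq\<^sup>2 + local_grad_sq r i)"
  using \<open>k \<le> K\<close>
proof (induction k rule: less_induct)
  case (less k)
  define W where "W = V + Uq\<^sup>2 + local_grad_sq r i"
  have W: "0 \<le> W" by (simp add: W_def V_nonneg local_grad_sq_def)
  have grad: "L2 M (\<lambda>\<omega>. gradient (f i) (x r \<omega>))"
    using smooth[OF i] L2_x by (rule gradient_L2)
  have diff: "L2 M (\<lambda>\<omega>. y r i j \<omega> - x r \<omega>)" if "j \<le> K" for j
    using y_L2[OF i that] L2_x by (rule L2_diff)
  have q: "(\<integral>\<omega>. (norm (q r i j \<omega>))\<^sup>2 \<partial>M) \<le> 8 * W" if "j < k" for j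
  proof -
    have j: "j < K" using that less.prems by simp
    \<comment> \<open>The constant 8 closes on itself: the feedback is at most \<open>W\<close>,
      noise, bias and gradient together give \<open>W\<close> as well, and the split into four parts
      costs a factor 4.\<close>
    have d: "\<beta>\<^sup>2 * (\<integral>\<omega>. (norm (y r i j \<omega> - x r \<omega>))\<^sup>2 \<partial>M) \<le> W"
    proof -
      have "\<beta>\<^sup>2 * (\<integral>\<omega>. (norm (y r i j \<omega> - x r \<omega>))\<^sup>2 \<partial>M) \<le> \<beta>\<^sup>2 * (8 * (\<eta>l * real K)\<^sup>2 * W)"
        using less.IH[OF that] j by (intro mult_left_mono) (auto simp: W_def)
      also have "\<dots> = (8 * (\<beta> * \<eta>l * real K)\<^sup>2) * W" by (simp add: power_mult_distrib)
      also have "\<dots> \<le> W" using small W by (intro mult_left_le_one_le) auto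
      finally show ?thesis .
    qed
    note ints = L2_integrable[OF noise_L2(1)[OF i j]] L2_integrable[OF diff[of j]] L2_integrable[OF grad]
    have "(\<integral>\<omega>. (norm (q r i j \<omega>))\<^sup>2 \<partial>M) \<le> (\<integral>\<omega>. 4 * (norm (noise r i j \<omega>))\<^sup>2 + 4 * Uq\<^sup>2
        + 4 * (\<beta>\<^sup>2 * (norm (y r i j \<omega> - x r \<omega>))\<^sup>2) + 4 * (norm (gradient (f i) (x r \<omega>)))\<^sup>2 \<partial>M)"
      using ints j L2_integrable[OF q_L2[OF i j]] by (intro integral_mono q_squared_le[OF i]) auto
    also have "\<dots> = 4 * (\<integral>\<omega>. (norm (noise r i j \<omega>))\<^sup>2 \<partial>M) + 4 * Uq\<^sup>2
        + 4 * (\<beta>\<^sup>2 * (\<integral>\<omega>. (norm (y r i j \<omega> - x r \<omega>))\<^sup>2 \<partial>M)) + 4 * local_grad_sq r i"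
      using ints j by (simp add: prob_space local_grad_sq_def)
    also have "\<dots> \<le> 8 * W"
      using d noise_L2(2)[OF i j] unfolding W_def by simp
    finally show ?thesis .
  qed
  have "(\<integral>\<omega>. (norm (y r i k \<omega> - x r \<omega>))\<^sup>2 \<partial>M) \<le> (\<integral>\<omega>. \<eta>l\<^sup>2 * (real K * (\<Sum>j<k. (norm (q r i j \<omega>))\<^sup>2)) \<partial>M)"
  proof (rule integral_mono)
    show "integrable M (\<lambda>\<omega>. (norm (y r i k \<omega> - x r \<omega>))\<^sup>2)"
      using less.prems by (intro L2_integrable diff)
    show "integrable M (\<lambda>\<omega>. \<eta>l\<^sup>2 * (real K * (\<Sum>j<k. (norm (q r i j \<omega>))\<^sup>2)))"
      using q_L2[OF i] less.prems by (intro integrable_mult_right Bochner_Integration.integrable_sum) (auto simp: L2_def)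
    fix \<omega>
    have "(norm (\<Sum>j<k. q r i j \<omega>))\<^sup>2 \<le> real k * (\<Sum>j<k. (norm (q r i j \<omega>))\<^sup>2)"
      using norm_sum_squared_le[of "\<lambda>j. q r i j \<omega>" "{..<k}"] by simp
    also have "\<dots> \<le> real K * (\<Sum>j<k. (norm (q r i j \<omega>))\<^sup>2)"
      using less.prems by (intro mult_right_mono sum_nonneg) auto
    finally show "(norm (y r i k \<omega> - x r \<omega>))\<^sup>2 \<le> \<eta>l\<^sup>2 * (real K * (\<Sum>j<k. (norm (q r i j \<omega>))\<^sup>2))"
      unfolding y_diff by (simp add: power_mult_distrib mult_left_mono)
  qed
  also have "\<dots> = \<eta>l\<^sup>2 * (real K * (\<Sum>j<k. \<integral>\<omega>. (norm (q r i j \<omega>))\<^sup>2 \<partial>M))"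
    using L2_integrable[OF q_L2[OF i]] less.prems by (simp add: Bochner_Integration.integral_sum)
  also have "\<dots> \<le> \<eta>l\<^sup>2 * (real K * (\<Sum>j<k. 8 * W))"
    using q by (intro mult_left_mono sum_mono) auto
  also have "\<dots> \<le> \<eta>l\<^sup>2 * (real K * (real K * (8 * W)))"
    using less.prems W by (intro mult_left_mono) (auto intro: mult_right_mono)
  also have "\<dots> = 8 * (\<eta>l * real K)\<^sup>2 * W"
    by (simp add: power2_eq_square)
  finally show ?case by (simp add: W_def)
qed

text \<open>Averaging over clients turns the local gradients of \<open>drift\<close> into the
  dissimilarity bound. The resulting multiple of \<open>grad_sq\<close> goes to the absorption in
  \<open>round_arithmetic\<close>.\<close>

lemma err_sq_le:
  assumes small: "8 * (\<beta> * \<eta>l * real K)\<^sup>2 \<le> 1"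
  shows "err_sq r \<le> 2 * Uq\<^sup>2 + 16 * (\<beta> * \<eta>l * real K)\<^sup>2 * (V + Uq\<^sup>2 + G\<^sup>2 + B\<^sup>2 * grad_sq r)"
proof -
  define c where "c = 16 * (\<beta> * \<eta>l * real K)\<^sup>2"
  have c: "0 \<le> c" by (simp add: c_def)
  have "(\<integral>\<omega>. (norm (err r i k \<omega>))\<^sup>2 \<partial>M) \<le> 2 * Uq\<^sup>2 + c * (V + Uq\<^sup>2) + c * local_grad_sq r i"
    if i: "i \<in> {1..N}" and k: "k < K" for i k
  proof -
    have d: "integrable M (\<lambda>\<omega>. (norm (y r i k \<omega> - x r \<omega>))\<^sup>2)"
      using y_L2[OF i] k L2_x by (intro L2_integrable L2_diff) auto
    have "(\<integral>\<omega>. (norm (err r i k \<omega>))\<^sup>2 \<partial>M) \<le> (\<integral>\<omega>. 2 * Uq\<^sup>2 + 2 * (\<beta>\<^sup>2 * (norm (y r i k \<omega> - x r \<omega>))\<^sup>2) \<partial>M)"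
      using d L2_integrable[OF err_L2[OF i k]] by (intro integral_mono err_squared_le[OF i]) auto
    also have "\<dots> = 2 * Uq\<^sup>2 + 2 * \<beta>\<^sup>2 * (\<integral>\<omega>. (norm (y r i k \<omega> - x r \<omega>))\<^sup>2 \<partial>M)"
      using d by (simp add: prob_space)
    also have "\<dots> \<le> 2 * Uq\<^sup>2 + 2 * \<beta>\<^sup>2 * (8 * (\<eta>l * real K)\<^sup>2 * (V + Uq\<^sup>2 + local_grad_sq r i))"
      using drift[OF i small, of k] k by (intro add_left_mono mult_left_mono) auto
    finally show ?thesis by (simp add: c_def power_mult_distrib algebra_simps)
  qed
  then have "(\<Sum>p\<in>calls. \<integral>\<omega>. (norm (err r (fst p) (snd p) \<omega>))\<^sup>2 \<partial>M)
      \<le> (\<Sum>p\<in>calls. 2 * Uq\<^sup>2 + c * (V + Uq\<^sup>2) + c * local_grad_sq r (fst p))"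
    by (intro sum_mono) (auto simp: calls_def)
  also have "\<dots> = (\<Sum>i=1..N. \<Sum>k<K. 2 * Uq\<^sup>2 + c * (V + Uq\<^sup>2) + c * local_grad_sq r i)"
    by (rule sum_calls)
  also have "\<dots> = real N * real K * (2 * Uq\<^sup>2 + c * (V + Uq\<^sup>2)) + real K * c * (\<Sum>i=1..N. local_grad_sq r i)"
    by (simp add: sum.distrib sum_distrib_left algebra_simps)
  also have "\<dots> \<le> real N * real K * (2 * Uq\<^sup>2 + c * (V + Uq\<^sup>2)) + real K * c * (real N * (G\<^sup>2 + B\<^sup>2 * grad_sq r))"
    using dissimilarity_sq c by (intro add_left_mono mult_left_mono) auto
  also have "\<dots> = real N * real K * (2 * Uq\<^sup>2 + c * (V + Uq\<^sup>2 + G\<^sup>2 + B\<^sup>2 * grad_sq r))"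
    by (simp add: algebra_simps)
  finally show ?thesis
    using S K by (simp add: err_sq_def c_def field_simps)
qed

section \<open>Descent in one round\<close>

text \<open>Against the gradient at \<open>x r\<close> the noise integrates to zero and selection
  yields \<open>S / N\<close>, so what remains is the full gradient plus the averaged error. Young's
  inequality spends half of the squared gradient norm on that error; the bias needs no other
  treatment.\<close>

lemma expected_progress:
  "(\<integral>\<omega>. gradient obj (x r \<omega>) \<bullet> (x (Suc r) \<omega> - x r \<omega>) \<partial>M)
    \<le> - (\<eta>g * \<eta>l * real K / 2) * (grad_sq r - err_sq r)"
proof -
  define m where "m \<omega> = gradient obj (x r \<omega>)" for \<omega>
  have m: "L2 M m"
    unfolding m_def using smooth_obj L2_x by (rule gradient_L2)
  have v: "L2 M (\<lambda>\<omega>. gradient (f i) (x r \<omega>))" if "i \<in> {1..N}" for i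
    using smooth[OF that] L2_x by (rule gradient_L2)
  have m_meas: "m \<in> borel_measurable (gen J)" if "past r \<subseteq> J" for J
    unfolding m_def[abs_def] using that r by (intro measurable_comp_H x_measurable) auto
  have p: "fst p \<in> {1..N}" "snd p < K" if "p \<in> calls" for p using that by (auto simp: calls_def)
  have one: "(\<integral>\<omega>. m \<omega> \<bullet> (sel r i \<omega> *\<^sub>R q r i k \<omega>) \<partial>M)
      = real S / real N * ((\<integral>\<omega>. m \<omega> \<bullet> gradient (f i) (x r \<omega>) \<partial>M) + (\<integral>\<omega>. m \<omega> \<bullet> err r i k \<omega> \<partial>M))"
    if i: "i \<in> {1..N}" and k: "k < K" for i k
  proof -
    let ?v = "\<lambda>\<omega>. gradient (f i) (x r \<omega>)"
    have L2_sum: "L2 M (\<lambda>\<omega>. ?v \<omega> + err r i k \<omega>)"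
      using v[OF i] err_L2[OF i k] by (rule L2_add)
    \<comment> \<open>The selection factor is attached to the gradient: the product is known without
      the call, so the noise is orthogonal to it.\<close>
    have Z: "L2 M (\<lambda>\<omega>. sel r i \<omega> *\<^sub>R m \<omega>)" "(\<lambda>\<omega>. sel r i \<omega> *\<^sub>R m \<omega>) \<in> borel_measurable (gen (other_calls r i k))"
      using m sel_L2 sel_measurable_other m_meas past_other[OF r] by (auto intro!: borel_measurable_scaleR)
    have "(\<integral>\<omega>. m \<omega> \<bullet> (sel r i \<omega> *\<^sub>R q r i k \<omega>) \<partial>M)
        = (\<integral>\<omega>. (sel r i \<omega> *\<^sub>R m \<omega>) \<bullet> noise r i k \<omega> + sel r i \<omega> * (m \<omega> \<bullet> (?v \<omega> + err r i k \<omega>)) \<partial>M)"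
      by (intro Bochner_Integration.integral_cong refl)
        (simp add: noise_def err_def inner_diff_right algebra_simps)
    also have "\<dots> = (\<integral>\<omega>. (sel r i \<omega> *\<^sub>R m \<omega>) \<bullet> noise r i k \<omega> \<partial>M) + (\<integral>\<omega>. sel r i \<omega> * (m \<omega> \<bullet> (?v \<omega> + err r i k \<omega>)) \<partial>M)"
    proof (rule Bochner_Integration.integral_add)
      show "integrable M (\<lambda>\<omega>. (sel r i \<omega> *\<^sub>R m \<omega>) \<bullet> noise r i k \<omega>)"
        using L2_inner[OF Z(1) noise_L2(1)[OF i k]] .
      show "integrable M (\<lambda>\<omega>. sel r i \<omega> * (m \<omega> \<bullet> (?v \<omega> + err r i k \<omega>)))"
        using L2_inner[OF Z(1) L2_sum] by simp
    qed
    also have "(\<integral>\<omega>. (sel r i \<omega> *\<^sub>R m \<omega>) \<bullet> noise r i k \<omega> \<partial>M) = 0"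
      using i k Z by (rule noise_orthogonal)
    also have "(\<integral>\<omega>. sel r i \<omega> * (m \<omega> \<bullet> (?v \<omega> + err r i k \<omega>)) \<partial>M)
        = real S / real N * (\<integral>\<omega>. m \<omega> \<bullet> (?v \<omega> + err r i k \<omega>) \<partial>M)"
      using i k m L2_sum m_meas past_other[OF r] local_measurable(1)
      by (intro sel_integral borel_measurable_inner borel_measurable_add err_measurable measurable_comp_H L2_inner) auto
    also have "(\<integral>\<omega>. m \<omega> \<bullet> (?v \<omega> + err r i k \<omega>) \<partial>M) = (\<integral>\<omega>. m \<omega> \<bullet> ?v \<omega> \<partial>M) + (\<integral>\<omega>. m \<omega> \<bullet> err r i k \<omega> \<partial>M)"
      unfolding inner_add_right
      using L2_inner[OF m v[OF i]] L2_inner[OF m err_L2[OF i k]] by (rule Bochner_Integration.integral_add)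
    finally show ?thesis by simp
  qed
  have young: "- (1 / 2) * grad_sq r - (1 / 2) * (\<integral>\<omega>. (norm (err r i k \<omega>))\<^sup>2 \<partial>M) \<le> (\<integral>\<omega>. m \<omega> \<bullet> err r i k \<omega> \<partial>M)"
    if i: "i \<in> {1..N}" and k: "k < K" for i k
  proof -
    have "- (1 / 2) * grad_sq r - (1 / 2) * (\<integral>\<omega>. (norm (err r i k \<omega>))\<^sup>2 \<partial>M)
        = (\<integral>\<omega>. - (1 / 2) * (norm (m \<omega>))\<^sup>2 - (1 / 2) * (norm (err r i k \<omega>))\<^sup>2 \<partial>M)"
      using L2_integrable[OF m] L2_integrable[OF err_L2[OF i k]] by (simp add: grad_sq_def m_def)
    also have "\<dots> \<le> (\<integral>\<omega>. m \<omega> \<bullet> err r i k \<omega> \<partial>M)"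
    proof (rule integral_mono)
      \<comment> \<open>This is the expanded square of \<open>m + err\<close>.\<close>
      show "- (1 / 2) * (norm (m \<omega>))\<^sup>2 - (1 / 2) * (norm (err r i k \<omega>))\<^sup>2 \<le> m \<omega> \<bullet> err r i k \<omega>" for \<omega>
        using inner_ge_zero[of "m \<omega> + err r i k \<omega>"]
        by (simp add: power2_norm_eq_inner inner_add_left inner_add_right inner_commute)
    qed (use L2_integrable[OF m] L2_integrable[OF err_L2[OF i k]] L2_inner[OF m err_L2[OF i k]] in auto)
    finally show ?thesis .
  qed
  have "(\<Sum>i=1..N. \<integral>\<omega>. m \<omega> \<bullet> gradient (f i) (x r \<omega>) \<partial>M) = (\<integral>\<omega>. (\<Sum>i=1..N. m \<omega> \<bullet> gradient (f i) (x r \<omega>)) \<partial>M)"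
    using L2_inner[OF m v] by (intro Bochner_Integration.integral_sum[symmetric]) auto
  also have "\<dots> = (\<integral>\<omega>. real N * (norm (m \<omega>))\<^sup>2 \<partial>M)"
  proof (intro Bochner_Integration.integral_cong refl)
    fix \<omega>
    have "(\<Sum>i=1..N. gradient (f i) (x r \<omega>)) = real N *\<^sub>R m \<omega>"
      using S by (simp add: m_def gradient_obj)
    then show "(\<Sum>i=1..N. m \<omega> \<bullet> gradient (f i) (x r \<omega>)) = real N * (norm (m \<omega>))\<^sup>2"
      by (simp add: power2_norm_eq_inner flip: inner_sum_right)
  qed
  also have "\<dots> = real N * grad_sq r" by (simp add: grad_sq_def m_def)
  finally have sum_v: "(\<Sum>i=1..N. \<integral>\<omega>. m \<omega> \<bullet> gradient (f i) (x r \<omega>) \<partial>M) = real N * grad_sq r" .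
  have card: "real (card calls) = real N * real K" by (simp add: calls_def)
  define T where "T = (\<Sum>p\<in>calls. \<integral>\<omega>. m \<omega> \<bullet> (sel r (fst p) \<omega> *\<^sub>R q r (fst p) (snd p) \<omega>) \<partial>M)"
  have sum_grad: "real N * real K * grad_sq r = (\<Sum>p\<in>calls. \<integral>\<omega>. m \<omega> \<bullet> gradient (f (fst p)) (x r \<omega>) \<partial>M)"
  proof -
    have "(\<Sum>p\<in>calls. \<integral>\<omega>. m \<omega> \<bullet> gradient (f (fst p)) (x r \<omega>) \<partial>M)
        = (\<Sum>i=1..N. \<Sum>k<K. \<integral>\<omega>. m \<omega> \<bullet> gradient (f i) (x r \<omega>) \<partial>M)"
      by (rule sum_calls)
    also have "\<dots> = real K * (\<Sum>i=1..N. \<integral>\<omega>. m \<omega> \<bullet> gradient (f i) (x r \<omega>) \<partial>M)"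
      by (simp add: sum_distrib_left)
    finally show ?thesis by (simp only: sum_v mult_ac)
  qed
  have "(\<Sum>p\<in>calls. (\<integral>\<omega>. m \<omega> \<bullet> gradient (f (fst p)) (x r \<omega>) \<partial>M)
        + (- (1 / 2) * grad_sq r - (1 / 2) * (\<integral>\<omega>. (norm (err r (fst p) (snd p) \<omega>))\<^sup>2 \<partial>M)))
      = (\<Sum>p\<in>calls. \<integral>\<omega>. m \<omega> \<bullet> gradient (f (fst p)) (x r \<omega>) \<partial>M)
        + (real (card calls) * (- (1 / 2) * grad_sq r)
        - (1 / 2) * (\<Sum>p\<in>calls. \<integral>\<omega>. (norm (err r (fst p) (snd p) \<omega>))\<^sup>2 \<partial>M))"
    by (simp only: sum.distrib sum_subtractf sum_distrib_left[symmetric] sum_constant)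
  also have "\<dots> = real N * real K * grad_sq r - (1 / 2) * (real N * real K * grad_sq r)
        - (1 / 2) * (\<Sum>p\<in>calls. \<integral>\<omega>. (norm (err r (fst p) (snd p) \<omega>))\<^sup>2 \<partial>M)"
    unfolding sum_grad[symmetric] card by simp
  finally have sum_split: "real N * real K * grad_sq r - (1 / 2) * (real N * real K * grad_sq r)
        - (1 / 2) * (\<Sum>p\<in>calls. \<integral>\<omega>. (norm (err r (fst p) (snd p) \<omega>))\<^sup>2 \<partial>M)
      = (\<Sum>p\<in>calls. (\<integral>\<omega>. m \<omega> \<bullet> gradient (f (fst p)) (x r \<omega>) \<partial>M)
        + (- (1 / 2) * grad_sq r - (1 / 2) * (\<integral>\<omega>. (norm (err r (fst p) (snd p) \<omega>))\<^sup>2 \<partial>M)))" by (rule sym)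
  have "real S * real K / 2 * (grad_sq r - err_sq r) =
      real S / real N * (real N * real K * grad_sq r - (1 / 2) * (real N * real K * grad_sq r)
        - (1 / 2) * (\<Sum>p\<in>calls. \<integral>\<omega>. (norm (err r (fst p) (snd p) \<omega>))\<^sup>2 \<partial>M))"
    using S K by (simp add: err_sq_def field_simps)
  also have "\<dots> \<le> real S / real N * (\<Sum>p\<in>calls. (\<integral>\<omega>. m \<omega> \<bullet> gradient (f (fst p)) (x r \<omega>) \<partial>M)
        + (\<integral>\<omega>. m \<omega> \<bullet> err r (fst p) (snd p) \<omega> \<partial>M))"
    unfolding sum_split using young p by (intro mult_left_mono sum_mono add_left_mono) auto
  also have "\<dots> = T"
    unfolding T_def sum_distrib_left using one p by (intro sum.cong) auto
  finally have T: "real S * real K / 2 * (grad_sq r - err_sq r) \<le> T" .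
  have "(\<integral>\<omega>. m \<omega> \<bullet> (x (Suc r) \<omega> - x r \<omega>) \<partial>M)
      = (\<integral>\<omega>. - (\<eta>g * \<eta>l / real S) * (\<Sum>p\<in>calls. m \<omega> \<bullet> (sel r (fst p) \<omega> *\<^sub>R q r (fst p) (snd p) \<omega>)) \<partial>M)"
  proof (intro Bochner_Integration.integral_cong refl)
    fix \<omega> assume \<omega>: "\<omega> \<in> space M"
    have "(\<Sum>i=1..N. sel r i \<omega> *\<^sub>R (\<Sum>k<K. q r i k \<omega>)) = (\<Sum>p\<in>calls. sel r (fst p) \<omega> *\<^sub>R q r (fst p) (snd p) \<omega>)"
      by (simp only: sum_calls[of "\<lambda>i k. sel r i \<omega> *\<^sub>R q r i k \<omega>"] scaleR_sum_right)
    then show "m \<omega> \<bullet> (x (Suc r) \<omega> - x r \<omega>)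
        = - (\<eta>g * \<eta>l / real S) * (\<Sum>p\<in>calls. m \<omega> \<bullet> (sel r (fst p) \<omega> *\<^sub>R q r (fst p) (snd p) \<omega>))"
      by (simp only: x_Suc_diff[OF \<omega>] inner_scaleR_right[of _ "- (\<eta>g * \<eta>l / real S)"] inner_sum_right)
  qed
  also have "\<dots> = - (\<eta>g * \<eta>l / real S) * T"
    unfolding T_def using L2_inner[OF m sel_L2[OF q_L2]] p
    by (subst integral_mult_right_zero) (simp add: Bochner_Integration.integral_sum)
  also have "\<dots> \<le> - (\<eta>g * \<eta>l / real S) * (real S * real K / 2 * (grad_sq r - err_sq r))"
    using T \<eta>l \<eta>g by (intro mult_left_mono_neg) auto
  also have "\<dots> = - (\<eta>g * \<eta>l * real K / 2) * (grad_sq r - err_sq r)"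
    using S by simp
  finally show ?thesis by (simp add: m_def)
qed

text \<open>The three parts are separated before squaring, at the cost of a factor 3, so that the
  noise keeps its linear scaling while the other two scale quadratically in
  \<open>K\<close>.\<close>

lemma update_second_moment:
  "(\<integral>\<omega>. (norm (x (Suc r) \<omega> - x r \<omega>))\<^sup>2 \<partial>M)
    \<le> (\<eta>g * \<eta>l / real S)\<^sup>2 * (3 * (real S * real K * V) + 3 * ((real S)\<^sup>2 * (real K)\<^sup>2 * err_sq r)
      + 3 * ((real K)\<^sup>2 * (2 * (real S)\<^sup>2 * grad_sq r + 2 * real S * (G\<^sup>2 + B\<^sup>2 * grad_sq r))))"
proof -
  define X where "X \<omega> = (\<Sum>p\<in>calls. sel r (fst p) \<omega> *\<^sub>R noise r (fst p) (snd p) \<omega>)" for \<omega>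
  define Y where "Y \<omega> = (\<Sum>p\<in>calls. sel r (fst p) \<omega> *\<^sub>R err r (fst p) (snd p) \<omega>)" for \<omega>
  define Z where "Z \<omega> = (\<Sum>i=1..N. sel r i \<omega> *\<^sub>R gradient (f i) (x r \<omega>))" for \<omega>
  have p: "fst p \<in> {1..N}" "snd p < K" if "p \<in> calls" for p using that by (auto simp: calls_def)
  have L2: "L2 M X" "L2 M Y" "L2 M Z"
    unfolding X_def Y_def Z_def using noise_L2(1) err_L2 p gradient_L2[OF smooth L2_x]
    by (auto intro!: L2_sum sel_L2)
  have eq: "x (Suc r) \<omega> - x r \<omega> = - (\<eta>g * \<eta>l / real S) *\<^sub>R (X \<omega> + Y \<omega> + real K *\<^sub>R Z \<omega>)"
    if "\<omega> \<in> space M" for \<omega>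
  proof -
    have "(\<Sum>k<K. q r i k \<omega>) = (\<Sum>k<K. noise r i k \<omega>) + (\<Sum>k<K. err r i k \<omega>) + real K *\<^sub>R gradient (f i) (x r \<omega>)" for i
      by (simp add: noise_def err_def sum_subtractf sum_constant_scaleR)
    then have "(\<Sum>i=1..N. sel r i \<omega> *\<^sub>R (\<Sum>k<K. q r i k \<omega>)) = X \<omega> + Y \<omega> + real K *\<^sub>R Z \<omega>"
      unfolding X_def Y_def Z_def sum_calls[of "\<lambda>i k. sel r i \<omega> *\<^sub>R noise r i k \<omega>"]
        sum_calls[of "\<lambda>i k. sel r i \<omega> *\<^sub>R err r i k \<omega>"]
      by (simp add: scaleR_add_right sum.distrib scaleR_sum_right mult.commute)
    then show ?thesis using x_Suc_diff[OF that] by simp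
  qed
  have "(\<integral>\<omega>. (norm (x (Suc r) \<omega> - x r \<omega>))\<^sup>2 \<partial>M)
      \<le> (\<integral>\<omega>. (\<eta>g * \<eta>l / real S)\<^sup>2 * (3 * (norm (X \<omega>))\<^sup>2 + 3 * (norm (Y \<omega>))\<^sup>2
        + 3 * ((real K)\<^sup>2 * (norm (Z \<omega>))\<^sup>2)) \<partial>M)"
  proof (rule integral_mono)
    show "integrable M (\<lambda>\<omega>. (norm (x (Suc r) \<omega> - x r \<omega>))\<^sup>2)"
      using L2_x_Suc L2_x by (intro L2_integrable L2_diff)
    show "integrable M (\<lambda>\<omega>. (\<eta>g * \<eta>l / real S)\<^sup>2 * (3 * (norm (X \<omega>))\<^sup>2 + 3 * (norm (Y \<omega>))\<^sup>2
        + 3 * ((real K)\<^sup>2 * (norm (Z \<omega>))\<^sup>2)))"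
      using L2[THEN L2_integrable] by (intro integrable_mult_right Bochner_Integration.integrable_add)
    fix \<omega> assume "\<omega> \<in> space M"
    from eq[OF this] show "(norm (x (Suc r) \<omega> - x r \<omega>))\<^sup>2
        \<le> (\<eta>g * \<eta>l / real S)\<^sup>2 * (3 * (norm (X \<omega>))\<^sup>2 + 3 * (norm (Y \<omega>))\<^sup>2 + 3 * ((real K)\<^sup>2 * (norm (Z \<omega>))\<^sup>2))"
      using mult_left_mono[OF norm_add3_squared_le[of "X \<omega>" "Y \<omega>" "real K *\<^sub>R Z \<omega>"], of "(\<eta>g * \<eta>l / real S)\<^sup>2"]
      by (simp only: norm_scaleR power_mult_distrib power2_abs power2_minus zero_le_power2)
  qed
  also have "\<dots> = (\<eta>g * \<eta>l / real S)\<^sup>2 * (3 * (\<integral>\<omega>. (norm (X \<omega>))\<^sup>2 \<partial>M) + 3 * (\<integral>\<omega>. (norm (Y \<omega>))\<^sup>2 \<partial>M)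
        + 3 * ((real K)\<^sup>2 * (\<integral>\<omega>. (norm (Z \<omega>))\<^sup>2 \<partial>M)))"
    using L2[THEN L2_integrable] by simp
  also have "\<dots> \<le> (\<eta>g * \<eta>l / real S)\<^sup>2 * (3 * (real S * real K * V) + 3 * ((real S)\<^sup>2 * (real K)\<^sup>2 * err_sq r)
      + 3 * ((real K)\<^sup>2 * (2 * (real S)\<^sup>2 * grad_sq r + 2 * real S * (G\<^sup>2 + B\<^sup>2 * grad_sq r))))"
  proof -
    have "2 * (real S / real N) * (\<Sum>i=1..N. local_grad_sq r i) \<le> 2 * (real S / real N) * (real N * (G\<^sup>2 + B\<^sup>2 * grad_sq r))"
      using dissimilarity_sq by (intro mult_left_mono) auto
    also have "\<dots> = 2 * real S * (G\<^sup>2 + B\<^sup>2 * grad_sq r)" using S by simp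
    finally have "(\<integral>\<omega>. (norm (Z \<omega>))\<^sup>2 \<partial>M) \<le> 2 * (real S)\<^sup>2 * grad_sq r + 2 * real S * (G\<^sup>2 + B\<^sup>2 * grad_sq r)"
      using grad_sum by (simp add: Z_def)
    then show ?thesis
      using noise_sum err_sum by (intro mult_left_mono add_mono) (auto simp: X_def Y_def)
  qed
  finally show ?thesis .
qed

lemma expected_descent:
  "(\<integral>\<omega>. obj (x (Suc r) \<omega>) \<partial>M) \<le> (\<integral>\<omega>. obj (x r \<omega>) \<partial>M)
    + (\<integral>\<omega>. gradient obj (x r \<omega>) \<bullet> (x (Suc r) \<omega> - x r \<omega>) \<partial>M)
    + \<beta> * (\<integral>\<omega>. (norm (x (Suc r) \<omega> - x r \<omega>))\<^sup>2 \<partial>M)"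
proof -
  have d: "L2 M (\<lambda>\<omega>. x (Suc r) \<omega> - x r \<omega>)"
    using L2_x_Suc L2_x by (rule L2_diff)
  note ints = obj_integrable[OF L2_x] L2_inner[OF gradient_L2[OF smooth_obj L2_x] d]
    integrable_mult_right[OF L2_integrable[OF d], of \<beta>]
  have "(\<integral>\<omega>. obj (x (Suc r) \<omega>) \<partial>M) \<le> (\<integral>\<omega>. obj (x r \<omega>)
      + gradient obj (x r \<omega>) \<bullet> (x (Suc r) \<omega> - x r \<omega>) + \<beta> * (norm (x (Suc r) \<omega> - x r \<omega>))\<^sup>2 \<partial>M)"
  proof (rule integral_mono)
    show "integrable M (\<lambda>\<omega>. obj (x (Suc r) \<omega>))" by (rule obj_integrable[OF L2_x_Suc])
    show "integrable M (\<lambda>\<omega>. obj (x r \<omega>) + gradient obj (x r \<omega>) \<bullet> (x (Suc r) \<omega> - x r \<omega>)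
        + \<beta> * (norm (x (Suc r) \<omega> - x r \<omega>))\<^sup>2)"
      using ints by (intro Bochner_Integration.integrable_add)
    show "obj (x (Suc r) \<omega>) \<le> obj (x r \<omega>)
        + gradient obj (x r \<omega>) \<bullet> (x (Suc r) \<omega> - x r \<omega>) + \<beta> * (norm (x (Suc r) \<omega> - x r \<omega>))\<^sup>2" for \<omega>
      using beta_smooth_descent[OF smooth_obj, of "x r \<omega>" "x (Suc r) \<omega> - x r \<omega>"] by simp
  qed
  also have "\<dots> = (\<integral>\<omega>. obj (x r \<omega>) \<partial>M)
    + (\<integral>\<omega>. gradient obj (x r \<omega>) \<bullet> (x (Suc r) \<omega> - x r \<omega>) \<partial>M)
    + \<beta> * (\<integral>\<omega>. (norm (x (Suc r) \<omega> - x r \<omega>))\<^sup>2 \<partial>M)"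
    using ints by (simp only: Bochner_Integration.integral_add Bochner_Integration.integrable_add integral_mult_right_zero)
  finally show ?thesis .
qed

end

text \<open>Closes the loop: the estimates of a round assume square integrability at its start and
  deliver it at its end.\<close>

lemma x_L2: "r \<le> R \<Longrightarrow> L2 M (x r)"
proof (induction r)
  case 0
  then show ?case by (simp add: x_def L2_const)
next
  case (Suc r)
  then show ?case by (intro L2_x_Suc) auto
qed

section \<open>Summation over the rounds\<close>

text \<open>What \<open>round_arithmetic\<close> leaves per unit of effective step size once the
  gradient terms are absorbed.\<close>

definition residual :: real where
  "residual = 3 * Uq\<^sup>2 + 16 * (\<beta> * \<eta>l * real K)\<^sup>2 * (V + G\<^sup>2)
    + 3 * (\<beta> * (\<eta>g * \<eta>l * real K)) * (V / (real S * real K) + 2 * G\<^sup>2 / real S)"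

lemma round_descent:
  assumes r: "r < R" and small: "(1 + B\<^sup>2) * (\<beta> * (\<eta>g * \<eta>l * real K)) \<le> 1 / 1000"
  shows "\<eta>g * \<eta>l * real K / 4 * grad_sq r
    \<le> (\<integral>\<omega>. obj (x r \<omega>) \<partial>M) - (\<integral>\<omega>. obj (x (Suc r) \<omega>) \<partial>M) + \<eta>g * \<eta>l * real K * residual"
proof -
  let ?\<eta> = "\<eta>g * \<eta>l * real K"
  let ?b = "\<beta> * \<eta>l * real K"
  have L2: "L2 M (x r)" using r by (intro x_L2) simp
  have \<eta>: "0 \<le> ?\<eta>" using \<eta>g \<eta>l by simp
  \<comment> \<open>This is where \<open>1 \<le> \<eta>g\<close> enters: the local displacement
    scale \<open>\<eta>l * K\<close> is at most the effective step size.\<close>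
  have b: "?b \<le> \<beta> * ?\<eta>"
  proof -
    have "\<beta> * \<eta>l * real K * 1 \<le> \<beta> * \<eta>l * real K * \<eta>g"
      using \<eta>g \<eta>l \<beta>_nonneg by (intro mult_left_mono) auto
    then show ?thesis by (simp add: mult_ac)
  qed
  have b0: "0 \<le> ?b" using \<eta>l \<beta>_nonneg by simp
  have a: "\<beta> * ?\<eta> \<le> 1 / 1000"
    using small mult_nonneg_nonneg[OF zero_le_power2[of B] mult_nonneg_nonneg[OF \<beta>_nonneg \<eta>]]
    by (simp only: distrib_right)
  \<comment> \<open>The step-size condition is far stronger than what \<open>drift\<close>
    demands.\<close>
  have "?b\<^sup>2 \<le> (1 / 1000)\<^sup>2" using b a b0 by (intro power_mono) auto
  then have b_small: "8 * ?b\<^sup>2 \<le> 1" by (simp add: power2_eq_square)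
  have eq: "\<eta>g * \<eta>l / real S = ?\<eta> / (real S * real K)" using K by simp
  have "(\<integral>\<omega>. obj (x (Suc r) \<omega>) \<partial>M) - (\<integral>\<omega>. obj (x r \<omega>) \<partial>M)
      \<le> - (?\<eta> / 2) * (grad_sq r - err_sq r)
      + \<beta> * ((?\<eta> / (real S * real K))\<^sup>2 * (3 * (real S * real K * V) + 3 * ((real S)\<^sup>2 * (real K)\<^sup>2 * err_sq r)
      + 3 * ((real K)\<^sup>2 * (2 * (real S)\<^sup>2 * grad_sq r + 2 * real S * (G\<^sup>2 + B\<^sup>2 * grad_sq r)))))"
    using expected_descent[OF r L2] expected_progress[OF r L2]
      mult_left_mono[OF update_second_moment[OF r L2] \<beta>_nonneg] unfolding eq by linarith
  from round_arithmetic[OF this err_sq_le[OF r L2 b_small] \<eta> \<beta>_nonneg _ V_nonneg _ _ b0 _ small b]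
  show ?thesis
    using S K by (simp add: residual_def grad_sq_def err_sq_def sum_nonneg)
qed

lemma sum_rounds:
  assumes small: "(1 + B\<^sup>2) * (\<beta> * (\<eta>g * \<eta>l * real K)) \<le> 1 / 1000" and "n \<le> R"
  shows "\<eta>g * \<eta>l * real K / 4 * (\<Sum>r<n. grad_sq r)
    \<le> obj x0 - (\<integral>\<omega>. obj (x n \<omega>) \<partial>M) + real n * (\<eta>g * \<eta>l * real K * residual)"
  using \<open>n \<le> R\<close>
proof (induction n)
  case 0
  then show ?case by (simp add: x_def prob_space)
next
  case (Suc n)
  then show ?case
    using round_descent[of n] small by (simp add: algebra_simps)
qed

text \<open>The output round is fresh relative to all draws that determine the iterates, so the
  indicator of each round factors out with weight \<open>1 / R\<close>.\<close>

lemma output_moment: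
  shows "integrable M (\<lambda>\<omega>. (norm (gradient obj (x (\<tau> \<omega>) \<omega>)))\<^sup>2)"
    and "(\<integral>\<omega>. (norm (gradient obj (x (\<tau> \<omega>) \<omega>)))\<^sup>2 \<partial>M) = (\<Sum>r<R. grad_sq r) / real R"
proof -
  define h where "h r \<omega> = (norm (gradient obj (x r \<omega>)))\<^sup>2" for r \<omega>
  have sel: "integrable M (\<lambda>\<omega>. of_bool (\<tau> \<omega> = r) * h r \<omega>)"
    "(\<integral>\<omega>. of_bool (\<tau> \<omega> = r) * h r \<omega> \<partial>M) = grad_sq r / real R" if "r < R" for r
  proof -
    have meas: "(\<lambda>t. of_bool (t = r) :: real) \<in> borel_measurable (uniform_count_measure {..<R})"
      by (simp add: measurable_def sets_uniform_count_measure space_uniform_count_measure)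
    have [measurable]: "(\<lambda>\<omega>. gradient obj (x r \<omega>)) \<in> borel_measurable (gen (draws N K R - {Output}))"
      using that past_output by (intro measurable_comp_H x_measurable) auto
    have h: "h r \<in> borel_measurable (gen (draws N K R - {Output}))" "integrable M (h r)"
      unfolding h_def[abs_def] using L2_integrable[OF gradient_L2[OF smooth_obj x_L2]] that by auto
    note * = fresh_product[OF fresh_output meas, of 1, OF _ h]
    show "integrable M (\<lambda>\<omega>. of_bool (\<tau> \<omega> = r) * h r \<omega>)" using *(1) by simp
    show "(\<integral>\<omega>. of_bool (\<tau> \<omega> = r) * h r \<omega> \<partial>M) = grad_sq r / real R"
      using *(2) that by (simp add: integral_uniform_count_measure grad_sq_def h_def of_bool_def)
  qed
  have eq: "h (\<tau> \<omega>) \<omega> = (\<Sum>r<R. of_bool (\<tau> \<omega> = r) * h r \<omega>)" if "\<omega> \<in> space M" for \<omega>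
  proof -
    have "\<tau> \<omega> < R"
      using measurable_space[OF fresh_measurable[OF fresh_output] that] by (simp add: space_uniform_count_measure)
    then have "h (\<tau> \<omega>) \<omega> = (\<Sum>r<R. if \<tau> \<omega> = r then h r \<omega> else 0)" by simp
    also have "\<dots> = (\<Sum>r<R. of_bool (\<tau> \<omega> = r) * h r \<omega>)" by (intro sum.cong) auto
    finally show ?thesis .
  qed
  have int: "integrable M (\<lambda>\<omega>. \<Sum>r<R. of_bool (\<tau> \<omega> = r) * h r \<omega>)"
    using sel by (intro Bochner_Integration.integrable_sum) auto
  show "integrable M (\<lambda>\<omega>. (norm (gradient obj (x (\<tau> \<omega>) \<omega>)))\<^sup>2)"
    unfolding h_def[symmetric] by (subst Bochner_Integration.integrable_cong[OF refl eq]) (use int in auto)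
  have "(\<integral>\<omega>. h (\<tau> \<omega>) \<omega> \<partial>M) = (\<integral>\<omega>. (\<Sum>r<R. of_bool (\<tau> \<omega> = r) * h r \<omega>) \<partial>M)"
    using eq by (rule Bochner_Integration.integral_cong[OF refl])
  also have "\<dots> = (\<Sum>r<R. grad_sq r / real R)"
    using sel by (subst Bochner_Integration.integral_sum) auto
  finally show "(\<integral>\<omega>. (norm (gradient obj (x (\<tau> \<omega>) \<omega>)))\<^sup>2 \<partial>M) = (\<Sum>r<R. grad_sq r) / real R"
    by (simp add: h_def sum_divide_distrib)
qed

lemma convergence:
  assumes small: "(1 + B\<^sup>2) * (\<beta> * (\<eta>g * \<eta>l * real K)) \<le> 1 / 1000" and bdd: "bdd_below (range obj)"
  shows "(\<integral>\<omega>. (norm (gradient obj (x (\<tau> \<omega>) \<omega>)))\<^sup>2 \<partial>M)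
    \<le> 4 * ((obj x0 - (INF u. obj u)) / (\<eta>g * \<eta>l * real K * real R)) + 4 * residual"
proof -
  define \<eta> where "\<eta> = \<eta>g * \<eta>l * real K"
  have \<eta>: "0 < \<eta>" using \<eta>g \<eta>l K by (simp add: \<eta>_def)
  \<comment> \<open>Boundedness from below makes the infimum a genuine lower bound for the last
    iterate, which ends the telescoping.\<close>
  have "(\<integral>\<omega>. (INF u. obj u) \<partial>M) \<le> (\<integral>\<omega>. obj (x R \<omega>) \<partial>M)"
    using obj_integrable[OF x_L2] bdd by (intro integral_mono cINF_lower) auto
  then have "(INF u. obj u) \<le> (\<integral>\<omega>. obj (x R \<omega>) \<partial>M)" by (simp add: prob_space)
  then have "\<eta> / 4 * (\<Sum>r<R. grad_sq r) \<le> (obj x0 - (INF u. obj u)) + real R * (\<eta> * residual)"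
    using sum_rounds[OF small, of R] by (simp add: \<eta>_def)
  then have "(\<Sum>r<R. grad_sq r) / real R \<le> 4 * ((obj x0 - (INF u. obj u)) / (\<eta> * real R)) + 4 * residual"
    using \<eta> R by (simp add: field_simps)
  then show ?thesis by (simp add: output_moment(2) \<eta>_def)
qed

end

section \<open>The convergence theorem\<close>

theorem theorem1:
  shows "\<exists>c0 C :: real. 0 < c0 \<and> 1 / 1000 \<le> c0 \<and> 0 < C \<and> C \<le> 1000 \<and>
    (\<forall>(N::nat) (S::nat) (K::nat) (R::nat)
       (f :: nat \<Rightarrow> 'a::euclidean_space \<Rightarrow> real) (\<beta>::real) (G::real) (B::real)
       (D :: nat \<Rightarrow> 'x measure) (Q :: nat \<Rightarrow> 'q measure)
       (g :: nat \<Rightarrow> 'a \<Rightarrow> 'x \<Rightarrow> 'a) (gq :: nat \<Rightarrow> 'a \<Rightarrow> 'x \<Rightarrow> 'q \<Rightarrow> 'a)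
       (\<sigma>::real) (Uq::real) (\<sigma>q::real) (\<eta>l::real) (\<eta>g::real) (x0::'a)
       (M :: 'w measure) (A :: nat \<Rightarrow> 'w \<Rightarrow> nat set)
       (\<xi> :: nat \<Rightarrow> nat \<Rightarrow> nat \<Rightarrow> 'w \<Rightarrow> 'x) (\<zeta> :: nat \<Rightarrow> nat \<Rightarrow> nat \<Rightarrow> 'w \<Rightarrow> 'q) (\<tau> :: 'w \<Rightarrow> nat).
       1 \<le> S \<longrightarrow> S \<le> N \<longrightarrow> 1 \<le> K \<longrightarrow> 1 \<le> R \<longrightarrow>
       (\<forall>i\<in>{1..N}. beta_smooth \<beta> (f i)) \<longrightarrow>
       0 \<le> G \<longrightarrow> 1 \<le> B \<longrightarrow> bounded_gradient_dissimilarity G B N f \<longrightarrow>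
       (\<forall>i\<in>{1..N}. stochastic_oracle (D i) (f i) (g i) (\<sigma>\<^sup>2)) \<longrightarrow>
       (\<forall>i\<in>{1..N}. biased_quantum_oracle (D i) (Q i) (g i) (gq i) Uq (\<sigma>q\<^sup>2)) \<longrightarrow>
       bdd_below (range (global_objective N f)) \<longrightarrow>
       0 < \<eta>l \<longrightarrow> 1 \<le> \<eta>g \<longrightarrow>
       (0 < \<beta> \<longrightarrow> \<eta>l \<le> c0 / ((1 + B\<^sup>2) * \<beta> * real K * \<eta>g)) \<longrightarrow>
       fedavg_randomness N S K R D Q M A \<xi> \<zeta> \<tau> \<longrightarrow>
       (let F = global_objective N f x0 - (INF x. global_objective N f x);
            \<eta> = \<eta>g * \<eta>l * real K;
            xs = (\<lambda>r \<omega>. server_iterate S K \<eta>l \<eta>g gq (\<lambda>r. A r \<omega>)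
                    (\<lambda>r i k. \<xi> r i k \<omega>) (\<lambda>r i k. \<zeta> r i k \<omega>) x0 r);
            xbar = (\<lambda>\<omega>. xs (\<tau> \<omega>) \<omega>)
        in integrable M (\<lambda>\<omega>. (norm (gradient (global_objective N f) (xbar \<omega>)))\<^sup>2) \<and>
           (\<integral>\<omega>. (norm (gradient (global_objective N f) (xbar \<omega>)))\<^sup>2 \<partial>M)
             \<le> C * (F / (\<eta> * real R)
                  + \<beta> * \<eta> * (G\<^sup>2 / real S + (\<sigma>\<^sup>2 + \<sigma>q\<^sup>2) / (real K * real S))
                  + \<beta>\<^sup>2 * \<eta>l\<^sup>2 * (real K)\<^sup>2 * (G\<^sup>2 + \<sigma>\<^sup>2 + \<sigma>q\<^sup>2)
                  + Uq\<^sup>2)))"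
\<comment> \<open>The first constant is the smallness used by \<open>round_arithmetic\<close>. The
  second is generous: the largest coefficient that occurs is 128.\<close>
proof (rule exI[of _ "1 / 1000"], rule exI[of _ 1000], intro conjI allI impI)
  fix N S K R :: nat and f :: "nat \<Rightarrow> 'a \<Rightarrow> real" and \<beta> G B :: real
    and D :: "nat \<Rightarrow> 'x measure" and Q :: "nat \<Rightarrow> 'q measure"
    and g :: "nat \<Rightarrow> 'a \<Rightarrow> 'x \<Rightarrow> 'a" and gq :: "nat \<Rightarrow> 'a \<Rightarrow> 'x \<Rightarrow> 'q \<Rightarrow> 'a"
    and \<sigma> Uq \<sigma>q \<eta>l \<eta>g :: real and x0 :: 'a
    and M :: "'w measure" and A :: "nat \<Rightarrow> 'w \<Rightarrow> nat set"
    and \<xi> :: "nat \<Rightarrow> nat \<Rightarrow> nat \<Rightarrow> 'w \<Rightarrow> 'x" and \<zeta> :: "nat \<Rightarrow> nat \<Rightarrow> nat \<Rightarrow> 'w \<Rightarrow> 'q" and \<tau> :: "'w \<Rightarrow> nat"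
  assume asm: "1 \<le> S" "S \<le> N" "1 \<le> K" "1 \<le> R" "\<forall>i\<in>{1..N}. beta_smooth \<beta> (f i)"
    "0 \<le> G" "1 \<le> B" "bounded_gradient_dissimilarity G B N f"
    "\<forall>i\<in>{1..N}. stochastic_oracle (D i) (f i) (g i) (\<sigma>\<^sup>2)"
    "\<forall>i\<in>{1..N}. biased_quantum_oracle (D i) (Q i) (g i) (gq i) Uq (\<sigma>q\<^sup>2)"
    and bdd: "bdd_below (range (global_objective N f))"
    and \<eta>: "0 < \<eta>l" "1 \<le> \<eta>g" "0 < \<beta> \<longrightarrow> \<eta>l \<le> 1 / 1000 / ((1 + B\<^sup>2) * \<beta> * real K * \<eta>g)"
    and rnd: "fedavg_randomness N S K R D Q M A \<xi> \<zeta> \<tau>"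
  interpret fedavg N S K R f \<beta> G B D Q g gq \<sigma> Uq \<sigma>q \<eta>l \<eta>g x0 M A \<xi> \<zeta> \<tau>
    using asm \<eta> rnd by unfold_locales auto
  let ?\<eta> = "\<eta>g * \<eta>l * real K"
  define F where "F = obj x0 - (INF u. obj u)"
  have bdd': "bdd_below (range obj)" using bdd by (simp add: obj_def)
  \<comment> \<open>The sign is used when the coefficient of \<open>F\<close> is raised from 4 to
    the common constant.\<close>
  have F: "0 \<le> F" using bdd' by (simp add: F_def cINF_lower)
  have small: "(1 + B\<^sup>2) * (\<beta> * ?\<eta>) \<le> 1 / 1000"
  \<comment> \<open>For \<beta> = 0 the guarded step-size condition says nothing, but then the
    product to be bounded is zero.\<close>
  proof (cases "\<beta> = 0")
    case False
    then have "0 < \<beta>" using \<beta>_nonneg by simp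
    then have pos: "0 < (1 + B\<^sup>2) * \<beta> * real K * \<eta>g"
      using \<eta> asm(3) by (intro mult_pos_pos) (auto simp: add_pos_nonneg)
    have "\<eta>l \<le> 1 / 1000 / ((1 + B\<^sup>2) * \<beta> * real K * \<eta>g)" using \<eta> \<open>0 < \<beta>\<close> by simp
    then have "\<eta>l * ((1 + B\<^sup>2) * \<beta> * real K * \<eta>g) \<le> 1 / 1000"
      using pos by (simp only: pos_le_divide_eq)
    then show ?thesis by (simp only: mult_ac)
  qed simp
  have bound: "4 * (F / (?\<eta> * real R)) + 4 * residual
      \<le> 1000 * (F / (?\<eta> * real R)
        + \<beta> * ?\<eta> * (G\<^sup>2 / real S + (\<sigma>\<^sup>2 + \<sigma>q\<^sup>2) / (real K * real S))
        + \<beta>\<^sup>2 * \<eta>l\<^sup>2 * (real K)\<^sup>2 * (G\<^sup>2 + \<sigma>\<^sup>2 + \<sigma>q\<^sup>2) + Uq\<^sup>2)"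
  proof -
    define T1 where "T1 = F / (?\<eta> * real R)"
    define T2 where "T2 = \<beta> * ?\<eta> * (G\<^sup>2 / real S)"
    define T3 where "T3 = \<beta> * ?\<eta> * ((\<sigma>\<^sup>2 + \<sigma>q\<^sup>2) / (real K * real S))"
    define T4 where "T4 = (\<beta> * \<eta>l * real K)\<^sup>2 * G\<^sup>2"
    define T5 where "T5 = (\<beta> * \<eta>l * real K)\<^sup>2 * (\<sigma>\<^sup>2 + \<sigma>q\<^sup>2)"
    have nonneg: "0 \<le> T1" "0 \<le> T2" "0 \<le> T3" "0 \<le> T4" "0 \<le> T5" "0 \<le> Uq\<^sup>2"
      using F \<eta> \<beta>_nonneg by (auto simp: T1_def T2_def T3_def T4_def T5_def)
    \<comment> \<open>Unfolding \<open>V\<close> doubles the coefficients 16 and 3 of the variance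
      terms. After the factor 4 from \<open>convergence\<close>, the drift part of the variances has
      the largest coefficient, 4 * 32.\<close>
    have "residual = 3 * Uq\<^sup>2 + 32 * T5 + 16 * T4 + 6 * T3 + 6 * T2"
      by (simp add: residual_def V_def T2_def T3_def T4_def T5_def algebra_simps add_divide_distrib)
    then have "4 * T1 + 4 * residual \<le> 1000 * (T1 + (T2 + T3) + (T4 + T5) + Uq\<^sup>2)"
      using nonneg by simp
    also have "T2 + T3 = \<beta> * ?\<eta> * (G\<^sup>2 / real S + (\<sigma>\<^sup>2 + \<sigma>q\<^sup>2) / (real K * real S))"
      by (simp add: T2_def T3_def distrib_left)
    also have "T4 + T5 = \<beta>\<^sup>2 * \<eta>l\<^sup>2 * (real K)\<^sup>2 * (G\<^sup>2 + \<sigma>\<^sup>2 + \<sigma>q\<^sup>2)"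
      by (simp add: T4_def T5_def power_mult_distrib distrib_left)
    finally show ?thesis by (simp only: T1_def)
  qed
  show "let F = global_objective N f x0 - (INF x. global_objective N f x);
            \<eta> = \<eta>g * \<eta>l * real K;
            xs = (\<lambda>r \<omega>. server_iterate S K \<eta>l \<eta>g gq (\<lambda>r. A r \<omega>)
                    (\<lambda>r i k. \<xi> r i k \<omega>) (\<lambda>r i k. \<zeta> r i k \<omega>) x0 r);
            xbar = (\<lambda>\<omega>. xs (\<tau> \<omega>) \<omega>)
        in integrable M (\<lambda>\<omega>. (norm (gradient (global_objective N f) (xbar \<omega>)))\<^sup>2) \<and>
           (\<integral>\<omega>. (norm (gradient (global_objective N f) (xbar \<omega>)))\<^sup>2 \<partial>M)
             \<le> 1000 * (F / (\<eta> * real R)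
                  + \<beta> * \<eta> * (G\<^sup>2 / real S + (\<sigma>\<^sup>2 + \<sigma>q\<^sup>2) / (real K * real S))
                  + \<beta>\<^sup>2 * \<eta>l\<^sup>2 * (real K)\<^sup>2 * (G\<^sup>2 + \<sigma>\<^sup>2 + \<sigma>q\<^sup>2)
                  + Uq\<^sup>2)"
    unfolding Let_def obj_def[symmetric] x_def[symmetric] F_def[symmetric]
    using output_moment(1) order_trans[OF convergence[OF small bdd', folded F_def] bound] by (rule conjI)
qed simp_all

end
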